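(* Let $\Gamma$ be a compact metric graph, $\kappa,\tau>0$, $\alpha>\frac12$, and let $u$ be the solution of $L^{\alpha/2}(\tau u)=\mathcal{W}$ on $\Gamma$, where $L=\kappa^2-\Delta_\Gamma$ with $\Delta_\Gamma$ the Kirchhoff Laplacian and $\mathcal{W}$ is Gaussian white noise on $L_2(\Gamma)$. Let $\alpha^\ast=\lceil\alpha-\frac12\rceil-1$, where $\lceil a\rceil$ is the smallest integer larger than or equal to $a$. Then: (i) for every $\epsilon>0$, $u\in L_2(\Omega;\dot H^{\alpha-\frac12-\epsilon})$; (ii) $u\in H^1(\Gamma)$ $\mathbb{P}$-a.s. if and only if $\alpha>\frac32$; (iii) for $j=1,\dots,\alpha^\ast$, the weak derivative $D^ju$ exists $\mathbb{P}$-a.s.; (iv) if $\alpha\ge2$ and $k$ is an odd integer with $1\le k\le\alpha^\ast-1$, then $\mathbb{P}$-a.s. $\sum_{e\in\mathcal{E}_v}\partial_e^ku(v)=0$ for every $v\in\mathcal{V}$, where $\partial_e^ku$ is the directional derivative of $D^{k-1}u$.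
   Context: Graph. A compact metric graph $\Gamma$ is a connected graph with a finite set $\mathcal{V}$ of vertices and a finite set $\mathcal{E}$ of edges (loops and multiple edges allowed); each edge $e$ joins a pair of vertices, has a length $\ell_e\in(0,\infty)$, and is identified with the interval $[0,\ell_e]$, its endpoints being identified with its vertices. $\mathcal{E}_v$ denotes the edges incident to $v\in\mathcal{V}$. A function $f$ on $\Gamma$ is a collection $\{f_e\}_{e\in\mathcal{E}}$ of functions on $[0,\ell_e]$. $L_2(\Gamma)=\bigoplus_{e}L_2(e)$ (Lebesgue measure on each edge); $C(\Gamma)$ is the space of continuous functions on $\Gamma$; $\widetilde H^k(\Gamma)=\bigoplus_e H^k(e)$; $H^1(\Gamma)=C(\Gamma)\cap\widetilde H^1(\Gamma)$. $D^jf$ is the edgewise weak derivative of order $j$, in $L_2(\Gamma)$. Operator. The Kirchhoff Laplacian $\Delta_\Gamma$ acts as $f_e\mapsto f_e''$ on each edge, with domain $\{f\in\widetilde H^2(\Gamma)\cap C(\Gamma): \sum_{e\in\mathcal{E}_v}\partial_e f(v)=0\ \forall v\in\mathcal{V}\}$, where $\partial_e$ is the derivative along $e$ in the direction away from $v$ (in sums over $\mathcal{E}_v$ a loop at $v$ contributes one term for each of its two ends). $L=\kappa^2-\Delta_\Gamma$ is self-adjoint, positive definite, with discrete spectrum; $\{\varphi_i\}_{i\in\mathbb{N}}$ is an $L_2(\Gamma)$-orthonormal eigenbasis with eigenvalues $0<\lambda_1\le\lambda_2\le\cdots$, and $L^{\beta}\phi=\sum_i\lambda_i^{\beta}(\phi,\varphi_i)_{L_2(\Gamma)}\varphi_i$.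 For $\beta\ge0$, $\dot H^\beta=\{\phi\in L_2(\Gamma):\|\phi\|_\beta^2:=\sum_i\lambda_i^\beta(\phi,\varphi_i)_{L_2(\Gamma)}^2<\infty\}$; $\dot H^{-\beta}$ is the dual of $\dot H^{\beta}$, with norm $\|\phi\|_{-\beta}^2=\sum_i\lambda_i^{-\beta}\langle\phi,\varphi_i\rangle^2$. Field. $\mathcal{W}$ is Gaussian white noise on $L_2(\Gamma)$ over a complete probability space $(\Omega,\mathcal{F},\mathbb{P})$: a centered Gaussian family $\{\mathcal{W}(h):h\in L_2(\Gamma)\}$ with $\mathbb{E}[\mathcal{W}(h)\mathcal{W}(g)]=(h,g)_{L_2(\Gamma)}$. For $\alpha>\frac12$, the equation $L^{\alpha/2}(\tau u)=\mathcal{W}$ has a unique solution, the centered Gaussian $L_2(\Gamma)$-valued random variable with $(u,\psi)_{L_2(\Gamma)}=\mathcal{W}(\tau^{-1}L^{-\alpha/2}\psi)$ a.s. for all $\psi\in L_2(\Gamma)$. $L_2(\Omega;E)$ denotes $E$-valued Bochner measurable random variables with finite second moment. *)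

theory Defs
  imports "HOL-Probability.Probability" "Graph_Theory.Digraph_Component"
begin

section \<open>Compact metric graphs\<close>

text \<open>
  An edge \<open>e\<close> is the interval from \<open>0\<close> to \<open>len \<Gamma> e\<close>; the digraph orientation only records which
  endpoint is glued to which vertex (\<open>0\<close> to the tail, \<open>len \<Gamma> e\<close> to the head). Library digraphs admit
  loops and multiple arcs, and \<open>Digraph_Component.connected\<close> ignores orientation.
\<close>

record ('v, 'e) metric_graph =
  shape :: "('v, 'e) pre_digraph"
  len :: "'e \<Rightarrow> real"

text \<open>
  At least one edge is required: over a single point \<open>L\<^sub>2\<close> is trivial and has no eigenbasis
  indexed by the natural numbers.
\<close>

definition compact_metric_graph :: "('v, 'e) metric_graph \<Rightarrow> bool" where
  "compact_metric_graph \<Gamma> \<longleftrightarrow>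
     fin_digraph (shape \<Gamma>) \<and> Digraph_Component.connected (shape \<Gamma>) \<and>
     arcs (shape \<Gamma>) \<noteq> {} \<and> (\<forall>e\<in>arcs (shape \<Gamma>). 0 < len \<Gamma> e)"

abbreviation edge_measure :: "('v, 'e) metric_graph \<Rightarrow> 'e \<Rightarrow> real measure" where
  "edge_measure \<Gamma> e \<equiv> lebesgue_on {0..len \<Gamma> e}"

text \<open>
  A function on the graph is a family of functions on the edges. Elements of \<open>L\<^sub>2\<close> are handled
  through representatives; all notions of function below are invariant under edgewise a.e. equality, except
  \<open>continuous_on_graph\<close>, which is about a genuine function. Values at edges outside the graph and
  at points outside an edge are never used.
\<close>

type_synonym 'e graph_fun = "'e \<Rightarrow> real \<Rightarrow> real"

definition ae_eq :: "('v, 'e) metric_graph \<Rightarrow> 'e graph_fun \<Rightarrow> 'e graph_fun \<Rightarrow> bool" where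
  "ae_eq \<Gamma> f g \<longleftrightarrow> (\<forall>e\<in>arcs (shape \<Gamma>). AE x in edge_measure \<Gamma> e. f e x = g e x)"

definition L2 :: "('v, 'e) metric_graph \<Rightarrow> 'e graph_fun set" where
  "L2 \<Gamma> = {f. \<forall>e\<in>arcs (shape \<Gamma>). f e \<in> borel_measurable (edge_measure \<Gamma> e) \<and>
                 integrable (edge_measure \<Gamma> e) (\<lambda>x. (f e x)\<^sup>2)}"

definition L2_inner :: "('v, 'e) metric_graph \<Rightarrow> 'e graph_fun \<Rightarrow> 'e graph_fun \<Rightarrow> real" where
  "L2_inner \<Gamma> f g = (\<Sum>e\<in>arcs (shape \<Gamma>). \<integral>x. f e x * g e x \<partial>(edge_measure \<Gamma> e))"

definition L2_norm :: "('v, 'e) metric_graph \<Rightarrow> 'e graph_fun \<Rightarrow> real" where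
  "L2_norm \<Gamma> f = sqrt (L2_inner \<Gamma> f f)"

definition continuous_on_graph :: "('v, 'e) metric_graph \<Rightarrow> 'e graph_fun \<Rightarrow> bool" where
  "continuous_on_graph \<Gamma> f \<longleftrightarrow>
     (\<forall>e\<in>arcs (shape \<Gamma>). continuous_on {0..len \<Gamma> e} (f e)) \<and>
     (\<exists>val. \<forall>e\<in>arcs (shape \<Gamma>).
        f e 0 = val (tail (shape \<Gamma>) e) \<and> f e (len \<Gamma> e) = val (head (shape \<Gamma>) e))"

definition C_space :: "('v, 'e) metric_graph \<Rightarrow> 'e graph_fun set" where
  "C_space \<Gamma> = {f. \<exists>c. continuous_on_graph \<Gamma> c \<and> ae_eq \<Gamma> f c}"

section \<open>Weak derivatives and Sobolev spaces\<close>

definition test_function :: "real \<Rightarrow> (real \<Rightarrow> real) \<Rightarrow> bool" where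
  "test_function l \<eta> \<longleftrightarrow>
     (\<forall>n x. ((deriv ^^ n) \<eta>) field_differentiable (at x)) \<and>
     closure {x. \<eta> x \<noteq> 0} \<subseteq> {0<..<l}"

definition has_weak_deriv ::
    "('v, 'e) metric_graph \<Rightarrow> nat \<Rightarrow> 'e graph_fun \<Rightarrow> 'e graph_fun \<Rightarrow> bool" where
  "has_weak_deriv \<Gamma> j f g \<longleftrightarrow> f \<in> L2 \<Gamma> \<and> g \<in> L2 \<Gamma> \<and>
     (\<forall>e\<in>arcs (shape \<Gamma>). \<forall>\<eta>. test_function (len \<Gamma> e) \<eta> \<longrightarrow>
        (\<integral>x. f e x * (deriv ^^ j) \<eta> x \<partial>(edge_measure \<Gamma> e)) =
        (-1) ^ j * (\<integral>x. g e x * \<eta> x \<partial>(edge_measure \<Gamma> e)))"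

definition weakly_differentiable :: "('v, 'e) metric_graph \<Rightarrow> nat \<Rightarrow> 'e graph_fun \<Rightarrow> bool" where
  "weakly_differentiable \<Gamma> j f \<longleftrightarrow> (\<exists>g. has_weak_deriv \<Gamma> j f g)"

definition weak_deriv :: "('v, 'e) metric_graph \<Rightarrow> nat \<Rightarrow> 'e graph_fun \<Rightarrow> 'e graph_fun" where
  "weak_deriv \<Gamma> j f = (SOME g. has_weak_deriv \<Gamma> j f g)"

definition Sobolev_edges :: "('v, 'e) metric_graph \<Rightarrow> nat \<Rightarrow> 'e graph_fun set" where
  "Sobolev_edges \<Gamma> k = {f \<in> L2 \<Gamma>. \<forall>j\<le>k. weakly_differentiable \<Gamma> j f}"

definition H1 :: "('v, 'e) metric_graph \<Rightarrow> 'e graph_fun set" where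
  "H1 \<Gamma> = C_space \<Gamma> \<inter> Sobolev_edges \<Gamma> 1"

section \<open>The Kirchhoff Laplacian\<close>

text \<open>
  An edge end is a pair of an edge and a flag; \<open>True\<close> is the end at coordinate \<open>0\<close>. A loop thus has
  two ends at its vertex.
\<close>

definition edge_ends :: "('v, 'e) metric_graph \<Rightarrow> 'v \<Rightarrow> ('e \<times> bool) set" where
  "edge_ends \<Gamma> v = {(e, b). e \<in> arcs (shape \<Gamma>) \<and>
                      (if b then tail (shape \<Gamma>) e else head (shape \<Gamma>) e) = v}"

text \<open>The directional derivative is taken of the continuous representative on the edge.\<close>

definition has_dir_deriv ::
    "('v, 'e) metric_graph \<Rightarrow> 'e graph_fun \<Rightarrow> 'e \<times> bool \<Rightarrow> real \<Rightarrow> bool" where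
  "has_dir_deriv \<Gamma> f = (\<lambda>(e, b) d. \<exists>c. continuous_on {0..len \<Gamma> e} c \<and>
     (AE x in edge_measure \<Gamma> e. f e x = c x) \<and>
     (if b then (c has_real_derivative d) (at 0 within {0..len \<Gamma> e})
      else (c has_real_derivative (- d)) (at (len \<Gamma> e) within {0..len \<Gamma> e})))"

definition kirchhoff_at :: "('v, 'e) metric_graph \<Rightarrow> 'v \<Rightarrow> 'e graph_fun \<Rightarrow> bool" where
  "kirchhoff_at \<Gamma> v f \<longleftrightarrow>
     (\<exists>d. (\<forall>p\<in>edge_ends \<Gamma> v. has_dir_deriv \<Gamma> f p (d p)) \<and> (\<Sum>p\<in>edge_ends \<Gamma> v. d p) = 0)"

definition laplacian_dom :: "('v, 'e) metric_graph \<Rightarrow> 'e graph_fun set" where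
  "laplacian_dom \<Gamma> =
     {f \<in> Sobolev_edges \<Gamma> 2 \<inter> C_space \<Gamma>. \<forall>v\<in>verts (shape \<Gamma>). kirchhoff_at \<Gamma> v f}"

definition laplacian :: "('v, 'e) metric_graph \<Rightarrow> 'e graph_fun \<Rightarrow> 'e graph_fun" where
  "laplacian \<Gamma> f = weak_deriv \<Gamma> 2 f"

definition L_op :: "('v, 'e) metric_graph \<Rightarrow> real \<Rightarrow> 'e graph_fun \<Rightarrow> 'e graph_fun" where
  "L_op \<Gamma> \<kappa> f = (\<lambda>e x. \<kappa>\<^sup>2 * f e x - laplacian \<Gamma> f e x)"

definition eigenbasis ::
    "('v, 'e) metric_graph \<Rightarrow> real \<Rightarrow> (nat \<Rightarrow> 'e graph_fun) \<Rightarrow> (nat \<Rightarrow> real) \<Rightarrow> bool" where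
  "eigenbasis \<Gamma> \<kappa> \<phi> lam \<longleftrightarrow>
     (\<forall>i. \<phi> i \<in> laplacian_dom \<Gamma> \<and> ae_eq \<Gamma> (L_op \<Gamma> \<kappa> (\<phi> i)) (\<lambda>e x. lam i * \<phi> i e x)) \<and>
     (\<forall>i j. L2_inner \<Gamma> (\<phi> i) (\<phi> j) = (if i = j then 1 else 0)) \<and>
     (\<forall>f\<in>L2 \<Gamma>.
        (\<lambda>n. L2_norm \<Gamma> (\<lambda>e x. f e x - (\<Sum>i<n. L2_inner \<Gamma> f (\<phi> i) * \<phi> i e x))) \<longlonglongrightarrow> 0) \<and>
     0 < lam 0 \<and> incseq lam"

section \<open>Fractional powers and the associated scale of spaces\<close>

definition L_pow ::
    "('v, 'e) metric_graph \<Rightarrow> (nat \<Rightarrow> 'e graph_fun) \<Rightarrow> (nat \<Rightarrow> real) \<Rightarrow> real \<Rightarrow>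
     'e graph_fun \<Rightarrow> 'e graph_fun" where
  "L_pow \<Gamma> \<phi> lam \<beta> f = (SOME g. g \<in> L2 \<Gamma> \<and>
     (\<lambda>n. L2_norm \<Gamma> (\<lambda>e x. g e x -
        (\<Sum>i<n. lam i powr \<beta> * L2_inner \<Gamma> f (\<phi> i) * \<phi> i e x))) \<longlonglongrightarrow> 0)"

definition Hdot ::
    "('v, 'e) metric_graph \<Rightarrow> (nat \<Rightarrow> 'e graph_fun) \<Rightarrow> (nat \<Rightarrow> real) \<Rightarrow> real \<Rightarrow> 'e graph_fun set" where
  "Hdot \<Gamma> \<phi> lam \<beta> = {f \<in> L2 \<Gamma>. summable (\<lambda>i. lam i powr \<beta> * (L2_inner \<Gamma> f (\<phi> i))\<^sup>2)}"

definition Hdot_norm ::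
    "('v, 'e) metric_graph \<Rightarrow> (nat \<Rightarrow> 'e graph_fun) \<Rightarrow> (nat \<Rightarrow> real) \<Rightarrow> real \<Rightarrow> 'e graph_fun \<Rightarrow> real" where
  "Hdot_norm \<Gamma> \<phi> lam \<beta> f = sqrt (\<Sum>i. lam i powr \<beta> * (L2_inner \<Gamma> f (\<phi> i))\<^sup>2)"

definition Hdot_dual ::
    "('v, 'e) metric_graph \<Rightarrow> (nat \<Rightarrow> 'e graph_fun) \<Rightarrow> (nat \<Rightarrow> real) \<Rightarrow> real \<Rightarrow>
     ('e graph_fun \<Rightarrow> real) set" where
  "Hdot_dual \<Gamma> \<phi> lam \<beta> =
     {F. (\<forall>f\<in>Hdot \<Gamma> \<phi> lam \<beta>. \<forall>g\<in>Hdot \<Gamma> \<phi> lam \<beta>. \<forall>a b.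
             F (\<lambda>e x. a * f e x + b * g e x) = a * F f + b * F g) \<and>
         (\<exists>C. \<forall>f\<in>Hdot \<Gamma> \<phi> lam \<beta>. \<bar>F f\<bar> \<le> C * Hdot_norm \<Gamma> \<phi> lam \<beta> f)}"

definition Hdot_dual_norm ::
    "(nat \<Rightarrow> 'e graph_fun) \<Rightarrow> (nat \<Rightarrow> real) \<Rightarrow> real \<Rightarrow> ('e graph_fun \<Rightarrow> real) \<Rightarrow> real" where
  "Hdot_dual_norm \<phi> lam \<beta> F = sqrt (\<Sum>i. lam i powr (-\<beta>) * (F (\<phi> i))\<^sup>2)"

section \<open>Random variables and white noise\<close>

text \<open>
  A normed space is given by a carrier \<open>E\<close> and a (semi)norm \<open>N\<close>; members are representatives of its
  elements, so \<open>E\<close>-valued maps are only required to take values in \<open>E\<close> almost surely.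
\<close>

definition bochner_measurable ::
    "'w measure \<Rightarrow> 'x::minus set \<Rightarrow> ('x \<Rightarrow> real) \<Rightarrow> ('w \<Rightarrow> 'x) \<Rightarrow> bool" where
  "bochner_measurable M E N X \<longleftrightarrow> (AE \<omega> in M. X \<omega> \<in> E) \<and>
     (\<exists>s. (\<forall>n. simple_function M (s n) \<and> s n ` space M \<subseteq> E) \<and>
          (AE \<omega> in M. (\<lambda>n. N (s n \<omega> - X \<omega>)) \<longlonglongrightarrow> 0))"

definition L2_Bochner :: "'w measure \<Rightarrow> 'x::minus set \<Rightarrow> ('x \<Rightarrow> real) \<Rightarrow> ('w \<Rightarrow> 'x) set" where
  "L2_Bochner M E N = {X. bochner_measurable M E N X \<and> integrable M (\<lambda>\<omega>. (N (X \<omega>))\<^sup>2)}"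

text \<open>
  For a negative order \<open>s\<close> the random element of \<open>L\<^sub>2\<close> is read as the random functional
  \<open>\<psi> \<mapsto> (u, \<psi>)\<close>.
\<close>

definition in_L2_Hdot ::
    "'w measure \<Rightarrow> ('v, 'e) metric_graph \<Rightarrow> (nat \<Rightarrow> 'e graph_fun) \<Rightarrow> (nat \<Rightarrow> real) \<Rightarrow> real \<Rightarrow>
     ('w \<Rightarrow> 'e graph_fun) \<Rightarrow> bool" where
  "in_L2_Hdot M \<Gamma> \<phi> lam s u \<longleftrightarrow>
     (if 0 \<le> s then u \<in> L2_Bochner M (Hdot \<Gamma> \<phi> lam s) (Hdot_norm \<Gamma> \<phi> lam s)
      else (\<lambda>\<omega> \<psi>. L2_inner \<Gamma> (u \<omega>) \<psi>)
             \<in> L2_Bochner M (Hdot_dual \<Gamma> \<phi> lam (-s)) (Hdot_dual_norm \<phi> lam (-s)))"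

text \<open>The point mass at \<open>0\<close> counts as Gaussian.\<close>

definition centered_gaussian :: "'w measure \<Rightarrow> ('w \<Rightarrow> real) \<Rightarrow> bool" where
  "centered_gaussian M X \<longleftrightarrow> X \<in> borel_measurable M \<and>
     ((AE \<omega> in M. X \<omega> = 0) \<or> (\<exists>\<sigma>>0. distributed M lborel X (normal_density 0 \<sigma>)))"

definition white_noise ::
    "'w measure \<Rightarrow> ('v, 'e) metric_graph \<Rightarrow> ('e graph_fun \<Rightarrow> 'w \<Rightarrow> real) \<Rightarrow> bool" where
  "white_noise M \<Gamma> W \<longleftrightarrow>
     (\<forall>H c. finite H \<and> H \<subseteq> L2 \<Gamma> \<longrightarrow> centered_gaussian M (\<lambda>\<omega>. \<Sum>h\<in>H. c h * W h \<omega>)) \<and>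
     (\<forall>h\<in>L2 \<Gamma>. \<forall>g\<in>L2 \<Gamma>. (\<integral>\<omega>. W h \<omega> * W g \<omega> \<partial>M) = L2_inner \<Gamma> h g)"

text \<open>\<open>u\<close> solves \<open>L\<^bsup>\<alpha>/2\<^esup> (\<tau> u) = W\<close>.\<close>

definition whittle_matern_solution ::
    "'w measure \<Rightarrow> ('v, 'e) metric_graph \<Rightarrow> (nat \<Rightarrow> 'e graph_fun) \<Rightarrow> (nat \<Rightarrow> real) \<Rightarrow>
     real \<Rightarrow> real \<Rightarrow> ('e graph_fun \<Rightarrow> 'w \<Rightarrow> real) \<Rightarrow> ('w \<Rightarrow> 'e graph_fun) \<Rightarrow> bool" where
  "whittle_matern_solution M \<Gamma> \<phi> lam \<alpha> \<tau> W u \<longleftrightarrow>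
     bochner_measurable M (L2 \<Gamma>) (L2_norm \<Gamma>) u \<and>
     (\<forall>\<psi>\<in>L2 \<Gamma>. centered_gaussian M (\<lambda>\<omega>. L2_inner \<Gamma> (u \<omega>) \<psi>)) \<and>
     (\<forall>\<psi>\<in>L2 \<Gamma>. AE \<omega> in M.
        L2_inner \<Gamma> (u \<omega>) \<psi> = W (\<lambda>e x. inverse \<tau> * L_pow \<Gamma> \<phi> lam (-\<alpha>/2) \<psi> e x) \<omega>)"

end

theory Submission
  imports Defs "HOL-Real_Asymp.Real_Asymp"
begin

text \<open>
  Everything is decided by the coefficients \<open>\<xi> i = (u, \<phi> i)\<close>. Since \<open>u\<close> is \<open>L\<close> to the power
  \<open>- \<alpha> / 2\<close> applied to noise, up to the factor \<open>1 / \<tau>\<close>, they are uncorrelated Gaussian variables of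
  variance \<open>lam i powr (- \<alpha>) / \<tau>\<^sup>2\<close>, so the expected squared norm of \<open>u\<close> of order \<open>s\<close> is a multiple of
  the sum of \<open>lam i powr (s - \<alpha>)\<close>. Two questions remain: how fast the eigenvalues grow, and what
  summability of \<open>lam i ^ j * (\<xi> i)\<^sup>2\<close> says about derivatives, continuity and vertex conditions.

  Growth. The sum \<open>K\<close> of the squares of the first \<open>n + 1\<close> eigenfunctions at a point \<open>x\<close> is the value at
  \<open>x\<close> of a combination of these eigenfunctions whose squared norm is again \<open>K\<close> and whose energy is at
  most \<open>lam n * K\<close>. A trace inequality on the edge bounds \<open>K\<close> by a multiple of \<open>sqrt (lam n)\<close>, and
  integrating over the graph gives \<open>n + 1 \<le> A * sqrt (lam n)\<close> (\<open>lam_lower_bound\<close>). So the powers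
  \<open>lam i powr (- s)\<close> are summable for \<open>s > 1/2\<close>, and part (i) and the almost sure summability
  \<open>coefficients_summable\<close> follow. In the other direction, the sine functions on a single edge are
  orthonormal functions of energy of order \<open>k\<^sup>2\<close>, and convexity of \<open>t powr (-1/2)\<close> turns this into the
  divergence of the sum of \<open>lam i powr (-1/2)\<close> (\<open>not_summable_lam_powr\<close>).

  Regularity. An eigenfunction satisfies \<open>f'' = (\<kappa>\<^sup>2 - lam i) * f\<close> weakly on every edge, hence classically
  by the lemma of du Bois-Reymond (\<open>phi_regular\<close>). Continuity together with the Kirchhoff condition
  removes the boundary terms in Green's formula, so the derivatives of the eigenfunctions are orthogonal
  with squared norms \<open>lam i - \<kappa>\<^sup>2\<close>. The \<open>j\<close>-th derivatives of the eigenfunctions are therefore orthogonal with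
  squared norms \<open>(lam i - \<kappa>\<^sup>2) ^ j\<close>; summing the series of \<open>j\<close>-th derivatives gives the weak
  derivative (\<open>spectral_weak_deriv\<close>), which is part (iii). By the trace inequality one further derivative
  in the mean square makes a series converge uniformly. At order one this yields continuity and thus
  \<open>H1\<close> (\<open>H1_if_summable\<close>); two orders beyond an even \<open>j\<close> it yields \<open>C\<^sup>1\<close> convergence of the \<open>j\<close>-th
  derivatives on the closed edges, so the vanishing vertex sums of the eigenfunctions survive in the limit
  (\<open>kirchhoff_even_weak_deriv\<close>), which is part (iv).

  Sharpness of (ii). A function in \<open>H1\<close> satisfies Green's formula against every eigenfunction, and the
  Bessel inequality for the energy form makes \<open>lam i * (\<xi> i)\<^sup>2\<close> summable (\<open>summable_if_H1\<close>). For
  \<open>\<alpha> \<le> 3/2\<close> this is almost surely false: fourth moments of Gaussian pairs show that the partial sums of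
  \<open>lam i powr (\<alpha> - 1/2) * (\<xi> i)\<^sup>2\<close>, whose expectations diverge, are concentrated around their
  expectations (\<open>not_AE_summable_squares\<close>).
\<close>

section \<open>Smooth functions and weak derivatives on an interval\<close>

definition smooth :: "(real \<Rightarrow> real) \<Rightarrow> bool" where
  "smooth f \<longleftrightarrow> (\<forall>n x. ((deriv ^^ n) f) field_differentiable (at x))"

lemma deriv_eqI:
  fixes f g :: "real \<Rightarrow> real"
  assumes "\<And>x. (f has_real_derivative g x) (at x)"
  shows "deriv f = g"
  using assms by (intro ext DERIV_imp_deriv)

text \<open>
  Smoothness is always proved by exhibiting a class of functions, given by formulas, that contains the
  function and is closed under differentiation; no iterated derivative is ever computed.
\<close>

lemma smooth_if_in_closed_class:
  assumes "f \<in> S" and closed: "\<And>g. g \<in> S \<Longrightarrow> \<exists>g'\<in>S. \<forall>x. (g has_real_derivative g' x) (at x)"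
  shows "smooth f"
proof -
  have *: "(deriv ^^ n) f \<in> S" for n
  proof (induction n)
    case (Suc n)
    obtain g' where "g' \<in> S" "\<forall>x. ((deriv ^^ n) f has_real_derivative g' x) (at x)"
      using closed[OF Suc] by blast
    moreover from this have "deriv ((deriv ^^ n) f) = g'" by (intro deriv_eqI) auto
    ultimately show ?case by simp
  qed (use assms in simp)
  show ?thesis unfolding smooth_def
  proof (intro allI)
    fix n x show "(deriv ^^ n) f field_differentiable at x"
      using closed[OF *[of n]] unfolding field_differentiable_def by blast
  qed
qed

lemma smooth_deriv: "smooth f \<Longrightarrow> smooth (deriv f)"
  unfolding smooth_def by (metis comp_apply funpow_Suc_right)

lemma smooth_has_deriv: "smooth f \<Longrightarrow> (f has_real_derivative deriv f x) (at x)"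
  unfolding smooth_def by (metis DERIV_deriv_iff_field_differentiable funpow_0)

lemma smooth_antiderivative:
  assumes "\<And>x. (f has_real_derivative g x) (at x)" and g: "smooth g"
  shows "smooth f"
  using assms(1)
proof (intro smooth_if_in_closed_class[of f "insert f {g. smooth g}"])
  fix h assume "h \<in> insert f {g. smooth g}"
  then show "\<exists>g'\<in>insert f {g. smooth g}. \<forall>x. (h has_real_derivative g' x) (at x)"
    using assms smooth_deriv smooth_has_deriv by blast
qed auto

lemma smooth_continuous: "smooth f \<Longrightarrow> continuous_on A f"
  by (meson smooth_has_deriv DERIV_isCont continuous_at_imp_continuous_on)

lemma smooth_const: "smooth (\<lambda>_. c)"
proof (rule smooth_if_in_closed_class[where S = "range (\<lambda>c _. c)"])
  fix g :: "real \<Rightarrow> real" assume "g \<in> range (\<lambda>c _. c)"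
  then show "\<exists>g'\<in>range (\<lambda>c _. c). \<forall>x. (g has_real_derivative g' x) (at x)"
    by (intro bexI[of _ "\<lambda>_. 0"]) (auto intro!: derivative_eq_intros)
qed auto

text \<open>
  Products alone are not closed under differentiation; finite sums of products are, by the Leibniz rule.
\<close>

inductive_set product_sums :: "(real \<Rightarrow> real) set" where
  prod: "smooth f \<Longrightarrow> smooth g \<Longrightarrow> (\<lambda>x. f x * g x) \<in> product_sums"
| add: "f \<in> product_sums \<Longrightarrow> g \<in> product_sums \<Longrightarrow> (\<lambda>x. f x + g x) \<in> product_sums"

lemma product_sums_smooth: assumes "f \<in> product_sums" shows "smooth f"
  using assms
proof (rule smooth_if_in_closed_class)
  fix g assume "g \<in> product_sums"
  then show "\<exists>g'\<in>product_sums. \<forall>x. (g has_real_derivative g' x) (at x)"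
  proof induction
    case (prod f g)
    have "(\<lambda>x. deriv f x * g x + f x * deriv g x) \<in> product_sums"
      using prod by (intro product_sums.intros smooth_deriv)
    moreover have "((\<lambda>x. f x * g x) has_real_derivative deriv f x * g x + f x * deriv g x) (at x)" for x
      using DERIV_mult[OF smooth_has_deriv[OF prod(1)] smooth_has_deriv[OF prod(2)], of x]
      by (simp add: algebra_simps)
    ultimately show ?case by (intro bexI[of _ "\<lambda>x. deriv f x * g x + f x * deriv g x"]) auto
  next
    case (add f g)
    then obtain f' g' where "f' \<in> product_sums" "g' \<in> product_sums"
      "\<forall>x. (f has_real_derivative f' x) (at x)" "\<forall>x. (g has_real_derivative g' x) (at x)" by blast
    then show ?case
      by (intro bexI[of _ "\<lambda>x. f' x + g' x"]) (auto intro!: derivative_eq_intros product_sums.intros)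
  qed
qed

lemma smooth_mult: "smooth f \<Longrightarrow> smooth g \<Longrightarrow> smooth (\<lambda>x. f x * g x)"
  by (rule product_sums_smooth[OF product_sums.prod])

lemma smooth_add: "smooth f \<Longrightarrow> smooth g \<Longrightarrow> smooth (\<lambda>x. f x + g x)"
  using product_sums_smooth[OF product_sums.add[OF product_sums.prod product_sums.prod], of f "\<lambda>_. 1" g "\<lambda>_. 1"]
  by (simp add: smooth_const)

lemma smooth_cmult: "smooth f \<Longrightarrow> smooth (\<lambda>x. c * f x)"
  by (intro smooth_mult smooth_const)

lemma smooth_diff: "smooth f \<Longrightarrow> smooth g \<Longrightarrow> smooth (\<lambda>x. f x - g x)"
  using smooth_add[OF _ smooth_cmult[of g "-1"], of f] by simp

lemma smooth_affine:
  assumes "smooth f" shows "smooth (\<lambda>x. f (a * x + b))"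
proof (rule smooth_if_in_closed_class[where S = "{\<lambda>x. c * f (a * x + b) | c f. smooth f}"])
  fix g assume "g \<in> {\<lambda>x. c * f (a * x + b) | c f. smooth f}"
  then obtain c h where h: "g = (\<lambda>x. c * h (a * x + b))" "smooth h" by blast
  have "(g has_real_derivative (c * a) * deriv h (a * x + b)) (at x)" for x
  proof -
    have "((\<lambda>x. a * x + b) has_real_derivative a) (at x)"
      by (auto intro!: derivative_eq_intros)
    from DERIV_cmult[OF DERIV_chain2[OF smooth_has_deriv[OF h(2)] this], of c]
    show ?thesis unfolding h(1) by (simp add: mult_ac)
  qed
  then show "\<exists>g'\<in>{\<lambda>x. c * f (a * x + b) | c f. smooth f}. \<forall>x. (g has_real_derivative g' x) (at x)"
    using smooth_deriv[OF h(2)]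
    by (intro bexI[of _ "\<lambda>x. (c * a) * deriv h (a * x + b)"]) auto
qed (use assms in \<open>force intro: exI[of _ 1]\<close>)

text \<open>
  The functions \<open>p (1/x) * exp (-1/x)\<close>, extended by zero to the left, are closed under differentiation,
  and all derivatives at zero vanish because the exponential beats every polynomial.
\<close>

definition flat_exp :: "real poly \<Rightarrow> real \<Rightarrow> real" where
  "flat_exp p x = (if x > 0 then poly p (1 / x) * exp (- (1 / x)) else 0)"

lemma poly_times_exp_tendsto_0:
  "((\<lambda>y. poly p y * exp (- y)) \<longlongrightarrow> 0) (at_top :: real filter)"
proof (induction p rule: pCons_induct)
  case (pCons a p)
  have mono: "((\<lambda>y. y ^ n * exp (- y)) \<longlongrightarrow> 0) (at_top :: real filter)" for n :: nat
    by real_asymp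
  have "((\<lambda>y. \<Sum>i\<le>degree (pCons a p). coeff (pCons a p) i * (y ^ i * exp (- y))) \<longlongrightarrow>
        (\<Sum>i\<le>degree (pCons a p). coeff (pCons a p) i * 0)) at_top"
    by (intro tendsto_intros mono)
  then show ?case by (simp only: poly_altdef sum_distrib_right mult.assoc) simp
qed simp

lemma smooth_flat_exp: "smooth (flat_exp p)"
proof (rule smooth_if_in_closed_class[where S = "range flat_exp"])
  fix g assume "g \<in> range flat_exp"
  then obtain p where g: "g = flat_exp p" by blast
  define q where "q = [:0, 0, 1:] * (p - pderiv p)"
  have q: "poly q y = y\<^sup>2 * (poly p y - poly (pderiv p) y)" for y
    by (simp add: q_def algebra_simps power2_eq_square)
  have "(flat_exp p has_real_derivative flat_exp q x) (at x)" for x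
  proof -
    consider "x > 0" | "x < 0" | "x = 0" by linarith
    then show ?thesis
    proof cases
      case 1
      have "((\<lambda>x. poly p (1 / x) * exp (- (1 / x))) has_real_derivative flat_exp q x) (at x)"
        using 1 by (auto intro!: derivative_eq_intros DERIV_chain'[where g="poly p"] poly_DERIV
                simp: flat_exp_def q field_simps power2_eq_square)
      moreover have "\<forall>\<^sub>F y in nhds x. poly p (1 / y) * exp (- (1 / y)) = flat_exp p y"
        using eventually_nhds_in_open[of "{0<..}" x] 1
        by (auto elim!: eventually_mono simp: flat_exp_def)
      ultimately show ?thesis by (simp add: DERIV_cong_ev)
    next
      case 2
      have "\<forall>\<^sub>F y in nhds x. 0 = flat_exp p y"
        using eventually_nhds_in_open[of "{..<0}" x] 2
        by (auto elim!: eventually_mono simp: flat_exp_def)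
      then have "(flat_exp p has_real_derivative 0) (at x)"
        using DERIV_cong_ev[of x x "\<lambda>_. 0" "flat_exp p" 0 0] by simp
      then show ?thesis using 2 by (simp add: flat_exp_def)
    next
      case 3
      have "((\<lambda>h. poly ([:0, 1:] * p) (inverse h) * exp (- inverse h)) \<longlongrightarrow> 0) (at_right 0)"
        by (rule filterlim_compose[OF poly_times_exp_tendsto_0 filterlim_inverse_at_top_right])
      then have "((\<lambda>h. flat_exp p h / h) \<longlongrightarrow> 0) (at_right 0)"
        by (rule Lim_transform_eventually)
           (auto simp: eventually_at_right_field flat_exp_def field_simps intro: exI[of _ 1])
      moreover have "((\<lambda>h. flat_exp p h / h) \<longlongrightarrow> 0) (at_left 0)"
        by (rule Lim_transform_eventually[OF tendsto_const])
           (auto simp: eventually_at_left_field flat_exp_def intro: exI[of _ "-1"])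
      ultimately have "((\<lambda>h. flat_exp p h / h) \<longlongrightarrow> 0) (at 0)"
        by (simp add: filterlim_at_split)
      then show ?thesis using 3 by (simp add: DERIV_def flat_exp_def)
    qed
  qed
  then show "\<exists>g'\<in>range flat_exp. \<forall>x. (g has_real_derivative g' x) (at x)"
    using g by blast
qed auto

definition bump :: "real \<Rightarrow> real" where
  "bump x = flat_exp 1 x * flat_exp 1 (1 - x)"

lemma smooth_bump: "smooth bump"
  unfolding bump_def
  using smooth_mult[OF smooth_flat_exp smooth_affine[OF smooth_flat_exp], of 1 1 "-1" 1] by simp

lemma bump_pos: "0 < x \<Longrightarrow> x < 1 \<Longrightarrow> 0 < bump x"
  and bump_nonneg: "0 \<le> bump x"
  and bump_eq_0: "x \<le> 0 \<or> 1 \<le> x \<Longrightarrow> bump x = 0"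
  by (auto simp: bump_def flat_exp_def)

lemma real_continuous_antiderivative:
  fixes f :: "real \<Rightarrow> real"
  assumes "continuous_on UNIV f"
  obtains F where "\<And>x. (F has_real_derivative f x) (at x)"
  using einterval_antiderivative[of "-\<infinity>" "\<infinity>" f] assms
  by (auto simp: continuous_on_eq_continuous_at has_real_derivative_iff_has_vector_derivative)

lemma constant_of_zero_deriv:
  fixes F :: "real \<Rightarrow> real"
  assumes "\<And>x. (F has_real_derivative f x) (at x)" "\<And>x. a \<le> x \<Longrightarrow> x \<le> b \<Longrightarrow> f x = 0" "a \<le> b"
  shows "F a = F b"
  using assms(3)
proof (cases "a = b")
  case False
  show ?thesis
  proof (rule DERIV_isconst2[of a b F, symmetric])
    show "continuous_on {a..b} F" by (meson DERIV_isCont assms(1) continuous_at_imp_continuous_on)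
    show "(F has_real_derivative 0) (at x)" if "a < x" "x < b" for x
      using assms(1)[of x] assms(2)[of x] that by simp
  qed (use False assms(3) in auto)
qed simp

text \<open>
  The normalised antiderivative of a bump. The step turns an arbitrarily short interval into a smooth
  transition from 0 to 1, and its derivative is a nonnegative kernel of mass one.
\<close>

lemma smooth_step_exists:
  "\<exists>S. smooth S \<and> (\<forall>x\<le>0. S x = 0) \<and> (\<forall>x\<ge>1. S x = (1::real)) \<and> (\<forall>x. 0 \<le> deriv S x) \<and>
       (\<forall>x. x \<le> 0 \<or> 1 \<le> x \<longrightarrow> deriv S x = 0)"
proof -
  obtain F where F: "\<And>x. (F has_real_derivative bump x) (at x)"
    using real_continuous_antiderivative smooth_continuous[OF smooth_bump] by metis
  have less: "F 0 < F 1"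
    by (rule DERIV_pos_imp_increasing_open[of 0 1 F])
       (use F bump_pos in \<open>auto intro: DERIV_continuous_on DERIV_isCont continuous_at_imp_continuous_on\<close>)
  define S where "S x = (F x - F 0) / (F 1 - F 0)" for x
  have S: "(S has_real_derivative bump x / (F 1 - F 0)) (at x)" for x
    unfolding S_def using less by (auto intro!: derivative_eq_intros F)
  then have d: "deriv S = (\<lambda>x. bump x / (F 1 - F 0))" by (rule deriv_eqI)
  have "smooth S"
    using smooth_antiderivative[OF S] smooth_cmult[OF smooth_bump, of "1 / (F 1 - F 0)"] by simp
  moreover have "S x = 0" if "x \<le> 0" for x
    using constant_of_zero_deriv[OF F, of x 0] bump_eq_0 that by (simp add: S_def)
  moreover have "S x = 1" if "x \<ge> 1" for x
    using constant_of_zero_deriv[OF F, of 1 x] bump_eq_0 that less by (simp add: S_def)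
  ultimately show ?thesis
    using less bump_nonneg bump_eq_0 by (intro exI[of _ S]) (auto simp: d)
qed

definition smooth_step :: "real \<Rightarrow> real" where
  "smooth_step = (SOME S. smooth S \<and> (\<forall>x\<le>0. S x = 0) \<and> (\<forall>x\<ge>1. S x = (1::real)) \<and> (\<forall>x. 0 \<le> deriv S x) \<and>
       (\<forall>x. x \<le> 0 \<or> 1 \<le> x \<longrightarrow> deriv S x = 0))"

lemma smooth_step:
  "smooth smooth_step" "x \<le> 0 \<Longrightarrow> smooth_step x = 0" "x \<ge> 1 \<Longrightarrow> smooth_step x = 1"
  "0 \<le> deriv smooth_step x" "x \<le> 0 \<or> 1 \<le> x \<Longrightarrow> deriv smooth_step x = 0"
  using someI_ex[OF smooth_step_exists, folded smooth_step_def] by blast+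

lemma smooth_step_mono: "x \<le> y \<Longrightarrow> smooth_step x \<le> smooth_step y"
  by (rule DERIV_nonneg_imp_nondecreasing) (use smooth_has_deriv[OF smooth_step(1)] smooth_step(4) in blast)+

lemma smooth_step_bounds: "0 \<le> smooth_step x" "smooth_step x \<le> 1"
  using smooth_step_mono[of "min 0 x" x] smooth_step_mono[of x "max 1 x"] smooth_step(2,3) by auto

subsection \<open>Test functions\<close>

lemma test_functionI:
  assumes "smooth \<eta>" "0 < a" "b < l" "\<And>x. x < a \<or> b < x \<Longrightarrow> \<eta> x = 0"
  shows "test_function l \<eta>"
proof -
  have "{x. \<eta> x \<noteq> 0} \<subseteq> {a..b}" using assms(4) by force
  then have "closure {x. \<eta> x \<noteq> 0} \<subseteq> {a..b}" by (simp add: closure_minimal)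
  with assms show ?thesis unfolding test_function_def smooth_def by fastforce
qed

text \<open>
  The closure of the support is compact, so it keeps a positive distance from both ends of the interval.
\<close>

lemma test_functionE:
  assumes "test_function l \<eta>" "0 < l"
  obtains a b where "smooth \<eta>" "0 < a" "a \<le> b" "b < l" "\<And>x. x < a \<or> b < x \<Longrightarrow> \<eta> x = 0"
proof -
  let ?C = "closure {x. \<eta> x \<noteq> 0}"
  have sm: "smooth \<eta>" and C: "?C \<subseteq> {0<..<l}" using assms by (auto simp: test_function_def smooth_def)
  show ?thesis
  proof (cases "?C = {}")
    case True
    then have "\<eta> x = 0" for x using closure_subset[of "{x. \<eta> x \<noteq> 0}"] by auto
    then show ?thesis using that[of "l/2" "l/2"] sm assms(2) by auto
  next
    case False
    have "compact ?C" using C by (meson bounded_closed_interval bounded_subset closed_closure compact_eq_bounded_closed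
       greaterThanLessThan_subseteq_atLeastAtMost_iff order_refl subset_trans)
    then obtain a b where "a \<in> ?C" "b \<in> ?C" "\<forall>x\<in>?C. a \<le> x" "\<forall>x\<in>?C. x \<le> b"
      using False by (meson compact_attains_inf compact_attains_sup)
    moreover have "\<eta> x = 0" if "x \<notin> ?C" for x using that closure_subset[of "{x. \<eta> x \<noteq> 0}"] by auto
    ultimately show ?thesis using that[of a b] sm C by (meson greaterThanLessThan_iff leD subsetD)
  qed
qed

lemma test_function_deriv:
  assumes "test_function l \<eta>" "0 < l" shows "test_function l (deriv \<eta>)"
proof -
  obtain a b where ab: "smooth \<eta>" "0 < a" "a \<le> b" "b < l" "\<And>x. x < a \<or> b < x \<Longrightarrow> \<eta> x = 0"
    using test_functionE[OF assms] by metis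
  have "deriv \<eta> x = 0" if "x < a \<or> b < x" for x
  proof -
    have "\<forall>\<^sub>F y in nhds x. y \<in> {..<a} \<union> {b<..}"
      using that by (intro eventually_nhds_in_open open_Un) auto
    then have "\<forall>\<^sub>F y in nhds x. 0 = \<eta> y"
      by (rule eventually_mono) (use ab(5) in auto)
    then have "(\<eta> has_real_derivative 0) (at x)"
      using DERIV_cong_ev[of x x "\<lambda>_. 0" "\<eta>" 0 0] by simp
    then show ?thesis by (rule DERIV_imp_deriv)
  qed
  then show ?thesis using ab by (intro test_functionI[of _ a b] smooth_deriv) auto
qed

lemma test_function_higher_deriv:
  assumes "test_function l \<eta>" "0 < l" shows "test_function l ((deriv ^^ n) \<eta>)"
  by (induction n) (auto intro: assms test_function_deriv)

lemma test_function_boundary: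
  assumes "test_function l \<eta>" "0 < l" shows "\<eta> 0 = 0" "\<eta> l = 0"
  using test_functionE[OF assms] by (metis)+

lemma test_function_smooth: "test_function l \<eta> \<Longrightarrow> smooth \<eta>"
  by (simp add: test_function_def smooth_def)


subsection \<open>Calculus on an interval\<close>

lemma continuous_integrable_interval:
  fixes f :: "real \<Rightarrow> real"
  assumes "continuous_on {a..b} f" shows "integrable (lebesgue_on {a..b}) f"
  using assms by (rule continuous_imp_integrable_real)

lemma continuous_measurable_interval:
  fixes f :: "real \<Rightarrow> real"
  assumes "continuous_on {a..b} f" shows "f \<in> borel_measurable (lebesgue_on {a..b})"
  using continuous_integrable_interval[OF assms] by auto

lemma integrable_mult_continuous:
  fixes f g :: "real \<Rightarrow> real"
  assumes g: "integrable (lebesgue_on {a..b}) g" and f: "continuous_on {a..b} f"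
  shows "integrable (lebesgue_on {a..b}) (\<lambda>x. g x * f x)"
proof -
  have "compact (f ` {a..b})" using f compact_continuous_image compact_Icc by blast
  then obtain B where B: "\<And>x. x \<in> {a..b} \<Longrightarrow> \<bar>f x\<bar> \<le> B"
    by (metis bounded_iff compact_imp_bounded imageI real_norm_def)
  have m: "f \<in> borel_measurable (lebesgue_on {a..b})" by (rule continuous_measurable_interval[OF f])
  show ?thesis
  proof (rule Bochner_Integration.integrable_bound[of _ "\<lambda>x. B * \<bar>g x\<bar>"])
    show "AE x in lebesgue_on {a..b}. norm (g x * f x) \<le> norm (B * \<bar>g x\<bar>)"
    proof (rule AE_I2)
      fix x assume "x \<in> space (lebesgue_on {a..b})"
      then have *: "\<bar>f x\<bar> \<le> B" using B by simp
      have "\<bar>f x\<bar> * \<bar>g x\<bar> \<le> \<bar>B\<bar> * \<bar>g x\<bar>" using * by (intro mult_right_mono) auto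
      then show "norm (g x * f x) \<le> norm (B * \<bar>g x\<bar>)" by (simp add: abs_mult mult.commute)
    qed
  qed (use g m in auto)
qed

lemma FTC_lebesgue:
  fixes F f :: "real \<Rightarrow> real"
  assumes "a \<le> b" "\<And>x. x \<in> {a..b} \<Longrightarrow> (F has_real_derivative f x) (at x within {a..b})"
    and "continuous_on {a..b} f"
  shows "(\<integral>x. f x \<partial>lebesgue_on {a..b}) = F b - F a"
proof -
  have "(f has_integral F b - F a) {a..b}"
    using assms by (intro fundamental_theorem_of_calculus)
      (auto simp: has_real_derivative_iff_has_vector_derivative)
  moreover have "(\<integral>x. f x \<partial>lebesgue_on {a..b}) = integral {a..b} f"
    using assms by (intro lebesgue_integral_eq_integral continuous_integrable_interval) auto
  ultimately show ?thesis by (simp add: integral_unique)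
qed

lemma deriv_within_continuous:
  fixes F :: "real \<Rightarrow> real"
  assumes "\<And>x. x \<in> S \<Longrightarrow> (F has_real_derivative f x) (at x within S)"
  shows "continuous_on S F"
  using assms by (meson DERIV_continuous_on)

lemma integration_by_parts_lebesgue:
  fixes F G f g :: "real \<Rightarrow> real"
  assumes "a \<le> b" "\<And>x. x \<in> {a..b} \<Longrightarrow> (F has_real_derivative f x) (at x within {a..b})"
    "\<And>x. x \<in> {a..b} \<Longrightarrow> (G has_real_derivative g x) (at x within {a..b})"
    and f: "continuous_on {a..b} f" and g: "continuous_on {a..b} g"
  shows "(\<integral>x. F x * g x \<partial>lebesgue_on {a..b}) = F b * G b - F a * G a - (\<integral>x. f x * G x \<partial>lebesgue_on {a..b})"
proof -
  have c: "continuous_on {a..b} F" "continuous_on {a..b} G"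
    using assms deriv_within_continuous by blast+
  have "(\<integral>x. F x * g x + f x * G x \<partial>lebesgue_on {a..b}) = F b * G b - F a * G a"
    using assms c by (intro FTC_lebesgue) (auto intro!: derivative_eq_intros continuous_intros)
  moreover have "integrable (lebesgue_on {a..b}) (\<lambda>x. F x * g x)"
     "integrable (lebesgue_on {a..b}) (\<lambda>x. f x * G x)"
    using c f g by (auto intro!: continuous_integrable_interval continuous_intros)
  ultimately show ?thesis by simp
qed

lemma continuous_AE_eq_interval:
  fixes c d :: "real \<Rightarrow> real"
  assumes l: "0 < l" and c: "continuous_on {0..l} c" and d: "continuous_on {0..l} d"
    and ae: "AE x in lebesgue_on {0..l}. c x = d x" and x: "x \<in> {0..l}"
  shows "c x = d x"
proof -
  let ?U = "{x \<in> {0<..<l}. c x - d x \<in> - {0}}"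
  have cd: "continuous_on {0..l} (\<lambda>x. c x - d x)" using c d by (intro continuous_intros)
  then have "continuous_on {0<..<l} (\<lambda>x. c x - d x)" by (rule continuous_on_subset) auto
  then have o: "open ?U"
    using continuous_open_preimage[of "{0<..<l}" "\<lambda>x. c x - d x" "- {0}"]
    by (simp add: vimage_def Int_def open_Compl)
  have "AE x in lebesgue. x \<in> {0..l} \<longrightarrow> c x = d x"
    using ae by (simp add: AE_restrict_space_iff)
  then have "AE x in lebesgue. x \<notin> ?U" by eventually_elim auto
  then have "?U \<in> null_sets lebesgue"
    by (rule AE_iff_null_sets[THEN iffD2, rotated]) (use o in auto)
  then have "negligible ?U" by (simp add: negligible_iff_null_sets)
  then have "?U = {}" using o open_not_negligible by blast
  then have z: "\<And>x. x \<in> {0<..<l} \<Longrightarrow> c x - d x = 0" by auto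
  have cl: "closure {0<..<l} = {0..l}" using l by simp
  have "c x - d x = 0"
    by (rule continuous_constant_on_closure[of "{0<..<l}" "\<lambda>x. c x - d x" 0 x])
       (use cd z x in \<open>simp_all add: cl\<close>)
  then show ?thesis by simp
qed

lemma test_function_continuous: "test_function l \<eta> \<Longrightarrow> continuous_on A \<eta>"
  by (intro smooth_continuous test_function_smooth)

lemma integrable_mult_test:
  "integrable (lebesgue_on {0..l}) g \<Longrightarrow> test_function l \<eta> \<Longrightarrow>
   integrable (lebesgue_on {0..l}) (\<lambda>x. g x * \<eta> x)"
  by (intro integrable_mult_continuous test_function_continuous)

subsection \<open>The fundamental lemma of the calculus of variations\<close>

lemma smooth_step_eventually_1:
  assumes "0 < t" shows "\<forall>\<^sub>F n in sequentially. smooth_step (real n * t - 1) = 1"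
proof -
  have "\<forall>\<^sub>F n in sequentially. real n \<ge> 2 / t" by real_asymp
  then show ?thesis by eventually_elim (use assms in \<open>auto intro!: smooth_step(3) simp: field_simps\<close>)
qed

text \<open>
  The indicator of an open interval is the bounded pointwise limit of test functions, namely of products of
  a rising and a falling step.
\<close>

lemma integral_interval_zero:
  assumes g: "integrable (lebesgue_on {0..l}) g"
    and orth: "\<And>\<eta>. test_function l \<eta> \<Longrightarrow> (\<integral>x. g x * \<eta> x \<partial>lebesgue_on {0..l}) = 0"
    and ab: "0 \<le> a" "a < b" "b \<le> l"
  shows "(\<integral>x. g x * indicator {a<..<b} x \<partial>lebesgue_on {0..l}) = 0"
proof -
  define \<eta> where "\<eta> n x = smooth_step (real n * (x - a) - 1) * smooth_step (real n * (b - x) - 1)" for n x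
  have sm: "smooth (\<eta> n)" for n
    using smooth_mult[OF smooth_affine[OF smooth_step(1)] smooth_affine[OF smooth_step(1)],
        of "real n" "- real n * a - 1" "- real n" "real n * b - 1"]
    by (simp add: \<eta>_def[abs_def] algebra_simps)
  have t: "test_function l (\<eta> n)" if "n > 0" for n
  proof (rule test_functionI[OF sm, of "a + 1 / n" "b - 1 / n"])
    show "\<eta> n x = 0" if "x < a + 1 / real n \<or> b - 1 / real n < x" for x
      using that \<open>n > 0\<close> smooth_step(2)[of "real n * (x - a) - 1"] smooth_step(2)[of "real n * (b - x) - 1"]
      by (auto simp: \<eta>_def field_simps)
  qed (use ab that in \<open>auto simp: add_nonneg_pos intro: less_le_trans[of _ b]\<close>)
  have lim: "(\<lambda>n. \<integral>x. g x * \<eta> n x \<partial>lebesgue_on {0..l}) \<longlonglongrightarrow>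
             (\<integral>x. g x * indicator {a<..<b} x \<partial>lebesgue_on {0..l})"
  proof (rule integral_dominated_convergence[where w = "\<lambda>x. \<bar>g x\<bar>"])
    show "(\<lambda>x. g x * indicator {a<..<b} x) \<in> borel_measurable (lebesgue_on {0..l})"
      by (intro borel_measurable_times borel_measurable_integrable[OF g] borel_measurable_indicator)
         (use ab in \<open>auto simp: sets_restrict_space_iff\<close>)
    show "(\<lambda>x. g x * \<eta> n x) \<in> borel_measurable (lebesgue_on {0..l})" for n
      using g sm by (intro borel_measurable_integrable integrable_mult_continuous smooth_continuous)
    show "AE x in lebesgue_on {0..l}. (\<lambda>n. g x * \<eta> n x) \<longlonglongrightarrow> g x * indicator {a<..<b} x"
    proof (intro AE_I2 tendsto_intros)
      fix x
      show "(\<lambda>n. \<eta> n x) \<longlonglongrightarrow> indicator {a<..<b} x"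
      proof (cases "x \<in> {a<..<b}")
        case True
        then have "0 < x - a" "0 < b - x" by auto
        from smooth_step_eventually_1[OF this(1)] smooth_step_eventually_1[OF this(2)]
        have "\<forall>\<^sub>F n in sequentially. \<eta> n x = 1"
          by eventually_elim (auto simp: \<eta>_def)
        then show ?thesis using True by (simp add: tendsto_eventually)
      next
        case False
        have "real n * (x - a) \<le> 0 \<or> real n * (b - x) \<le> 0" for n
          using False by (auto simp: mult_le_0_iff)
        then have "\<eta> n x = 0" for n
          unfolding \<eta>_def by (metis smooth_step(2) diff_le_0_iff_le less_eq_real_def mult_eq_0_iff order_trans zero_less_one)
        then show ?thesis using False by simp
      qed
    qed
    show "AE x in lebesgue_on {0..l}. norm (g x * \<eta> n x) \<le> \<bar>g x\<bar>" for n
      using smooth_step_bounds by (intro AE_I2) (auto simp: \<eta>_def abs_mult intro!: mult_left_le mult_le_one)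
  qed (use g in auto)
  have "\<forall>\<^sub>F n in sequentially. (\<integral>x. g x * \<eta> n x \<partial>lebesgue_on {0..l}) = 0"
    using eventually_gt_at_top[of "0::nat"] by eventually_elim (use orth t in auto)
  then have "(\<lambda>n. \<integral>x. g x * \<eta> n x \<partial>lebesgue_on {0..l}) \<longlonglongrightarrow> 0"
    by (rule tendsto_eventually)
  with lim show ?thesis by (rule LIMSEQ_unique)
qed

text \<open>
  A function orthogonal to all test functions has integral zero over every subinterval. Its averages over
  shrinking intervals vanish, and by Lebesgue differentiation they recover the function almost everywhere.
\<close>

lemma fundamental_lemma:
  assumes g: "integrable (lebesgue_on {0..l}) g"
    and orth: "\<And>\<eta>. test_function l \<eta> \<Longrightarrow> (\<integral>x. g x * \<eta> x \<partial>lebesgue_on {0..l}) = 0"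
  shows "AE x in lebesgue_on {0..l}. g x = 0"
proof -
  define h where "h x = (if x \<in> {0..l} then g x else 0)" for x
  have gi: "g integrable_on {0..l}" using g by (intro integrable_on_lebesgue_on) auto
  then have "h integrable_on UNIV" unfolding h_def by (simp only: integrable_restrict_UNIV)
  then have "h integrable_on cbox a b" for a b by (rule integrable_on_subcbox) auto
  then obtain N where N: "negligible N"
    "\<And>x e. \<lbrakk>x \<notin> N; 0 < e\<rbrakk> \<Longrightarrow> \<exists>d>0. \<forall>t. 0 < t \<and> t < d \<longrightarrow>
              norm (integral (cbox x (x + t *\<^sub>R One)) h /\<^sub>R t ^ DIM(real) - h x) < e"
    using integrable_ccontinuous_explicit[of h] by metis
  have zero: "integral {a..b} h = 0" if ab: "0 \<le> a" "a < b" "b \<le> l" for a b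
  proof -
    have "integral {a..b} h = integral {a..b} g"
      by (rule integral_cong) (use ab in \<open>auto simp: h_def\<close>)
    also have "\<dots> = integral {a<..<b} g" by (simp add: integral_open_interval_real)
    also have "\<dots> = integral ({a<..<b} \<inter> {0..l}) g" 
      using ab by (intro arg_cong2[where f=integral]) auto
    also have "\<dots> = integral {0..l} (\<lambda>x. if x \<in> {a<..<b} then g x else 0)"
      by (simp only: Henstock_Kurzweil_Integration.integral_restrict_Int)
    also have "\<dots> = integral {0..l} (\<lambda>x. g x * indicator {a<..<b} x)"
      by (rule integral_cong) (auto simp: indicator_def)
    also have "\<dots> = (\<integral>x. g x * indicator {a<..<b} x \<partial>lebesgue_on {0..l})"
      by (intro lebesgue_integral_eq_integral[symmetric] integrable_real_mult_indicator g)
         (use ab in \<open>auto simp: sets_restrict_space_iff\<close>)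
    also have "\<dots> = 0" by (rule integral_interval_zero[OF g orth ab])
    finally show ?thesis .
  qed
  have *: "g x = 0" if x: "x \<in> {0..l}" "x \<notin> N" "x \<noteq> l" for x
  proof (rule ccontr)
    assume "g x \<noteq> 0"
    then have "\<bar>h x\<bar> > 0" using x by (simp add: h_def)
    from N(2)[OF x(2) this] obtain d where d: "d > 0"
      "\<forall>t. 0 < t \<and> t < d \<longrightarrow> norm (integral (cbox x (x + t *\<^sub>R One)) h /\<^sub>R t ^ DIM(real) - h x) < \<bar>h x\<bar>"
      by (elim exE conjE) (rule that)
    define t where "t = min (d / 2) (l - x)"
    have t: "0 < t" "t < d" "x + t \<le> l" using d x by (auto simp: t_def)
    then show False using d(2)[rule_format, of t] zero[of x "x + t"] x by simp
  qed
  have "AE x in lebesgue. x \<notin> insert l N"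
    by (rule AE_not_in) (use N(1) in \<open>simp add: negligible_iff_null_sets[symmetric]\<close>)
  then have "AE x in lebesgue. x \<in> {0..l} \<longrightarrow> g x = 0"
    by eventually_elim (use * in auto)
  then show ?thesis by (simp add: AE_restrict_space_iff)
qed

text \<open>
  The antiderivative that vanishes at the left end vanishes near the right end exactly because the total
  integral is zero.
\<close>

lemma test_function_antiderivative:
  assumes \<psi>: "test_function l \<psi>" "0 < l" and zero: "(\<integral>x. \<psi> x \<partial>lebesgue_on {0..l}) = 0"
  obtains \<eta> where "test_function l \<eta>" "deriv \<eta> = \<psi>"
proof -
  obtain a b where ab: "smooth \<psi>" "0 < a" "a \<le> b" "b < l" "\<And>x. x < a \<or> b < x \<Longrightarrow> \<psi> x = 0"
    using test_functionE[OF \<psi>] by metis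
  obtain F where F: "\<And>x. (F has_real_derivative \<psi> x) (at x)"
    using real_continuous_antiderivative smooth_continuous[OF ab(1)] by metis
  define \<eta> where "\<eta> x = F x - F 0" for x
  have d: "(\<eta> has_real_derivative \<psi> x) (at x)" for x
    unfolding \<eta>_def using F by (auto intro!: derivative_eq_intros)
  have sm: "smooth \<eta>" by (rule smooth_antiderivative[OF d ab(1)])
  have l: "\<eta> l = 0"
    using FTC_lebesgue[of 0 l \<eta> \<psi>] zero \<psi>(2) d smooth_continuous[OF ab(1)]
    by (auto simp: \<eta>_def intro: DERIV_subset)
  have "test_function l \<eta>"
  proof (rule test_functionI[OF sm, of "a/2" "(b+l)/2"])
    show "\<eta> x = 0" if x: "x < a/2 \<or> (b + l)/2 < x" for x
    proof -
      consider "x \<le> 0" | "0 \<le> x" "x < a/2" | "(b+l)/2 < x" "x \<le> l" | "l \<le> x" using x by linarith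
      then show ?thesis
      proof cases
        case 1 then show ?thesis using constant_of_zero_deriv[OF d, of x 0] ab by (simp add: \<eta>_def)
      next
        case 2 then show ?thesis using constant_of_zero_deriv[OF d, of 0 x] ab by (simp add: \<eta>_def)
      next
        case 3 then show ?thesis using constant_of_zero_deriv[OF d, of x l] ab l by (simp add: \<eta>_def)
      next
        case 4 then show ?thesis using constant_of_zero_deriv[OF d, of l x] ab l by (simp add: \<eta>_def)
      qed
    qed
  qed (use ab in auto)
  then show ?thesis using that deriv_eqI[OF d] by blast
qed

lemma test_function_integral_1:
  assumes "0 < l" obtains \<psi> where "test_function l \<psi>" "(\<integral>x. \<psi> x \<partial>lebesgue_on {0..l}) = 1"
proof -
  define F where "F x = smooth_step (3 / l * x + - 1)" for x
  have smF: "smooth F" unfolding F_def[abs_def] by (intro smooth_affine smooth_step)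
  have z: "deriv F x = 0" if "x < l/3 \<or> 2*l/3 < x" for x
  proof -
    have "(F has_real_derivative deriv smooth_step (3 / l * x + - 1) * (3 / l)) (at x)"
      unfolding F_def by (rule DERIV_chain2[OF smooth_has_deriv[OF smooth_step(1)]])
        (use assms in \<open>auto intro!: derivative_eq_intros\<close>)
    moreover have "deriv smooth_step (3 / l * x + - 1) = 0"
      by (rule smooth_step(5)) (use that assms in \<open>auto simp: field_simps\<close>)
    ultimately show ?thesis by (auto dest: DERIV_imp_deriv)
  qed
  have "test_function l (deriv F)"
    by (rule test_functionI[OF smooth_deriv[OF smF], of "l/3" "2*l/3"]) (use z assms in auto)
  moreover have "(\<integral>x. deriv F x \<partial>lebesgue_on {0..l}) = F l - F 0"
    using assms smF by (intro FTC_lebesgue smooth_continuous smooth_deriv)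
      (auto intro: DERIV_subset smooth_has_deriv)
  moreover have "F l = 1" "F 0 = 0" using assms smooth_step(2,3) by (auto simp: F_def)
  ultimately show ?thesis using that by simp
qed

lemma test_function_diff_cmult:
  assumes "test_function l f" "test_function l g" "0 < l"
  shows "test_function l (\<lambda>x. f x - c * g x)"
proof -
  obtain a b where f: "smooth f" "0 < a" "b < l" "\<And>x. x < a \<or> b < x \<Longrightarrow> f x = 0"
    using test_functionE[OF assms(1,3)] by metis
  obtain a' b' where g: "smooth g" "0 < a'" "b' < l" "\<And>x. x < a' \<or> b' < x \<Longrightarrow> g x = 0"
    using test_functionE[OF assms(2,3)] by metis
  show ?thesis
    by (rule test_functionI[of _ "min a a'" "max b b'"])
       (use f g in \<open>auto intro: smooth_diff smooth_cmult\<close>)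
qed

text \<open>
  A test function \<open>\<psi>\<close> with integral \<open>m\<close> differs from \<open>m\<close> times a fixed test function of integral one by
  the derivative of a test function. Hence \<open>h\<close> acts on \<open>\<psi>\<close> as a constant does, and the fundamental lemma
  applies to the difference.
\<close>

lemma du_Bois_Reymond:
  assumes l: "0 < l" and h: "integrable (lebesgue_on {0..l}) h"
    and orth: "\<And>\<eta>. test_function l \<eta> \<Longrightarrow> (\<integral>x. h x * deriv \<eta> x \<partial>lebesgue_on {0..l}) = 0"
  obtains C where "AE x in lebesgue_on {0..l}. h x = C"
proof -
  obtain \<psi>0 where \<psi>0: "test_function l \<psi>0" "(\<integral>x. \<psi>0 x \<partial>lebesgue_on {0..l}) = 1"
    using test_function_integral_1[OF l] by metis
  define C where "C = (\<integral>x. h x * \<psi>0 x \<partial>lebesgue_on {0..l})"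
  have int: "integrable (lebesgue_on {0..l}) \<psi>" if "test_function l \<psi>" for \<psi>
    using that by (intro continuous_integrable_interval test_function_continuous)
  have "(\<integral>x. (h x - C) * \<psi> x \<partial>lebesgue_on {0..l}) = 0" if \<psi>: "test_function l \<psi>" for \<psi>
  proof -
    define m where "m = (\<integral>x. \<psi> x \<partial>lebesgue_on {0..l})"
    have "(\<integral>x. \<psi> x - m * \<psi>0 x \<partial>lebesgue_on {0..l}) = 0"
      using int[OF \<psi>] int[OF \<psi>0(1)] \<psi>0(2) by (simp add: m_def)
    then obtain \<eta> where "test_function l \<eta>" "deriv \<eta> = (\<lambda>x. \<psi> x - m * \<psi>0 x)"
      using test_function_antiderivative test_function_diff_cmult[OF \<psi> \<psi>0(1) l] l by metis
    with orth have "(\<integral>x. h x * (\<psi> x - m * \<psi>0 x) \<partial>lebesgue_on {0..l}) = 0" by force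
    moreover have "h x * (\<psi> x - m * \<psi>0 x) = h x * \<psi> x - m * (h x * \<psi>0 x)" for x
      by (simp add: algebra_simps)
    ultimately have "(\<integral>x. h x * \<psi> x \<partial>lebesgue_on {0..l}) = m * C"
      using integrable_mult_test[OF h \<psi>] integrable_mult_test[OF h \<psi>0(1)]
      by (simp add: C_def)
    moreover have "(h x - C) * \<psi> x = h x * \<psi> x - C * \<psi> x" for x by (simp add: algebra_simps)
    ultimately show ?thesis
      using integrable_mult_test[OF h \<psi>] int[OF \<psi>] by (simp add: m_def)
  qed
  moreover have "integrable (lebesgue_on {0..l}) (\<lambda>x. h x - C)"
    using h by (intro Bochner_Integration.integrable_diff continuous_integrable_interval[of _ _ "\<lambda>_. C"]) auto
  ultimately have "AE x in lebesgue_on {0..l}. h x - C = 0"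
    by (intro fundamental_lemma)
  then show ?thesis using that by auto
qed


lemma approximate_identity:
  fixes w :: "real \<Rightarrow> real"
  assumes w: "continuous_on {0..l} w" and y: "y \<in> {0..l}"
    and K: "\<And>n. continuous_on {0..l} (K n)" "\<And>n x. x \<in> {0..l} \<Longrightarrow> 0 \<le> K n x"
    and mass: "\<forall>\<^sub>F n in sequentially. (\<integral>x. K n x \<partial>lebesgue_on {0..l}) = 1"
    and supp: "\<And>n x. x \<in> {0..l} \<Longrightarrow> real n * \<bar>x - y\<bar> > 2 \<Longrightarrow> K n x = 0"
  shows "(\<lambda>n. \<integral>x. w x * K n x \<partial>lebesgue_on {0..l}) \<longlonglongrightarrow> w y"
proof (rule LIMSEQ_I)
  fix e :: real assume e: "e > 0"
  obtain d where d: "d > 0" "\<And>x. x \<in> {0..l} \<Longrightarrow> \<bar>x - y\<bar> < d \<Longrightarrow> \<bar>w x - w y\<bar> < e / 2"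
    using w y e unfolding continuous_on_iff dist_real_def by (meson half_gt_zero)
  have "\<forall>\<^sub>F n in sequentially. real n * d > 2" using d(1) by real_asymp
  then have "\<forall>\<^sub>F n in sequentially. norm ((\<integral>x. w x * K n x \<partial>lebesgue_on {0..l}) - w y) < e"
    using mass
  proof eventually_elim
    case (elim n)
    have i: "integrable (lebesgue_on {0..l}) (\<lambda>x. w x * K n x)" "integrable (lebesgue_on {0..l}) (K n)"
      using w K by (auto intro!: continuous_integrable_interval continuous_intros)
    have "(\<integral>x. w x * K n x \<partial>lebesgue_on {0..l}) - w y = (\<integral>x. w x * K n x - w y * K n x \<partial>lebesgue_on {0..l})"
      using i elim(2) by simp
    also have "norm \<dots> \<le> (\<integral>x. norm (w x * K n x - w y * K n x) \<partial>lebesgue_on {0..l})" by (rule integral_norm_bound)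
    also have "\<dots> \<le> (\<integral>x. e / 2 * K n x \<partial>lebesgue_on {0..l})"
    proof (rule integral_mono)
      fix x assume "x \<in> space (lebesgue_on {0..l})"
      then have x: "x \<in> {0..l}" by simp
      have eq: "norm (w x * K n x - w y * K n x) = \<bar>w x - w y\<bar> * K n x"
        using K(2)[OF x] by (simp add: left_diff_distrib[symmetric] abs_mult)
      show "norm (w x * K n x - w y * K n x) \<le> e / 2 * K n x"
      proof (cases "\<bar>x - y\<bar> < d")
        case True
        then show ?thesis unfolding eq using d(2)[OF x] K(2)[OF x] by (intro mult_right_mono) auto
      next
        case False
        then have "real n * d \<le> real n * \<bar>x - y\<bar>" by (intro mult_left_mono) auto
        then show ?thesis unfolding eq using supp[OF x] elim(1) by simp
      qed
    qed (use i in auto)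
    also have "\<dots> < e" using elim(2) e by simp
    finally show ?case .
  qed
  then show "\<exists>no. \<forall>n\<ge>no. norm ((\<integral>x. w x * K n x \<partial>lebesgue_on {0..l}) - w y) < e"
    by (simp add: eventually_sequentially)
qed

text \<open>
  The derivatives of steps that get steeper at the point \<open>y\<close> form an approximate identity there. The
  shift \<open>d\<close> places the transition inside the interval even if \<open>y\<close> is an endpoint.
\<close>

lemma smooth_step_kernel:
  fixes d :: "nat \<Rightarrow> real"
  defines "K n x \<equiv> real n * deriv smooth_step (real n * x + d n)"
  assumes l: "0 < l" and y: "y \<in> {0..l}"
    and ends: "\<forall>\<^sub>F n in sequentially. d n \<le> 0 \<and> 1 \<le> real n * l + d n"
    and far: "\<And>n x. x \<in> {0..l} \<Longrightarrow> real n * \<bar>x - y\<bar> > 2 \<Longrightarrow> real n * x + d n \<le> 0 \<or> 1 \<le> real n * x + d n"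
    and w: "continuous_on {0..l} w"
  shows "((\<lambda>x. smooth_step (real n * x + d n)) has_real_derivative K n x) (at x)"
    and "(\<lambda>n. \<integral>x. w x * K n x \<partial>lebesgue_on {0..l}) \<longlonglongrightarrow> w y"
proof -
  have der: "((\<lambda>x. smooth_step (real n * x + d n)) has_real_derivative K n x) (at x)" for n x
  proof -
    have "((\<lambda>x. real n * x + d n) has_real_derivative real n) (at x)"
      by (auto intro!: derivative_eq_intros)
    from DERIV_chain2[OF smooth_has_deriv[OF smooth_step(1)] this]
    show ?thesis by (simp add: K_def mult.commute)
  qed
  then show "((\<lambda>x. smooth_step (real n * x + d n)) has_real_derivative K n x) (at x)" .
  have cont: "continuous_on A (K n)" for n A
    unfolding K_def
    by (intro smooth_continuous smooth_cmult smooth_affine[of "deriv smooth_step"] smooth_deriv smooth_step)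
  show "(\<lambda>n. \<integral>x. w x * K n x \<partial>lebesgue_on {0..l}) \<longlonglongrightarrow> w y"
  proof (rule approximate_identity[OF w y cont])
    show "0 \<le> K n x" for n x by (simp add: K_def smooth_step(4))
    show "K n x = 0" if "x \<in> {0..l}" "real n * \<bar>x - y\<bar> > 2" for n x
      using far[OF that] by (simp add: K_def smooth_step(5))
    show "\<forall>\<^sub>F n in sequentially. (\<integral>x. K n x \<partial>lebesgue_on {0..l}) = 1"
      using ends
    proof eventually_elim
      case (elim n)
      have "(\<integral>x. K n x \<partial>lebesgue_on {0..l}) = smooth_step (real n * l + d n) - smooth_step (real n * 0 + d n)"
        using l der cont by (intro FTC_lebesgue) (auto intro: DERIV_subset)
      then show ?case using elim smooth_step(2,3) by simp
    qed
  qed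
qed

text \<open>
  Test functions that rise from 0 to 1 next to
  the left end and fall back next to the right end converge to 1, while their derivatives converge to the
  difference of the point evaluations at the two ends.
\<close>

lemma weak_FTC:
  fixes w r :: "real \<Rightarrow> real"
  assumes l: "0 < l" and w: "continuous_on {0..l} w" and r: "integrable (lebesgue_on {0..l}) r"
    and weak: "\<And>\<eta>. test_function l \<eta> \<Longrightarrow>
      (\<integral>x. w x * deriv \<eta> x \<partial>lebesgue_on {0..l}) = - (\<integral>x. r x * \<eta> x \<partial>lebesgue_on {0..l})"
  shows "w l - w 0 = (\<integral>x. r x \<partial>lebesgue_on {0..l})"
proof -
  define A where "A n x = smooth_step (real n * x + (- 1))" for n x
  define B where "B n x = smooth_step (real n * x + (2 - real n * l))" for n x
  define A' where "A' n x = real n * deriv smooth_step (real n * x + (- 1))" for n x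
  define B' where "B' n x = real n * deriv smooth_step (real n * x + (2 - real n * l))" for n x
  have "\<forall>\<^sub>F n in sequentially. 2 \<le> real n * l" using l by real_asymp
  then have A: "(A n has_real_derivative A' n x) (at x)"
    "(\<lambda>n. \<integral>x. w x * A' n x \<partial>lebesgue_on {0..l}) \<longlonglongrightarrow> w 0" for n x
    unfolding A_def A'_def using l
    by (intro smooth_step_kernel[where y=0 and l=l and w=w and d = "\<lambda>_. -1"] w; auto elim!: eventually_mono)+
  have "\<forall>\<^sub>F n in sequentially. 2 \<le> real n * l" using l by real_asymp
  then have B: "(B n has_real_derivative B' n x) (at x)"
    "(\<lambda>n. \<integral>x. w x * B' n x \<partial>lebesgue_on {0..l}) \<longlonglongrightarrow> w l" for n x
    unfolding B_def B'_def using l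
    by (intro smooth_step_kernel[where y=l and l=l and w=w and d = "\<lambda>n. 2 - real n * l"] w;
        auto elim!: eventually_mono simp: abs_if algebra_simps split: if_splits)+
  define \<eta> where "\<eta> n x = A n x - B n x" for n x
  have sm: "smooth (\<eta> n)" for n
    unfolding \<eta>_def A_def B_def by (intro smooth_diff smooth_affine smooth_step)
  have d: "deriv (\<eta> n) = (\<lambda>x. A' n x - B' n x)" for n
    unfolding \<eta>_def using A(1) B(1) by (intro deriv_eqI) (auto intro!: derivative_eq_intros)
  have cont: "continuous_on {0..l} (A' n)" "continuous_on {0..l} (B' n)" for n
    unfolding A'_def B'_def
    by (intro smooth_continuous smooth_cmult smooth_affine[of "deriv smooth_step"] smooth_deriv smooth_step)+
  have test: "\<forall>\<^sub>F n in sequentially. test_function l (\<eta> n)"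
  proof -
    have "\<forall>\<^sub>F n in sequentially. 4 / l < real n" using l by real_asymp
    then show ?thesis
    proof eventually_elim
      case (elim n)
      have nl: "4 < real n * l" using elim l by (simp add: field_simps)
      then have n0: "0 < real n" using zero_less_mult_pos2[of "real n" l] l by linarith
      show ?case
      proof (rule test_functionI[OF sm, of "1 / n" "l - 1 / n"])
        show "\<eta> n x = 0" if "x < 1 / real n \<or> l - 1 / real n < x" for x
        proof (cases "x < 1 / real n")
          case True
          then have "real n * x < 1" using n0 by (simp add: field_simps)
          then show ?thesis using nl by (simp add: \<eta>_def A_def B_def smooth_step(2))
        next
          case False
          then have "real n * l - 1 < real n * x" using n0 that by (simp add: field_simps)
          then show ?thesis using nl by (simp add: \<eta>_def A_def B_def smooth_step(3))
        qed
      qed (use n0 in auto)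
    qed
  qed
  have "(\<lambda>n. \<integral>x. w x * deriv (\<eta> n) x \<partial>lebesgue_on {0..l}) \<longlonglongrightarrow> w 0 - w l"
  proof -
    have "(\<integral>x. w x * deriv (\<eta> n) x \<partial>lebesgue_on {0..l}) =
        (\<integral>x. w x * A' n x \<partial>lebesgue_on {0..l}) - (\<integral>x. w x * B' n x \<partial>lebesgue_on {0..l})" for n
      unfolding d right_diff_distrib using w cont
      by (intro Bochner_Integration.integral_diff continuous_integrable_interval continuous_intros)
    then show ?thesis using tendsto_diff[OF A(2) B(2)] by simp
  qed
  then have 1: "(\<lambda>n. - (\<integral>x. w x * deriv (\<eta> n) x \<partial>lebesgue_on {0..l})) \<longlonglongrightarrow> w l - w 0"
    by (auto dest: tendsto_minus)
  have 2: "(\<lambda>n. \<integral>x. r x * \<eta> n x \<partial>lebesgue_on {0..l}) \<longlonglongrightarrow> (\<integral>x. r x \<partial>lebesgue_on {0..l})"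
  proof (rule integral_dominated_convergence[where w = "\<lambda>x. \<bar>r x\<bar>"])
    show "(\<lambda>x. r x * \<eta> n x) \<in> borel_measurable (lebesgue_on {0..l})" for n
      using r sm by (intro borel_measurable_integrable integrable_mult_continuous smooth_continuous)
    have "AE x in lebesgue. x \<notin> {0, l}" by (rule AE_not_in) (simp add: negligible_iff_null_sets[symmetric])
    then have "AE x in lebesgue_on {0..l}. x \<notin> {0, l} \<and> x \<in> {0..l}"
      by (simp add: AE_restrict_space_iff) (auto elim: eventually_mono)
    then show "AE x in lebesgue_on {0..l}. (\<lambda>n. r x * \<eta> n x) \<longlonglongrightarrow> r x"
    proof eventually_elim
      case (elim x)
      then have x: "0 < x" "x < l" by auto
      have "\<forall>\<^sub>F n in sequentially. 2 \<le> real n * x \<and> 2 \<le> real n * (l - x)"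
        using x by (intro eventually_conj) (real_asymp+)
      then have "\<forall>\<^sub>F n in sequentially. r x * \<eta> n x = r x"
        by eventually_elim (auto simp: \<eta>_def A_def B_def smooth_step(2,3) algebra_simps)
      then show ?case by (rule tendsto_eventually)
    qed
    show "AE x in lebesgue_on {0..l}. norm (r x * \<eta> n x) \<le> \<bar>r x\<bar>" for n
    proof (rule AE_I2)
      fix x
      have "0 \<le> A n x" "A n x \<le> 1" "0 \<le> B n x" "B n x \<le> 1"
        unfolding A_def B_def by (rule smooth_step_bounds)+
      then have "\<bar>\<eta> n x\<bar> \<le> 1" unfolding \<eta>_def by linarith
      then show "norm (r x * \<eta> n x) \<le> \<bar>r x\<bar>" by (simp add: abs_mult mult_left_le)
    qed
  qed (use r in auto)
  have "\<forall>\<^sub>F n in sequentially. - (\<integral>x. w x * deriv (\<eta> n) x \<partial>lebesgue_on {0..l}) =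
      (\<integral>x. r x * \<eta> n x \<partial>lebesgue_on {0..l})"
    using test by eventually_elim (simp add: weak)
  with 1 have "(\<lambda>n. \<integral>x. r x * \<eta> n x \<partial>lebesgue_on {0..l}) \<longlonglongrightarrow> w l - w 0"
    by (rule Lim_transform_eventually)
  then show ?thesis using 2 by (rule LIMSEQ_unique)
qed

text \<open>
  Cut-offs of solutions of \<open>q'' = m * q\<close> are admissible test functions: combinations of \<open>q\<close> and
  \<open>p = q'\<close> with test function coefficients form a class closed under differentiation. Outside the open
  interval \<open>q\<close> and \<open>p\<close> may be arbitrary since the coefficients vanish there.
\<close>

lemma ode_test_function:
  fixes q p :: "real \<Rightarrow> real"
  assumes l: "0 < l" and ode: "\<And>x. 0 < x \<Longrightarrow> x < l \<Longrightarrow> (q has_real_derivative p x) (at x)"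
     "\<And>x. 0 < x \<Longrightarrow> x < l \<Longrightarrow> (p has_real_derivative m * q x) (at x)"
    and \<chi>: "test_function l \<chi>1" "test_function l \<chi>2"
  defines "\<zeta> \<equiv> (\<lambda>x. \<chi>1 x * q x + \<chi>2 x * p x)"
  shows "(\<zeta> has_real_derivative (deriv \<chi>1 x + m * \<chi>2 x) * q x + (\<chi>1 x + deriv \<chi>2 x) * p x) (at x)"
    and "test_function l \<zeta>"
proof -
  have der: "((\<lambda>x. \<chi>1 x * q x + \<chi>2 x * p x) has_real_derivative
      (deriv \<chi>1 x + m * \<chi>2 x) * q x + (\<chi>1 x + deriv \<chi>2 x) * p x) (at x)"
    if \<chi>: "test_function l \<chi>1" "test_function l \<chi>2" for \<chi>1 \<chi>2 x
  proof (cases "0 < x \<and> x < l")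
    case True
    then have "(q has_real_derivative p x) (at x)" "(p has_real_derivative m * q x) (at x)"
      using ode by auto
    moreover have "(\<chi>1 has_real_derivative deriv \<chi>1 x) (at x)" "(\<chi>2 has_real_derivative deriv \<chi>2 x) (at x)"
      using \<chi> test_function_smooth smooth_has_deriv by auto
    ultimately show ?thesis by (auto intro!: derivative_eq_intros simp: algebra_simps)
  next
    case False
    obtain a b where 1: "0 < a" "b < l" "\<And>x. x < a \<or> b < x \<Longrightarrow> \<chi>1 x = 0"
      using test_functionE[OF \<chi>(1) l] by metis
    obtain a' b' where 2: "0 < a'" "b' < l" "\<And>x. x < a' \<or> b' < x \<Longrightarrow> \<chi>2 x = 0"
      using test_functionE[OF \<chi>(2) l] by metis
    obtain c d where 3: "0 < c" "d < l" "\<And>x. x < c \<or> d < x \<Longrightarrow> deriv \<chi>1 x = 0"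
      using test_functionE[OF test_function_deriv[OF \<chi>(1) l] l] by metis
    obtain c' d' where 4: "0 < c'" "d' < l" "\<And>x. x < c' \<or> d' < x \<Longrightarrow> deriv \<chi>2 x = 0"
      using test_functionE[OF test_function_deriv[OF \<chi>(2) l] l] by metis
    have "\<forall>\<^sub>F y in nhds x. y \<in> {..< min a a'} \<union> {max b b' <..}"
      using False 1 2 by (intro eventually_nhds_in_open open_Un) auto
    then have "\<forall>\<^sub>F y in nhds x. 0 = \<chi>1 y * q y + \<chi>2 y * p y"
      by (rule eventually_mono) (use 1 2 in auto)
    then have "((\<lambda>x. \<chi>1 x * q x + \<chi>2 x * p x) has_real_derivative 0) (at x)"
      using DERIV_cong_ev[of x x "\<lambda>_. 0" "\<lambda>x. \<chi>1 x * q x + \<chi>2 x * p x" 0 0] by simp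
    moreover have "\<chi>1 x = 0" "\<chi>2 x = 0" "deriv \<chi>1 x = 0" "deriv \<chi>2 x = 0"
      using False 1 2 3 4 by force+
    ultimately show ?thesis by simp
  qed
  show "(\<zeta> has_real_derivative (deriv \<chi>1 x + m * \<chi>2 x) * q x + (\<chi>1 x + deriv \<chi>2 x) * p x) (at x)"
    unfolding \<zeta>_def by (rule der[OF \<chi>])
  have comb: "test_function l (\<lambda>x. \<alpha> x + c * \<beta> x)" if "test_function l \<alpha>" "test_function l \<beta>" for \<alpha> \<beta> and c :: real
    using test_function_diff_cmult[OF that l, of "- c"] by simp
  have "smooth \<zeta>"
  proof (rule smooth_if_in_closed_class[where S = "{\<lambda>x. \<chi>1 x * q x + \<chi>2 x * p x |\<chi>1 \<chi>2. test_function l \<chi>1 \<and> test_function l \<chi>2}"])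
    fix g assume "g \<in> {\<lambda>x. \<chi>1 x * q x + \<chi>2 x * p x |\<chi>1 \<chi>2. test_function l \<chi>1 \<and> test_function l \<chi>2}"
    then obtain \<alpha> \<beta> where g: "g = (\<lambda>x. \<alpha> x * q x + \<beta> x * p x)" and t: "test_function l \<alpha>" "test_function l \<beta>"
      by blast
    have "test_function l (\<lambda>x. deriv \<alpha> x + m * \<beta> x)" "test_function l (\<lambda>x. \<alpha> x + deriv \<beta> x)"
      using comb[of "deriv \<alpha>" \<beta> m] comb[of \<alpha> "deriv \<beta>" 1] t test_function_deriv l by auto
    then show "\<exists>g'\<in>{\<lambda>x. \<chi>1 x * q x + \<chi>2 x * p x |\<chi>1 \<chi>2. test_function l \<chi>1 \<and> test_function l \<chi>2}.
                 \<forall>x. (g has_real_derivative g' x) (at x)"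
      unfolding g using der[OF t]
      by (intro bexI[of _ "\<lambda>x. (deriv \<alpha> x + m * \<beta> x) * q x + (\<alpha> x + deriv \<beta> x) * p x"]) auto
  qed (use \<chi> in \<open>auto simp: \<zeta>_def\<close>)
  moreover obtain a b where 1: "0 < a" "b < l" "\<And>x. x < a \<or> b < x \<Longrightarrow> \<chi>1 x = 0"
    using test_functionE[OF \<chi>(1) l] by metis
  moreover obtain a' b' where 2: "0 < a'" "b' < l" "\<And>x. x < a' \<or> b' < x \<Longrightarrow> \<chi>2 x = 0"
    using test_functionE[OF \<chi>(2) l] by metis
  ultimately show "test_function l \<zeta>"
    by (intro test_functionI[of \<zeta> "min a a'" "max b b'"]) (auto simp: \<zeta>_def)
qed

text \<open>
  The product \<open>c * p\<close> has the weak derivative \<open>g * p + m * c * q\<close>, as is seen by testing the weak derivative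
  \<open>g\<close> of \<open>c\<close> with \<open>\<eta> * p\<close>; the weak fundamental theorem then produces the boundary terms.
\<close>

lemma weak_integration_by_parts_ode:
  fixes f g c q p :: "real \<Rightarrow> real"
  assumes l: "0 < l" and g: "integrable (lebesgue_on {0..l}) g"
    and weak: "\<And>\<eta>. test_function l \<eta> \<Longrightarrow>
      (\<integral>x. c x * deriv \<eta> x \<partial>lebesgue_on {0..l}) = - (\<integral>x. g x * \<eta> x \<partial>lebesgue_on {0..l})"
    and c: "continuous_on {0..l} c"
    and q: "\<And>x. x \<in> {0..l} \<Longrightarrow> (q has_real_derivative p x) (at x within {0..l})"
    and p: "\<And>x. x \<in> {0..l} \<Longrightarrow> (p has_real_derivative m * q x) (at x within {0..l})"
  shows "(\<integral>x. g x * p x \<partial>lebesgue_on {0..l}) + m * (\<integral>x. c x * q x \<partial>lebesgue_on {0..l}) =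
         c l * p l - c 0 * p 0"
proof -
  have qc: "continuous_on {0..l} q" by (rule deriv_within_continuous[OF q])
  have pc: "continuous_on {0..l} p" by (rule deriv_within_continuous[OF p])
  have q': "(q has_real_derivative p x) (at x)" and p': "(p has_real_derivative m * q x) (at x)"
    if "0 < x" "x < l" for x
    using q[of x] p[of x] that at_within_Icc_at[of 0 x l] by auto
  have i: "integrable (lebesgue_on {0..l}) (\<lambda>x. g x * p x)"
    "integrable (lebesgue_on {0..l}) (\<lambda>x. m * (c x * q x))"
    using g pc qc c
    by (auto intro!: integrable_mult_continuous continuous_integrable_interval[where f = "\<lambda>x. c x * q x"]  continuous_intros)
  have "c l * p l - c 0 * p 0 = (\<integral>x. g x * p x + m * (c x * q x) \<partial>lebesgue_on {0..l})"
  proof (rule weak_FTC[OF l])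
    show "integrable (lebesgue_on {0..l}) (\<lambda>x. g x * p x + m * (c x * q x))" using i by auto
    fix \<eta> assume \<eta>: "test_function l \<eta>"
    have z: "test_function l (\<lambda>_. 0)" using smooth_const by (intro test_functionI[of _ "l/2" "l/2"]) (use l in auto)
    note * = ode_test_function[OF l q' p' z \<eta>]
    have tz: "test_function l (\<lambda>x. \<eta> x * p x)" using *(2) by simp
    have "deriv (\<lambda>x. \<eta> x * p x) = (\<lambda>x. m * \<eta> x * q x + deriv \<eta> x * p x)"
      using *(1) by (intro deriv_eqI) simp
    with weak[OF tz] have w: "(\<integral>x. c x * (m * \<eta> x * q x + deriv \<eta> x * p x) \<partial>lebesgue_on {0..l}) =
        - (\<integral>x. g x * (\<eta> x * p x) \<partial>lebesgue_on {0..l})" by simp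
    have ce: "continuous_on {0..l} \<eta>" "continuous_on {0..l} (deriv \<eta>)"
      using \<eta> test_function_continuous test_function_deriv l by blast+
    have "(\<integral>x. c x * (m * \<eta> x * q x + deriv \<eta> x * p x) \<partial>lebesgue_on {0..l}) =
       (\<integral>x. m * (c x * q x) * \<eta> x + c x * p x * deriv \<eta> x \<partial>lebesgue_on {0..l})"
      by (simp add: algebra_simps)
    also have "\<dots> = (\<integral>x. m * (c x * q x) * \<eta> x \<partial>lebesgue_on {0..l}) + (\<integral>x. c x * p x * deriv \<eta> x \<partial>lebesgue_on {0..l})"
      by (intro Bochner_Integration.integral_add continuous_integrable_interval continuous_intros c qc pc ce)
    finally have "(\<integral>x. c x * p x * deriv \<eta> x \<partial>lebesgue_on {0..l}) = 
      - ((\<integral>x. g x * p x * \<eta> x \<partial>lebesgue_on {0..l}) + (\<integral>x. m * (c x * q x) * \<eta> x \<partial>lebesgue_on {0..l}))"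
      using w by (simp add: mult_ac)
    also have "(\<integral>x. g x * p x * \<eta> x \<partial>lebesgue_on {0..l}) + (\<integral>x. m * (c x * q x) * \<eta> x \<partial>lebesgue_on {0..l}) =
      (\<integral>x. (g x * p x + m * (c x * q x)) * \<eta> x \<partial>lebesgue_on {0..l})"
      unfolding distrib_right
      by (intro Bochner_Integration.integral_add[symmetric] integrable_mult_continuous i ce)
    finally show "(\<integral>x. c x * p x * deriv \<eta> x \<partial>lebesgue_on {0..l}) =
      - (\<integral>x. (g x * p x + m * (c x * q x)) * \<eta> x \<partial>lebesgue_on {0..l})" .
  qed (use c pc in \<open>auto intro!: continuous_intros\<close>)
  then show ?thesis using i by simp
qed

lemma integral_upto_has_derivative:
  fixes f :: "real \<Rightarrow> real"
  assumes "continuous_on {0..l} f" "x \<in> {0..l}"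
  shows "((\<lambda>x. integral {0..x} f) has_real_derivative f x) (at x within {0..l})"
  using integral_has_vector_derivative[OF assms] by (simp add: has_real_derivative_iff_has_vector_derivative)

text \<open>
  Two applications of du Bois-Reymond: the weak derivative \<open>g\<close> differs from the antiderivative of
  \<open>m * c\<close> by a constant, and then \<open>c\<close> differs from the antiderivative of that by a constant.
\<close>

lemma weak_ode_solution_regular:
  fixes f g c :: "real \<Rightarrow> real"
  assumes l: "0 < l" and f: "integrable (lebesgue_on {0..l}) f" and g: "integrable (lebesgue_on {0..l}) g"
    and weak1: "\<And>\<eta>. test_function l \<eta> \<Longrightarrow>
      (\<integral>x. f x * deriv \<eta> x \<partial>lebesgue_on {0..l}) = - (\<integral>x. g x * \<eta> x \<partial>lebesgue_on {0..l})"
    and weak2: "\<And>\<eta>. test_function l \<eta> \<Longrightarrow>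
      (\<integral>x. f x * deriv (deriv \<eta>) x \<partial>lebesgue_on {0..l}) = (\<integral>x. m * f x * \<eta> x \<partial>lebesgue_on {0..l})"
    and c: "continuous_on {0..l} c" and ae: "AE x in lebesgue_on {0..l}. f x = c x"
  obtains c' where "\<And>x. x \<in> {0..l} \<Longrightarrow> (c has_real_derivative c' x) (at x within {0..l})"
    "\<And>x. x \<in> {0..l} \<Longrightarrow> (c' has_real_derivative m * c x) (at x within {0..l})"
    "AE x in lebesgue_on {0..l}. g x = c' x"
proof -
  have parts: "(\<integral>x. integral {0..x} h * deriv \<eta> x \<partial>lebesgue_on {0..l}) = - (\<integral>x. h x * \<eta> x \<partial>lebesgue_on {0..l})"
    if h: "continuous_on {0..l} h" and \<eta>: "test_function l \<eta>" for h \<eta>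
    using integration_by_parts_lebesgue[of 0 l "\<lambda>x. integral {0..x} h" h \<eta> "deriv \<eta>"]
      integral_upto_has_derivative[OF h] test_function_boundary[OF \<eta> l] l h
      test_function_continuous[OF test_function_deriv[OF \<eta> l]] smooth_has_deriv[OF test_function_smooth[OF \<eta>]]
    by (auto intro: DERIV_subset)
  have int: "integrable (lebesgue_on {0..l}) (\<lambda>x. integral {0..x} h)" if "continuous_on {0..l} h" for h :: "real \<Rightarrow> real"
    by (rule continuous_integrable_interval[OF deriv_within_continuous[OF integral_upto_has_derivative[OF that]]])
  \<comment> \<open>The classical candidate for \<open>g\<close>, up to a constant.\<close>
  define R where "R x = integral {0..x} (\<lambda>x. m * c x)" for x
  have mc: "continuous_on {0..l} (\<lambda>x. m * c x)" using c by (intro continuous_intros)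
  have R: "integrable (lebesgue_on {0..l}) R" unfolding R_def by (rule int[OF mc])
  have "(\<integral>x. (g x - R x) * deriv \<eta> x \<partial>lebesgue_on {0..l}) = 0" if \<eta>: "test_function l \<eta>" for \<eta>
  proof -
    note \<eta>' = test_function_deriv[OF \<eta> l]
    have "(\<integral>x. (g x - R x) * deriv \<eta> x \<partial>lebesgue_on {0..l}) =
       (\<integral>x. g x * deriv \<eta> x \<partial>lebesgue_on {0..l}) - (\<integral>x. R x * deriv \<eta> x \<partial>lebesgue_on {0..l})"
      unfolding left_diff_distrib
      by (intro Bochner_Integration.integral_diff integrable_mult_test g R \<eta>')
    also have "(\<integral>x. R x * deriv \<eta> x \<partial>lebesgue_on {0..l}) = - (\<integral>x. m * c x * \<eta> x \<partial>lebesgue_on {0..l})"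
      unfolding R_def by (rule parts[OF mc \<eta>])
    also have "(\<integral>x. m * c x * \<eta> x \<partial>lebesgue_on {0..l}) = (\<integral>x. m * f x * \<eta> x \<partial>lebesgue_on {0..l})"
    proof (rule integral_cong_AE)
      show "(\<lambda>x. m * c x * \<eta> x) \<in> borel_measurable (lebesgue_on {0..l})"
        by (intro continuous_measurable_interval continuous_intros mc test_function_continuous[OF \<eta>] c)
      show "(\<lambda>x. m * f x * \<eta> x) \<in> borel_measurable (lebesgue_on {0..l})"
        using integrable_mult_test[OF integrable_mult_right[OF f, of m] \<eta>] by auto
      show "AE x in lebesgue_on {0..l}. m * c x * \<eta> x = m * f x * \<eta> x"
        using ae by eventually_elim simp
    qed
    finally show ?thesis using weak1[OF \<eta>'] weak2[OF \<eta>] by simp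
  qed
  then obtain C where C: "AE x in lebesgue_on {0..l}. g x - R x = C"
    using du_Bois_Reymond[OF l, of "\<lambda>x. g x - R x"] g R by auto
  define c' where "c' x = R x + C" for x
  have c'd: "(c' has_real_derivative m * c x) (at x within {0..l})" if "x \<in> {0..l}" for x
    unfolding c'_def R_def
    by (rule DERIV_cong[OF DERIV_add[OF integral_upto_has_derivative[OF mc that] DERIV_const]]) simp
  have c'c: "continuous_on {0..l} c'" by (rule deriv_within_continuous[OF c'd])
  have gc': "AE x in lebesgue_on {0..l}. g x = c' x" using C by eventually_elim (simp add: c'_def)
  define Q where "Q x = integral {0..x} c'" for x
  have Qc: "continuous_on {0..l} Q"
    unfolding Q_def using deriv_within_continuous[OF integral_upto_has_derivative[OF c'c]] .
  have ci: "integrable (lebesgue_on {0..l}) c" by (rule continuous_integrable_interval[OF c])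
  have Qi: "integrable (lebesgue_on {0..l}) Q" by (rule continuous_integrable_interval[OF Qc])
  have "(\<integral>x. (c x - Q x) * deriv \<eta> x \<partial>lebesgue_on {0..l}) = 0" if \<eta>: "test_function l \<eta>" for \<eta>
  proof -
    note \<eta>' = test_function_deriv[OF \<eta> l]
    have "(\<integral>x. (c x - Q x) * deriv \<eta> x \<partial>lebesgue_on {0..l}) =
       (\<integral>x. c x * deriv \<eta> x \<partial>lebesgue_on {0..l}) - (\<integral>x. Q x * deriv \<eta> x \<partial>lebesgue_on {0..l})"
      unfolding left_diff_distrib
      by (intro Bochner_Integration.integral_diff integrable_mult_test ci Qi \<eta>')
    also have "(\<integral>x. Q x * deriv \<eta> x \<partial>lebesgue_on {0..l}) = - (\<integral>x. c' x * \<eta> x \<partial>lebesgue_on {0..l})"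
      unfolding Q_def by (rule parts[OF c'c \<eta>])
    also have "(\<integral>x. c' x * \<eta> x \<partial>lebesgue_on {0..l}) = (\<integral>x. g x * \<eta> x \<partial>lebesgue_on {0..l})"
      using gc' integrable_mult_test[OF g \<eta>] integrable_mult_test[OF continuous_integrable_interval[OF c'c] \<eta>]
      by (intro integral_cong_AE borel_measurable_integrable) (auto elim: eventually_mono)
    also have "(\<integral>x. c x * deriv \<eta> x \<partial>lebesgue_on {0..l}) = (\<integral>x. f x * deriv \<eta> x \<partial>lebesgue_on {0..l})"
      using ae integrable_mult_test[OF f \<eta>'] integrable_mult_test[OF ci \<eta>']
      by (intro integral_cong_AE borel_measurable_integrable) (auto elim: eventually_mono)
    finally show ?thesis using weak1[OF \<eta>] by simp
  qed
  then obtain D where D: "AE x in lebesgue_on {0..l}. c x - Q x = D"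
    using du_Bois_Reymond[OF l, of "\<lambda>x. c x - Q x"] ci Qi by auto
  have cQ: "c x = Q x + D" if "x \<in> {0..l}" for x
    by (rule continuous_AE_eq_interval[OF l c _ _ that, of "\<lambda>x. Q x + D"])
       (use D Qc in \<open>auto intro!: continuous_intros elim: eventually_mono\<close>)
  have "(c has_real_derivative c' x) (at x within {0..l})" if "x \<in> {0..l}" for x
  proof -
    have "((\<lambda>x. Q x + D) has_real_derivative c' x) (at x within {0..l})"
      unfolding Q_def 
      by (rule DERIV_cong[OF DERIV_add[OF integral_upto_has_derivative[OF c'c that] DERIV_const]]) simp
    then show ?thesis
      by (rule has_field_derivative_transform_within[of _ _ _ _ 1]) (use cQ that in auto)
  qed
  then show ?thesis using that c'd gc' by blast
qed


section \<open>The Hilbert space of square integrable functions\<close>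

definition square_integrable :: "'a measure \<Rightarrow> ('a \<Rightarrow> real) \<Rightarrow> bool" where
  "square_integrable M f \<longleftrightarrow> f \<in> borel_measurable M \<and> integrable M (\<lambda>x. (f x)\<^sup>2)"

lemma square_integrable_mult:
  assumes "square_integrable M f" "square_integrable M g"
  shows "integrable M (\<lambda>x. f x * g x)"
proof (rule Bochner_Integration.integrable_bound[of _ "\<lambda>x. (f x)\<^sup>2 + (g x)\<^sup>2"])
  have "\<bar>a * b\<bar> \<le> a\<^sup>2 + b\<^sup>2" for a b :: real
  proof -
    have "0 \<le> (\<bar>a\<bar> - \<bar>b\<bar>)\<^sup>2" by simp
    then have "2 * \<bar>a * b\<bar> \<le> a\<^sup>2 + b\<^sup>2" by (simp add: power2_diff abs_mult)
    then show ?thesis using abs_ge_zero[of "a * b"] by linarith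
  qed
  then show "AE x in M. norm (f x * g x) \<le> norm ((f x)\<^sup>2 + (g x)\<^sup>2)" by simp
qed (use assms in \<open>auto simp: square_integrable_def\<close>)

lemma square_integrable_add:
  assumes f: "square_integrable M f" and g: "square_integrable M g"
  shows "square_integrable M (\<lambda>x. f x + g x)"
proof -
  have "integrable M (\<lambda>x. (f x)\<^sup>2 + 2 * (f x * g x) + (g x)\<^sup>2)"
    using f g square_integrable_mult[OF f g] by (auto simp: square_integrable_def)
  moreover have "(\<lambda>x. (f x)\<^sup>2 + 2 * (f x * g x) + (g x)\<^sup>2) = (\<lambda>x. (f x + g x)\<^sup>2)"
    by (auto simp: power2_sum)
  ultimately show ?thesis using f g by (auto simp: square_integrable_def)
qed

lemma square_integrable_cmult:
  "square_integrable M f \<Longrightarrow> square_integrable M (\<lambda>x. c * f x)"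
  by (auto simp: square_integrable_def power_mult_distrib)

lemma square_integrable_diff:
  "square_integrable M f \<Longrightarrow> square_integrable M g \<Longrightarrow> square_integrable M (\<lambda>x. f x - g x)"
  using square_integrable_add[OF _ square_integrable_cmult[of M g "-1"], of f] by simp

lemma square_integrable_continuous:
  fixes f :: "real \<Rightarrow> real"
  shows "continuous_on {a..b} f \<Longrightarrow> square_integrable (lebesgue_on {a..b}) f"
  unfolding square_integrable_def
  by (intro conjI continuous_measurable_interval continuous_integrable_interval continuous_on_power)

lemma square_integrable_imp_integrable:
  assumes "finite_measure M" "square_integrable M f" shows "integrable M f"
  using finite_measure.square_integrable_imp_integrable[OF assms(1)] assms(2)
  by (auto simp: square_integrable_def)

text \<open>
  On a finite measure space square integrable increments that decrease geometrically have summable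
  integrals, so the series of increments converges absolutely almost everywhere.
\<close>

lemma fast_Cauchy_AE_convergent:
  assumes "finite_measure M" and f: "\<And>n. square_integrable M (f n)"
    and fast: "\<And>k. (\<integral>x. (f (Suc k) x - f k x)\<^sup>2 \<partial>M) \<le> (1/4) ^ k"
  shows "AE x in M. convergent (\<lambda>k. f k x)"
proof -
  interpret finite_measure M by fact
  define D where "D k x = \<bar>f (Suc k) x - f k x\<bar>" for k x
  have Dm[measurable]: "D k \<in> borel_measurable M" for k
    unfolding D_def using f square_integrable_def
    by (intro borel_measurable_abs borel_measurable_diff) auto
  have sq: "square_integrable M (\<lambda>x. f (Suc k) x - f k x)" for k
    by (intro square_integrable_diff f)
  have bound: "(\<integral>\<^sup>+x. ennreal (D k x) \<partial>M) \<le> ennreal ((measure M (space M) + 1) * (1/2) ^ k)" for k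
  proof -
    \<comment> \<open>The weighted inequality between arithmetic and geometric mean, with weights that make both terms geometric.\<close>
    have le: "D k x \<le> (1/2)^k + 2^k * (f (Suc k) x - f k x)\<^sup>2" for x
    proof -
      have "0 \<le> (1 - 2^k * D k x)\<^sup>2" by simp
      then have "2 * (2^k * D k x) \<le> 1 + (2^k * D k x)\<^sup>2" by (simp add: power2_diff)
      moreover have "0 \<le> 2^k * D k x" by (simp add: D_def)
      ultimately have "2^k * D k x \<le> 1 + 2^k * 2^k * (D k x)\<^sup>2" 
        by (simp add: power_mult_distrib power2_eq_square[of "2^k"])
      then have "(1/2)^k * (2^k * D k x) \<le> (1/2)^k * (1 + 2^k * 2^k * (D k x)\<^sup>2)"
        by (intro mult_left_mono) auto
      then show ?thesis by (simp add: D_def distrib_left power_one_over field_simps)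
    qed
    have i: "integrable M (\<lambda>x. (1/2)^k + 2^k * (f (Suc k) x - f k x)\<^sup>2)"
      using sq[of k] by (auto simp: square_integrable_def)
    have "(\<integral>\<^sup>+x. ennreal (D k x) \<partial>M) \<le> (\<integral>\<^sup>+x. ennreal ((1/2)^k + 2^k * (f (Suc k) x - f k x)\<^sup>2) \<partial>M)"
      using le by (intro nn_integral_mono ennreal_leI) auto
    also have "\<dots> = ennreal (\<integral>x. (1/2)^k + 2^k * (f (Suc k) x - f k x)\<^sup>2 \<partial>M)"
      using i by (intro nn_integral_eq_integral) auto
    also have "\<dots> \<le> ennreal ((measure M (space M) + 1) * (1/2) ^ k)"
    proof (rule ennreal_leI)
      have "(\<integral>x. (1/2)^k + 2^k * (f (Suc k) x - f k x)\<^sup>2 \<partial>M) =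
          measure M (space M) * (1/2)^k + 2^k * (\<integral>x. (f (Suc k) x - f k x)\<^sup>2 \<partial>M)"
        using sq[of k] by (simp add: square_integrable_def)
      also have "2^k * (\<integral>x. (f (Suc k) x - f k x)\<^sup>2 \<partial>M) \<le> 2^k * (1/4)^k"
        by (intro mult_left_mono fast) auto
      also have "2^k * (1/4)^k = (1/2 :: real)^k" by (simp add: power_mult_distrib[symmetric])
      finally show "(\<integral>x. (1/2)^k + 2^k * (f (Suc k) x - f k x)\<^sup>2 \<partial>M) \<le> (measure M (space M) + 1) * (1/2) ^ k"
        by (simp add: algebra_simps)
    qed
    finally show ?thesis .
  qed
  have "(\<integral>\<^sup>+x. (\<Sum>k. ennreal (D k x)) \<partial>M) = (\<Sum>k. \<integral>\<^sup>+x. ennreal (D k x) \<partial>M)"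
    by (intro nn_integral_suminf) auto
  also have "\<dots> \<le> (\<Sum>k. ennreal ((measure M (space M) + 1) * (1/2) ^ k))"
    by (intro suminf_le bound) auto
  also have "\<dots> < \<infinity>"
  proof -
    have "summable (\<lambda>k. (measure M (space M) + 1) * (1/2::real) ^ k)"
      by (intro summable_mult summable_geometric) auto
    then show ?thesis by (subst suminf_ennreal2) auto
  qed
  finally have "AE x in M. (\<Sum>k. ennreal (D k x)) \<noteq> \<infinity>"
    by (intro nn_integral_noteq_infinite) auto
  then show ?thesis
  proof eventually_elim
    case (elim x)
    then have "summable (\<lambda>k. D k x)"
      by (intro summable_suminf_not_top) (auto simp: D_def)
    then have "summable (\<lambda>k. f (Suc k) x - f k x)"
      unfolding D_def by (rule summable_rabs_cancel)
    then have "convergent (\<lambda>n. \<Sum>k<n. f (Suc k) x - f k x)" by (simp only: summable_iff_convergent)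
    then have "convergent (\<lambda>n. f n x - f 0 x)" by (simp only: sum_lessThan_telescope[of "\<lambda>k. f k x"])
    from convergent_add[OF this convergent_const[of "f 0 x"]] show ?case by simp
  qed
qed

text \<open>
  The theorem of Riesz and Fischer: a rapidly Cauchy subsequence converges almost everywhere, and
  Fatou's lemma shows that the pointwise limit is the limit in the mean square of the whole sequence.
\<close>

lemma square_integrable_complete:
  assumes M: "finite_measure M" and f: "\<And>n. square_integrable M (f n)"
    and Cauchy: "\<And>\<epsilon>. \<epsilon> > 0 \<Longrightarrow> \<exists>N. \<forall>m\<ge>N. \<forall>n\<ge>N. (\<integral>x. (f m x - f n x)\<^sup>2 \<partial>M) < (\<epsilon>::real)"
  obtains g where "square_integrable M g" "(\<lambda>n. \<integral>x. (f n x - g x)\<^sup>2 \<partial>M) \<longlonglongrightarrow> 0"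
proof -
  have "\<exists>N. \<forall>m\<ge>N. \<forall>n\<ge>N. (\<integral>x. (f m x - f n x)\<^sup>2 \<partial>M) < (1/4) ^ k" for k :: nat
    by (rule Cauchy) simp
  then obtain N where N: "\<And>k m n. N k \<le> m \<Longrightarrow> N k \<le> n \<Longrightarrow> (\<integral>x. (f m x - f n x)\<^sup>2 \<partial>M) < (1/4) ^ k"
    by metis
  \<comment> \<open>A monotone choice that dominates both \<open>k\<close> and \<open>N k\<close>.\<close>
  define r where "r k = k + (\<Sum>j\<le>k. N j)" for k
  have r: "N k \<le> r k" "k \<le> r k" for k
  proof -
    have "N k \<le> (\<Sum>j\<le>k. N j)" by (rule member_le_sum) auto
    then show "N k \<le> r k" "k \<le> r k" unfolding r_def by linarith+
  qed
  have rS: "r k \<le> r (Suc k)" for k unfolding r_def by simp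
  have conv: "AE x in M. convergent (\<lambda>k. f (r k) x)"
  proof (rule fast_Cauchy_AE_convergent[OF M f])
    have "N k \<le> r (Suc k)" for k using r(1)[of k] rS[of k] by linarith
    then show "(\<integral>x. (f (r (Suc k)) x - f (r k) x)\<^sup>2 \<partial>M) \<le> (1/4) ^ k" for k
      using N[of k "r (Suc k)" "r k"] r(1)[of k] by (simp add: less_imp_le)
  qed
  define g where "g x = lim (\<lambda>k. f (r k) x)" for x
  have fm[measurable]: "f n \<in> borel_measurable M" for n using f by (simp add: square_integrable_def)
  have gm[measurable]: "g \<in> borel_measurable M" unfolding g_def by measurable
  have key: "(\<integral>\<^sup>+x. ennreal ((f n x - g x)\<^sup>2) \<partial>M) \<le> ennreal \<epsilon>"
    if "\<epsilon> > 0" and Ne: "\<And>m. m \<ge> K \<Longrightarrow> (\<integral>x. (f n x - f m x)\<^sup>2 \<partial>M) < \<epsilon>" for n K \<epsilon>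
  proof -
    have "(\<integral>\<^sup>+x. ennreal ((f n x - g x)\<^sup>2) \<partial>M) \<le> (\<integral>\<^sup>+x. liminf (\<lambda>k. ennreal ((f n x - f (r k) x)\<^sup>2)) \<partial>M)"
    proof (rule nn_integral_mono_AE)
      show "AE x in M. ennreal ((f n x - g x)\<^sup>2) \<le> liminf (\<lambda>k. ennreal ((f n x - f (r k) x)\<^sup>2))"
        using conv
      proof eventually_elim
        case (elim x)
        then have "(\<lambda>k. f (r k) x) \<longlonglongrightarrow> g x" unfolding g_def by (simp add: convergent_LIMSEQ_iff)
        then have "(\<lambda>k. ennreal ((f n x - f (r k) x)\<^sup>2)) \<longlonglongrightarrow> ennreal ((f n x - g x)\<^sup>2)"
          by (intro tendsto_intros)
        from lim_imp_Liminf[OF _ this] show ?case by simp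
      qed
    qed
    also have "\<dots> \<le> liminf (\<lambda>k. \<integral>\<^sup>+x. ennreal ((f n x - f (r k) x)\<^sup>2) \<partial>M)"
      by (intro nn_integral_liminf) auto
    also have "\<dots> \<le> liminf (\<lambda>k::nat. ennreal \<epsilon>)"
    proof (rule Liminf_mono)
      show "\<forall>\<^sub>F k in sequentially. (\<integral>\<^sup>+x. ennreal ((f n x - f (r k) x)\<^sup>2) \<partial>M) \<le> ennreal \<epsilon>"
        using eventually_ge_at_top[of K]
      proof eventually_elim
        case (elim k)
        have "(\<integral>\<^sup>+x. ennreal ((f n x - f (r k) x)\<^sup>2) \<partial>M) = ennreal (\<integral>x. (f n x - f (r k) x)\<^sup>2 \<partial>M)"
          using square_integrable_diff[OF f[of n] f[of "r k"]]
          by (intro nn_integral_eq_integral) (auto simp: square_integrable_def)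
        then show ?case using Ne[of "r k"] elim r(2)[of k] by (auto intro!: ennreal_leI)
      qed
    qed
    also have "\<dots> = ennreal \<epsilon>" by (simp add: Liminf_const)
    finally show ?thesis .
  qed
  have sq: "square_integrable M (\<lambda>x. f (N 0) x - g x)"
  proof -
    have "(\<integral>\<^sup>+x. ennreal ((f (N 0) x - g x)\<^sup>2) \<partial>M) \<le> ennreal 1"
      by (rule key[of _ "N 0"]) (use N[of 0] in auto)
    then have "(\<integral>\<^sup>+x. ennreal ((f (N 0) x - g x)\<^sup>2) \<partial>M) < \<infinity>"
      using le_less_trans by fastforce
    then show ?thesis
      unfolding square_integrable_def by (auto intro!: integrableI_nonneg)
  qed
  have g: "square_integrable M g"
    using square_integrable_diff[OF f[of "N 0"] sq] by simp
  have "(\<lambda>n. \<integral>x. (f n x - g x)\<^sup>2 \<partial>M) \<longlonglongrightarrow> 0"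
  proof (rule LIMSEQ_I)
    fix e :: real assume e: "e > 0"
    obtain K where K: "\<And>m n. m \<ge> K \<Longrightarrow> n \<ge> K \<Longrightarrow> (\<integral>x. (f m x - f n x)\<^sup>2 \<partial>M) < e / 2"
      using Cauchy[of "e/2"] e by auto
    have "norm ((\<integral>x. (f n x - g x)\<^sup>2 \<partial>M) - 0) < e" if n: "n \<ge> K" for n
    proof -
      have "ennreal (\<integral>x. (f n x - g x)\<^sup>2 \<partial>M) = (\<integral>\<^sup>+x. ennreal ((f n x - g x)\<^sup>2) \<partial>M)"
        using square_integrable_diff[OF f[of n] g]
        by (intro nn_integral_eq_integral[symmetric]) (auto simp: square_integrable_def)
      also have "\<dots> \<le> ennreal (e / 2)" by (rule key[of _ K]) (use e K n in auto)
      finally have "(\<integral>x. (f n x - g x)\<^sup>2 \<partial>M) \<le> e / 2" using e by (simp add: ennreal_le_iff)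
      moreover have "0 \<le> (\<integral>x. (f n x - g x)\<^sup>2 \<partial>M)" by simp
      ultimately show ?thesis using e by simp
    qed
    then show "\<exists>no. \<forall>n\<ge>no. norm ((\<integral>x. (f n x - g x)\<^sup>2 \<partial>M) - 0) < e" by blast
  qed
  with g show ?thesis using that by blast
qed

subsection \<open>Square integrable functions on a graph\<close>

lemma finite_measure_edge: "finite_measure (lebesgue_on {0..l::real})"
  by (rule finite_measure_lebesgue_on) auto

lemma L2_iff: "f \<in> L2 \<Gamma> \<longleftrightarrow> (\<forall>e\<in>arcs (shape \<Gamma>). square_integrable (edge_measure \<Gamma> e) (f e))"
  by (auto simp: L2_def square_integrable_def)

lemma L2_add: "f \<in> L2 \<Gamma> \<Longrightarrow> g \<in> L2 \<Gamma> \<Longrightarrow> (\<lambda>e x. f e x + g e x) \<in> L2 \<Gamma>"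
  by (simp add: L2_iff square_integrable_add)

lemma L2_diff: "f \<in> L2 \<Gamma> \<Longrightarrow> g \<in> L2 \<Gamma> \<Longrightarrow> (\<lambda>e x. f e x - g e x) \<in> L2 \<Gamma>"
  by (simp add: L2_iff square_integrable_diff)

lemma L2_cmult: "f \<in> L2 \<Gamma> \<Longrightarrow> (\<lambda>e x. c * f e x) \<in> L2 \<Gamma>"
  by (simp add: L2_iff square_integrable_cmult)

lemma L2_zero: "(\<lambda>e x. 0) \<in> L2 \<Gamma>"
  by (simp add: L2_iff square_integrable_def)

lemma L2_sum:
  fixes f :: "'i \<Rightarrow> 'e graph_fun" and c :: "'i \<Rightarrow> real"
  shows "finite I \<Longrightarrow> (\<And>i. i \<in> I \<Longrightarrow> f i \<in> L2 \<Gamma>) \<Longrightarrow> (\<lambda>e x. \<Sum>i\<in>I. c i * f i e x) \<in> L2 \<Gamma>"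
  by (induction I rule: finite_induct) (auto intro!: L2_zero L2_add L2_cmult)

lemma L2_integrable_mult:
  "f \<in> L2 \<Gamma> \<Longrightarrow> g \<in> L2 \<Gamma> \<Longrightarrow> e \<in> arcs (shape \<Gamma>) \<Longrightarrow> integrable (edge_measure \<Gamma> e) (\<lambda>x. f e x * g e x)"
  by (simp add: L2_iff square_integrable_mult)

lemma L2_integrable:
  "f \<in> L2 \<Gamma> \<Longrightarrow> e \<in> arcs (shape \<Gamma>) \<Longrightarrow> integrable (edge_measure \<Gamma> e) (f e)"
  using square_integrable_imp_integrable finite_measure_edge by (auto simp: L2_iff)

lemma L2_inner_commute: "L2_inner \<Gamma> f g = L2_inner \<Gamma> g f"
  by (simp add: L2_inner_def mult.commute)

lemma L2_inner_self_nonneg: "0 \<le> L2_inner \<Gamma> f f"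
  unfolding L2_inner_def by (intro sum_nonneg integral_nonneg_AE) auto

lemma L2_norm_sq: "(L2_norm \<Gamma> f)\<^sup>2 = L2_inner \<Gamma> f f"
  by (simp add: L2_norm_def L2_inner_self_nonneg)

lemma L2_norm_nonneg: "0 \<le> L2_norm \<Gamma> f"
  by (simp add: L2_norm_def L2_inner_self_nonneg)

lemma L2_inner_add_left:
  "f \<in> L2 \<Gamma> \<Longrightarrow> g \<in> L2 \<Gamma> \<Longrightarrow> h \<in> L2 \<Gamma> \<Longrightarrow>
   L2_inner \<Gamma> (\<lambda>e x. f e x + g e x) h = L2_inner \<Gamma> f h + L2_inner \<Gamma> g h"
  by (simp add: L2_inner_def distrib_right L2_integrable_mult sum.distrib)

lemma L2_inner_diff_left:
  "f \<in> L2 \<Gamma> \<Longrightarrow> g \<in> L2 \<Gamma> \<Longrightarrow> h \<in> L2 \<Gamma> \<Longrightarrow>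
   L2_inner \<Gamma> (\<lambda>e x. f e x - g e x) h = L2_inner \<Gamma> f h - L2_inner \<Gamma> g h"
  by (simp add: L2_inner_def left_diff_distrib L2_integrable_mult sum_subtractf)

lemma L2_inner_cmult_left: "L2_inner \<Gamma> (\<lambda>e x. c * f e x) h = c * L2_inner \<Gamma> f h"
  by (simp add: L2_inner_def mult.assoc sum_distrib_left)

lemma L2_inner_zero_left: "L2_inner \<Gamma> (\<lambda>e x. 0) h = 0"
  by (simp add: L2_inner_def)

lemma L2_inner_sum_left:
  fixes f :: "'i \<Rightarrow> 'e graph_fun" and c :: "'i \<Rightarrow> real"
  assumes "finite I" "\<And>i. i \<in> I \<Longrightarrow> f i \<in> L2 \<Gamma>" "h \<in> L2 \<Gamma>"
  shows "L2_inner \<Gamma> (\<lambda>e x. \<Sum>i\<in>I. c i * f i e x) h = (\<Sum>i\<in>I. c i * L2_inner \<Gamma> (f i) h)"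
  using assms(1,2)
  by (induction I rule: finite_induct)
     (auto simp: L2_inner_zero_left L2_inner_add_left L2_inner_cmult_left L2_sum L2_cmult assms(3))

lemma L2_inner_sum_right:
  fixes f :: "'i \<Rightarrow> 'e graph_fun" and c :: "'i \<Rightarrow> real"
  assumes "finite I" "\<And>i. i \<in> I \<Longrightarrow> f i \<in> L2 \<Gamma>" "h \<in> L2 \<Gamma>"
  shows "L2_inner \<Gamma> h (\<lambda>e x. \<Sum>i\<in>I. c i * f i e x) = (\<Sum>i\<in>I. c i * L2_inner \<Gamma> h (f i))"
  using L2_inner_sum_left[OF assms, where c = c] by (simp add: L2_inner_commute[of \<Gamma> h])

lemma L2_inner_self_sum_orthogonal:
  fixes f :: "'i \<Rightarrow> 'e graph_fun" and c m :: "'i \<Rightarrow> real"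
  assumes "finite I" "\<And>i. f i \<in> L2 \<Gamma>" "\<And>i j. L2_inner \<Gamma> (f i) (f j) = (if i = j then m i else 0)"
  shows "L2_inner \<Gamma> (\<lambda>e x. \<Sum>i\<in>I. c i * f i e x) (\<lambda>e x. \<Sum>i\<in>I. c i * f i e x) = (\<Sum>i\<in>I. (c i)\<^sup>2 * m i)"
  using assms(1)
  by (simp add: L2_inner_sum_left L2_inner_sum_right L2_sum assms(2,3) if_distrib[of "\<lambda>x. _ * x"] sum.delta' power2_eq_square
        mult.assoc cong: if_cong sum.cong)

lemma L2_inner_cong:
  assumes "f \<in> L2 \<Gamma>" "f' \<in> L2 \<Gamma>" "g \<in> L2 \<Gamma>" "g' \<in> L2 \<Gamma>" "ae_eq \<Gamma> f f'" "ae_eq \<Gamma> g g'"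
  shows "L2_inner \<Gamma> f g = L2_inner \<Gamma> f' g'"
  unfolding L2_inner_def
proof (rule sum.cong)
  fix e assume e: "e \<in> arcs (shape \<Gamma>)"
  have 1: "AE x in edge_measure \<Gamma> e. f e x = f' e x" and 2: "AE x in edge_measure \<Gamma> e. g e x = g' e x"
    using assms(5,6) e by (auto simp: ae_eq_def)
  show "(\<integral>x. f e x * g e x \<partial>edge_measure \<Gamma> e) = (\<integral>x. f' e x * g' e x \<partial>edge_measure \<Gamma> e)"
  proof (rule integral_cong_AE)
    show "AE x in edge_measure \<Gamma> e. f e x * g e x = f' e x * g' e x"
      using 1 2 by eventually_elim simp
  qed (use e assms(1-4) in \<open>auto intro!: borel_measurable_integrable L2_integrable_mult\<close>)
qed simp

lemma L2_Cauchy_Schwarz: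
  assumes f: "f \<in> L2 \<Gamma>" and g: "g \<in> L2 \<Gamma>"
  shows "(L2_inner \<Gamma> f g)\<^sup>2 \<le> L2_inner \<Gamma> f f * L2_inner \<Gamma> g g"
proof -
  define A B C where "A = L2_inner \<Gamma> f f" and "B = L2_inner \<Gamma> f g" and "C = L2_inner \<Gamma> g g"
  have q: "0 \<le> A - 2 * t * B + t\<^sup>2 * C" for t
  proof -
    have "0 \<le> L2_inner \<Gamma> (\<lambda>e x. f e x - t * g e x) (\<lambda>e x. f e x - t * g e x)" by (rule L2_inner_self_nonneg)
    also have "\<dots> = L2_inner \<Gamma> f (\<lambda>e x. f e x - t * g e x) - t * L2_inner \<Gamma> g (\<lambda>e x. f e x - t * g e x)"
      by (simp add: L2_inner_diff_left L2_inner_cmult_left f g L2_diff L2_cmult)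
    also have "L2_inner \<Gamma> f (\<lambda>e x. f e x - t * g e x) = A - t * B"
      by (subst L2_inner_commute) (simp add: L2_inner_diff_left L2_inner_cmult_left f g L2_diff L2_cmult
          A_def B_def L2_inner_commute[of \<Gamma> g f])
    also have "L2_inner \<Gamma> g (\<lambda>e x. f e x - t * g e x) = B - t * C"
      by (subst L2_inner_commute) (simp add: L2_inner_diff_left L2_inner_cmult_left f g L2_diff L2_cmult
          C_def B_def)
    finally show ?thesis by (simp add: algebra_simps power2_eq_square)
  qed
  have "B\<^sup>2 \<le> A * C"
  proof (cases "C = 0")
    case True
    have "B = 0"
    proof (rule ccontr)
      assume "B \<noteq> 0"
      then show False using q[of "(A + 1) / (2 * B)"] True by simp
    qed
    then show ?thesis using True by simp
  next
    case False
    then have C: "C > 0" using L2_inner_self_nonneg[of \<Gamma> g] by (simp add: C_def)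
    have "0 \<le> (A - 2 * (B / C) * B + (B / C)\<^sup>2 * C) * C" using q[of "B / C"] C by (intro mult_nonneg_nonneg) (auto simp del: times_divide_eq_right)
    also have "\<dots> = A * C - B\<^sup>2" using C by (simp add: field_simps power2_eq_square)
    finally show ?thesis by simp
  qed
  then show ?thesis by (simp add: A_def B_def C_def)
qed

lemma L2_inner_bound: 
  assumes "f \<in> L2 \<Gamma>" "g \<in> L2 \<Gamma>" shows "\<bar>L2_inner \<Gamma> f g\<bar> \<le> L2_norm \<Gamma> f * L2_norm \<Gamma> g"
  using L2_Cauchy_Schwarz[OF assms] L2_norm_nonneg[of \<Gamma> f] L2_norm_nonneg[of \<Gamma> g]
  by (intro power2_le_imp_le[of "\<bar>L2_inner \<Gamma> f g\<bar>"]) (auto simp: power_mult_distrib L2_norm_sq)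

lemma L2_inner_tendsto:
  assumes f: "\<And>n. f n \<in> L2 \<Gamma>" "g \<in> L2 \<Gamma>" "h \<in> L2 \<Gamma>"
    and lim: "(\<lambda>n. L2_norm \<Gamma> (\<lambda>e x. g e x - f n e x)) \<longlonglongrightarrow> 0"
  shows "(\<lambda>n. L2_inner \<Gamma> (f n) h) \<longlonglongrightarrow> L2_inner \<Gamma> g h"
proof -
  have "(\<lambda>n. L2_norm \<Gamma> (\<lambda>e x. g e x - f n e x) * L2_norm \<Gamma> h) \<longlonglongrightarrow> 0"
    using tendsto_mult_left_zero[OF lim] .
  moreover have "\<forall>\<^sub>F n in sequentially. norm (L2_inner \<Gamma> (\<lambda>e x. g e x - f n e x) h)
      \<le> L2_norm \<Gamma> (\<lambda>e x. g e x - f n e x) * L2_norm \<Gamma> h"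
    unfolding real_norm_def by (intro always_eventually allI L2_inner_bound L2_diff f)
  ultimately have "(\<lambda>n. L2_inner \<Gamma> (\<lambda>e x. g e x - f n e x) h) \<longlonglongrightarrow> 0"
    by (rule Lim_null_comparison[rotated])
  then have "(\<lambda>n. L2_inner \<Gamma> g h - L2_inner \<Gamma> (f n) h) \<longlonglongrightarrow> 0"
    by (simp add: L2_inner_diff_left f)
  from tendsto_diff[OF tendsto_const[of "L2_inner \<Gamma> g h"] this] show ?thesis by simp
qed

lemma L2_complete:
  assumes fin: "finite (arcs (shape \<Gamma>))" and f: "\<And>n. f n \<in> L2 \<Gamma>"
    and Cauchy: "\<And>\<epsilon>. \<epsilon> > 0 \<Longrightarrow> \<exists>N. \<forall>m\<ge>N. \<forall>n\<ge>N. L2_inner \<Gamma> (\<lambda>e x. f m e x - f n e x) (\<lambda>e x. f m e x - f n e x) < \<epsilon>"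
  obtains g where "g \<in> L2 \<Gamma>" "(\<lambda>n. L2_norm \<Gamma> (\<lambda>e x. g e x - f n e x)) \<longlonglongrightarrow> 0"
proof -
  have "\<exists>g. square_integrable (edge_measure \<Gamma> e) g \<and> (\<lambda>n. \<integral>x. (f n e x - g x)\<^sup>2 \<partial>edge_measure \<Gamma> e) \<longlonglongrightarrow> 0"
    if e: "e \<in> arcs (shape \<Gamma>)" for e
  proof -
    have "\<exists>N. \<forall>m\<ge>N. \<forall>n\<ge>N. (\<integral>x. (f m e x - f n e x)\<^sup>2 \<partial>edge_measure \<Gamma> e) < \<epsilon>" if "\<epsilon> > 0" for \<epsilon>
    proof -
      obtain N where N: "\<And>m n. m \<ge> N \<Longrightarrow> n \<ge> N \<Longrightarrow> L2_inner \<Gamma> (\<lambda>e x. f m e x - f n e x) (\<lambda>e x. f m e x - f n e x) < \<epsilon>"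
        using Cauchy[OF \<open>\<epsilon> > 0\<close>] by blast
      have "(\<integral>x. (f m e x - f n e x)\<^sup>2 \<partial>edge_measure \<Gamma> e) \<le> L2_inner \<Gamma> (\<lambda>e x. f m e x - f n e x) (\<lambda>e x. f m e x - f n e x)" for m n
        unfolding L2_inner_def power2_eq_square using e fin
        by (intro member_le_sum[where f = "\<lambda>e. \<integral>x. (f m e x - f n e x) * (f m e x - f n e x) \<partial>edge_measure \<Gamma> e"]) auto
      then show ?thesis using N le_less_trans by blast
    qed
    note C = this
    have sq: "square_integrable (edge_measure \<Gamma> e) (f n e)" for n using f e by (simp add: L2_iff)
    obtain g where "square_integrable (edge_measure \<Gamma> e) g" "(\<lambda>n. \<integral>x. (f n e x - g x)\<^sup>2 \<partial>edge_measure \<Gamma> e) \<longlonglongrightarrow> 0"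
      by (rule square_integrable_complete[OF finite_measure_edge sq C])
    then show ?thesis by blast
  qed
  then have "\<exists>g. \<forall>e\<in>arcs (shape \<Gamma>). square_integrable (edge_measure \<Gamma> e) (g e) \<and>
      (\<lambda>n. \<integral>x. (f n e x - g e x)\<^sup>2 \<partial>edge_measure \<Gamma> e) \<longlonglongrightarrow> 0"
    by (intro bchoice ballI)
  then obtain g where g: "\<And>e. e \<in> arcs (shape \<Gamma>) \<Longrightarrow> square_integrable (edge_measure \<Gamma> e) (g e)"
    "\<And>e. e \<in> arcs (shape \<Gamma>) \<Longrightarrow> (\<lambda>n. \<integral>x. (f n e x - g e x)\<^sup>2 \<partial>edge_measure \<Gamma> e) \<longlonglongrightarrow> 0"
    by blast
  have "(\<lambda>n. \<Sum>e\<in>arcs (shape \<Gamma>). \<integral>x. (f n e x - g e x)\<^sup>2 \<partial>edge_measure \<Gamma> e) \<longlonglongrightarrow> (\<Sum>e\<in>arcs (shape \<Gamma>). 0)"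
    by (intro tendsto_sum g)
  then have "(\<lambda>n. L2_inner \<Gamma> (\<lambda>e x. g e x - f n e x) (\<lambda>e x. g e x - f n e x)) \<longlonglongrightarrow> 0"
    by (simp add: L2_inner_def power2_eq_square[symmetric] power2_commute[of "g _ _"])
  then have "(\<lambda>n. L2_norm \<Gamma> (\<lambda>e x. g e x - f n e x)) \<longlonglongrightarrow> 0"
    unfolding L2_norm_def using tendsto_real_sqrt by fastforce
  moreover have "g \<in> L2 \<Gamma>" using g(1) by (simp add: L2_iff)
  ultimately show ?thesis using that by blast
qed

text \<open>
  By orthogonality the squared norm of a block of the series is the corresponding block of \<open>(c i)\<^sup>2 * m i\<close>.
\<close>

lemma L2_orthogonal_Cauchy:
  fixes f :: "nat \<Rightarrow> 'e graph_fun" and c m :: "nat \<Rightarrow> real"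
  assumes f: "\<And>i. f i \<in> L2 \<Gamma>"
    and orth: "\<And>i j. L2_inner \<Gamma> (f i) (f j) = (if i = j then m i else 0)"
    and sum: "summable (\<lambda>i. (c i)\<^sup>2 * m i)" and \<epsilon>: "\<epsilon> > 0"
  shows "\<exists>N. \<forall>k\<ge>N. \<forall>n\<ge>N. L2_inner \<Gamma> (\<lambda>e x. (\<Sum>i<k. c i * f i e x) - (\<Sum>i<n. c i * f i e x))
             (\<lambda>e x. (\<Sum>i<k. c i * f i e x) - (\<Sum>i<n. c i * f i e x)) < \<epsilon>"
proof -
  let ?N = "\<lambda>k n. L2_inner \<Gamma> (\<lambda>e x. (\<Sum>i<k. c i * f i e x) - (\<Sum>i<n. c i * f i e x))
             (\<lambda>e x. (\<Sum>i<k. c i * f i e x) - (\<Sum>i<n. c i * f i e x))"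
  obtain N where N: "\<And>k n. k \<ge> N \<Longrightarrow> \<bar>\<Sum>i=k..<n. (c i)\<^sup>2 * m i\<bar> < \<epsilon>"
    using sum \<epsilon> by (metis summable_Cauchy real_norm_def)
  have *: "?N k n < \<epsilon>" if "N \<le> n" "n \<le> k" for k n
  proof -
    have "(\<Sum>i<k. c i * f i e x) - (\<Sum>i<n. c i * f i e x) = (\<Sum>i=n..<k. c i * f i e x)" for e x
      using sum_diff_nat_ivl[of 0 n k "\<lambda>i. c i * f i e x"] that by (simp add: atLeast0LessThan)
    then show ?thesis using N[of n k] that L2_inner_self_sum_orthogonal[OF _ f orth, of "{n..<k}" c] by auto
  qed
  have sym: "?N k n = ?N n k" for k n
    unfolding L2_inner_def by (intro sum.cong refl Bochner_Integration.integral_cong) (auto simp: algebra_simps)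
  have "?N k n < \<epsilon>" if "N \<le> n" "N \<le> k" for k n
    using *[of n k] *[of k n] sym[of k n] that by (cases "n \<le> k") auto
  then show ?thesis by blast
qed

lemma L2_orthogonal_series:
  fixes f :: "nat \<Rightarrow> 'e graph_fun" and c m :: "nat \<Rightarrow> real"
  assumes fin: "finite (arcs (shape \<Gamma>))" and f: "\<And>i. f i \<in> L2 \<Gamma>"
    and orth: "\<And>i j. L2_inner \<Gamma> (f i) (f j) = (if i = j then m i else 0)"
    and sum: "summable (\<lambda>i. (c i)\<^sup>2 * m i)"
  obtains g where "g \<in> L2 \<Gamma>" "(\<lambda>n. L2_norm \<Gamma> (\<lambda>e x. g e x - (\<Sum>i<n. c i * f i e x))) \<longlonglongrightarrow> 0"
proof (rule L2_complete[OF fin, of "\<lambda>n e x. \<Sum>i<n. c i * f i e x"])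
  show "(\<lambda>e x. \<Sum>i<n. c i * f i e x) \<in> L2 \<Gamma>" for n by (intro L2_sum f) auto
qed (rule L2_orthogonal_Cauchy[OF f orth sum], assumption, rule that)


section \<open>Eigenfunctions of the Kirchhoff Laplacian\<close>

text \<open>
  At a point where \<open>\<bar>f\<bar>\<close> is minimal, \<open>f\<^sup>2\<close> is at most its average. From there \<open>f\<^sup>2\<close> changes by at
  most the integral of \<open>\<bar>2 * f * f'\<bar> \<le> t * f\<^sup>2 + f'\<^sup>2 / t\<close>. The free parameter \<open>t\<close> replaces the
  geometric mean of the two norms and is chosen where the inequality is used.
\<close>

lemma trace_inequality:
  fixes f f' :: "real \<Rightarrow> real"
  assumes l: "0 < l" and t: "0 < t" and f: "\<And>x. x \<in> {0..l} \<Longrightarrow> (f has_real_derivative f' x) (at x within {0..l})"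
    and f': "continuous_on {0..l} f'" and x: "x \<in> {0..l}"
  shows "(f x)\<^sup>2 \<le> (1 / l + t) * (\<integral>x. (f x)\<^sup>2 \<partial>lebesgue_on {0..l}) + (1 / t) * (\<integral>x. (f' x)\<^sup>2 \<partial>lebesgue_on {0..l})"
proof -
  have fc: "continuous_on {0..l} f" by (rule deriv_within_continuous[OF f])
  then have f2: "continuous_on {0..l} (\<lambda>x. (f x)\<^sup>2)" by (intro continuous_intros)
  \<comment> \<open>\<open>P\<close> is the antiderivative of the dominating function, so \<open>P - f\<^sup>2\<close> and \<open>P + f\<^sup>2\<close> are both increasing.\<close>
  define W where "W x = t * (f x)\<^sup>2 + (1 / t) * (f' x)\<^sup>2" for x
  have W: "continuous_on {0..l} W" unfolding W_def using fc f' by (intro continuous_intros)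
  define P where "P x = integral {0..x} W" for x
  have P: "(P has_real_derivative W x) (at x within {0..l})" if "x \<in> {0..l}" for x
    unfolding P_def by (rule integral_upto_has_derivative[OF W that])
  have W0: "0 \<le> W x" for x using t by (simp add: W_def)
  have dom: "2 * f x * f' x \<le> W x" "- (2 * f x * f' x) \<le> W x" "0 \<le> W x + 2 * f x * f' x" for x
  proof -
    have "0 \<le> (t * f x - f' x)\<^sup>2 / t" "0 \<le> (t * f x + f' x)\<^sup>2 / t" using t by auto
    then show *: "2 * f x * f' x \<le> W x" "- (2 * f x * f' x) \<le> W x"
      using t unfolding W_def by (auto simp: power2_eq_square field_simps)
    then show "0 \<le> W x + 2 * f x * f' x" by linarith
  qed
  have mono: "g a \<le> g b" if "0 \<le> a" "a \<le> b" "b \<le> l"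
    and g: "\<And>x. x \<in> {0..l} \<Longrightarrow> (g has_real_derivative g' x) (at x within {0..l})"
    and g0: "\<And>x. 0 \<le> g' x" for g g' :: "real \<Rightarrow> real" and a b
  proof (rule DERIV_nonneg_imp_increasing_open[OF \<open>a \<le> b\<close>])
    show "\<exists>y. (g has_real_derivative y) (at x) \<and> 0 \<le> y" if "a < x" "x < b" for x
      using g[of x] g0[of x] that \<open>0 \<le> a\<close> \<open>b \<le> l\<close> at_within_Icc_at[of 0 x l] by auto
    show "continuous_on {a..b} g"
      by (rule continuous_on_subset[OF deriv_within_continuous[OF g]]) (use that in auto)
  qed
  have d1: "((\<lambda>x. P x - (f x)\<^sup>2) has_real_derivative (W x - 2 * f x * f' x)) (at x within {0..l})"
    and d2: "((\<lambda>x. P x + (f x)\<^sup>2) has_real_derivative (W x + 2 * f x * f' x)) (at x within {0..l})"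
    if "x \<in> {0..l}" for x
    using P[OF that] f[OF that] by (auto intro!: derivative_eq_intros)
  have Pl: "P l = t * (\<integral>x. (f x)\<^sup>2 \<partial>lebesgue_on {0..l}) + (1 / t) * (\<integral>x. (f' x)\<^sup>2 \<partial>lebesgue_on {0..l})"
  proof -
    have "P l = (\<integral>x. W x \<partial>lebesgue_on {0..l})"
      unfolding P_def using W by (intro lebesgue_integral_eq_integral[symmetric] continuous_integrable_interval) auto
    also have "\<dots> = t * (\<integral>x. (f x)\<^sup>2 \<partial>lebesgue_on {0..l}) + (1 / t) * (\<integral>x. (f' x)\<^sup>2 \<partial>lebesgue_on {0..l})"
      using continuous_integrable_interval[OF f2] continuous_integrable_interval[OF continuous_on_power[OF f', of 2]]
      unfolding W_def by simp
    finally show ?thesis .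
  qed
  have P0: "P 0 = 0" by (simp add: P_def)
  obtain y where y: "y \<in> {0..l}" "\<And>x. x \<in> {0..l} \<Longrightarrow> (f y)\<^sup>2 \<le> (f x)\<^sup>2"
    using continuous_attains_inf[OF compact_Icc _ f2] l by auto
  have "(\<integral>x. (f y)\<^sup>2 \<partial>lebesgue_on {0..l}) \<le> (\<integral>x. (f x)\<^sup>2 \<partial>lebesgue_on {0..l})"
    using y by (intro integral_mono continuous_integrable_interval f2) auto
  then have fy: "(f y)\<^sup>2 \<le> (1 / l) * (\<integral>x. (f x)\<^sup>2 \<partial>lebesgue_on {0..l})"
    using l by (simp add: measure_restrict_space field_simps)
  have "(f x)\<^sup>2 \<le> (f y)\<^sup>2 + P l"
  proof (cases "y \<le> x")
    case True
    have "P y - (f y)\<^sup>2 \<le> P x - (f x)\<^sup>2" 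
      by (rule mono[OF _ True _ d1]) (use x y dom in auto)
    moreover have "P x \<le> P l" "P 0 \<le> P y" by (rule mono[OF _ _ _ P]; use x y W0 in auto)+
    ultimately show ?thesis using P0 by linarith
  next
    case False
    have "P x + (f x)\<^sup>2 \<le> P y + (f y)\<^sup>2"
      by (rule mono[OF _ _ _ d2]) (use x y dom(3) False in auto)
    moreover have "P y \<le> P l" "P 0 \<le> P x" by (rule mono[OF _ _ _ P]; use x y W0 in auto)+
    ultimately show ?thesis using P0 by linarith
  qed
  then show ?thesis using fy Pl by (simp add: distrib_right)
qed

lemma deriv_within_interval_unique:
  fixes f :: "real \<Rightarrow> real"
  assumes "0 < l" "x \<in> {0..l}" "(f has_real_derivative a) (at x within {0..l})" "(f has_real_derivative b) (at x within {0..l})"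
  shows "a = b"
proof -
  have "(*) a = (*) b"
    by (rule frechet_derivative_unique_within_closed_interval[of 0 l x f])
       (use assms in \<open>auto simp: has_field_derivative_def\<close>)
  then show ?thesis by (metis mult.right_neutral)
qed

subsection \<open>Spectral data\<close>

locale kirchhoff_eigenbasis =
  fixes \<Gamma> :: "('v, 'e) metric_graph" and \<kappa> :: real and \<phi> :: "nat \<Rightarrow> 'e graph_fun" and lam :: "nat \<Rightarrow> real"
  assumes graph: "compact_metric_graph \<Gamma>" and kappa: "\<kappa> > 0" and basis: "eigenbasis \<Gamma> \<kappa> \<phi> lam"
begin

abbreviation "E \<equiv> arcs (shape \<Gamma>)"
abbreviation "V \<equiv> verts (shape \<Gamma>)"
abbreviation "inn \<equiv> L2_inner \<Gamma>"

lemma finite_E: "finite E" and finite_V: "finite V" and E_nonempty: "E \<noteq> {}"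
  and len_pos: "e \<in> E \<Longrightarrow> 0 < len \<Gamma> e"
  and tail_V: "e \<in> E \<Longrightarrow> tail (shape \<Gamma>) e \<in> V" and head_V: "e \<in> E \<Longrightarrow> head (shape \<Gamma>) e \<in> V"
  using graph unfolding compact_metric_graph_def
  by (auto simp: fin_digraph_def fin_digraph_axioms_def wf_digraph_def)

lemma lam_pos: "0 < lam i"
  using basis unfolding eigenbasis_def by (metis incseqD less_le_trans zero_le)

lemma lam_mono: "i \<le> j \<Longrightarrow> lam i \<le> lam j"
  using basis unfolding eigenbasis_def by (auto dest: incseqD)

lemma phi_L2: "\<phi> i \<in> L2 \<Gamma>"
  using basis by (auto simp: eigenbasis_def laplacian_dom_def Sobolev_edges_def)

lemma phi_orthonormal: "inn (\<phi> i) (\<phi> j) = (if i = j then 1 else 0)"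
  using basis by (auto simp: eigenbasis_def)

lemma phi_expansion:
  "f \<in> L2 \<Gamma> \<Longrightarrow> (\<lambda>n. L2_norm \<Gamma> (\<lambda>e x. f e x - (\<Sum>i<n. inn f (\<phi> i) * \<phi> i e x))) \<longlonglongrightarrow> 0"
  using basis by (auto simp: eigenbasis_def)

text \<open>
  The eigenvalue equation only says that the weak second derivative equals
  \<open>(\<kappa>\<^sup>2 - lam i) * \<phi> i\<close> almost everywhere; together with the weak first derivative this makes the continuous
  representative a classical solution up to the ends of each edge.
\<close>

lemma phi_regular:
  "\<exists>c c'. continuous_on_graph \<Gamma> c \<and> ae_eq \<Gamma> (\<phi> i) c \<and>
     (\<forall>e\<in>E. \<forall>x\<in>{0..len \<Gamma> e}. (c e has_real_derivative c' e x) (at x within {0..len \<Gamma> e}) \<and>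
        (c' e has_real_derivative (\<kappa>\<^sup>2 - lam i) * c e x) (at x within {0..len \<Gamma> e}))"
proof -
  have dom: "\<phi> i \<in> laplacian_dom \<Gamma>" and L: "ae_eq \<Gamma> (L_op \<Gamma> \<kappa> (\<phi> i)) (\<lambda>e x. lam i * \<phi> i e x)"
    using basis by (auto simp: eigenbasis_def)
  obtain c where c: "continuous_on_graph \<Gamma> c" "ae_eq \<Gamma> (\<phi> i) c"
    using dom by (auto simp: laplacian_dom_def C_space_def)
  have wd: "\<And>j. j \<le> 2 \<Longrightarrow> weakly_differentiable \<Gamma> j (\<phi> i)"
    using dom by (auto simp: laplacian_dom_def Sobolev_edges_def)
  obtain g where g: "has_weak_deriv \<Gamma> 1 (\<phi> i) g"
    using wd[of 1] by (auto simp: weakly_differentiable_def)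
  have lap: "has_weak_deriv \<Gamma> 2 (\<phi> i) (laplacian \<Gamma> (\<phi> i))"
    unfolding laplacian_def weak_deriv_def
    using wd[of 2] unfolding weakly_differentiable_def by (intro someI_ex[of "has_weak_deriv \<Gamma> 2 (\<phi> i)"]) simp
  have "\<exists>c'. \<forall>x\<in>{0..len \<Gamma> e}. (c e has_real_derivative c' x) (at x within {0..len \<Gamma> e}) \<and>
        (c' has_real_derivative (\<kappa>\<^sup>2 - lam i) * c e x) (at x within {0..len \<Gamma> e})" if e: "e \<in> E" for e
  proof -
    let ?l = "len \<Gamma> e"
    have lap_eq: "AE x in edge_measure \<Gamma> e. laplacian \<Gamma> (\<phi> i) e x = (\<kappa>\<^sup>2 - lam i) * \<phi> i e x"
    proof -
      have "AE x in edge_measure \<Gamma> e. L_op \<Gamma> \<kappa> (\<phi> i) e x = lam i * \<phi> i e x"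
        using L e by (simp add: ae_eq_def)
      then show ?thesis by eventually_elim (simp add: L_op_def algebra_simps)
    qed
    have int: "integrable (edge_measure \<Gamma> e) (\<phi> i e)" "integrable (edge_measure \<Gamma> e) (g e)"
      "integrable (edge_measure \<Gamma> e) (laplacian \<Gamma> (\<phi> i) e)"
      using g lap e L2_integrable by (auto simp: has_weak_deriv_def)
    have w1: "(\<integral>x. \<phi> i e x * deriv \<eta> x \<partial>edge_measure \<Gamma> e) = - (\<integral>x. g e x * \<eta> x \<partial>edge_measure \<Gamma> e)"
      if "test_function ?l \<eta>" for \<eta>
      using g e that by (auto simp: has_weak_deriv_def)
    have w2: "(\<integral>x. \<phi> i e x * deriv (deriv \<eta>) x \<partial>edge_measure \<Gamma> e) =
        (\<integral>x. (\<kappa>\<^sup>2 - lam i) * \<phi> i e x * \<eta> x \<partial>edge_measure \<Gamma> e)" if \<eta>: "test_function ?l \<eta>" for \<eta>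
    proof -
      have "(\<integral>x. \<phi> i e x * deriv (deriv \<eta>) x \<partial>edge_measure \<Gamma> e) =
          (\<integral>x. laplacian \<Gamma> (\<phi> i) e x * \<eta> x \<partial>edge_measure \<Gamma> e)"
        using lap e \<eta> by (auto simp: has_weak_deriv_def numeral_2_eq_2)
      also have "\<dots> = (\<integral>x. (\<kappa>\<^sup>2 - lam i) * \<phi> i e x * \<eta> x \<partial>edge_measure \<Gamma> e)"
      proof (rule integral_cong_AE)
        show "AE x in edge_measure \<Gamma> e. laplacian \<Gamma> (\<phi> i) e x * \<eta> x = (\<kappa>\<^sup>2 - lam i) * \<phi> i e x * \<eta> x"
          using lap_eq by eventually_elim simp
        show "(\<lambda>x. laplacian \<Gamma> (\<phi> i) e x * \<eta> x) \<in> borel_measurable (edge_measure \<Gamma> e)"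
          by (rule borel_measurable_integrable[OF integrable_mult_test[OF int(3) \<eta>]])
        show "(\<lambda>x. (\<kappa>\<^sup>2 - lam i) * \<phi> i e x * \<eta> x) \<in> borel_measurable (edge_measure \<Gamma> e)"
          by (rule borel_measurable_integrable[OF integrable_mult_test[OF integrable_mult_right[OF int(1)] \<eta>]])
      qed
      finally show ?thesis .
    qed
    have ce: "continuous_on {0..?l} (c e)" using c e by (auto simp: continuous_on_graph_def)
    have ae: "AE x in edge_measure \<Gamma> e. \<phi> i e x = c e x" using c e by (auto simp: ae_eq_def)
    obtain c' where "\<And>x. x \<in> {0..?l} \<Longrightarrow> (c e has_real_derivative c' x) (at x within {0..?l})"
      "\<And>x. x \<in> {0..?l} \<Longrightarrow> (c' has_real_derivative (\<kappa>\<^sup>2 - lam i) * c e x) (at x within {0..?l})"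
      by (rule weak_ode_solution_regular[OF len_pos[OF e] int(1,2) w1 w2 ce ae])
        (assumption+, rule that)
    then show ?thesis by blast
  qed
  then have "\<exists>c'. \<forall>e\<in>E. \<forall>x\<in>{0..len \<Gamma> e}. (c e has_real_derivative c' e x) (at x within {0..len \<Gamma> e}) \<and>
        (c' e has_real_derivative (\<kappa>\<^sup>2 - lam i) * c e x) (at x within {0..len \<Gamma> e})"
    by (intro bchoice ballI)
  with c show ?thesis by blast
qed

lemma phi_regular_all:
  "\<exists>c c'. \<forall>i. continuous_on_graph \<Gamma> (c i) \<and> ae_eq \<Gamma> (\<phi> i) (c i) \<and>
     (\<forall>e\<in>E. \<forall>x\<in>{0..len \<Gamma> e}. (c i e has_real_derivative c' i e x) (at x within {0..len \<Gamma> e}) \<and>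
        (c' i e has_real_derivative (\<kappa>\<^sup>2 - lam i) * c i e x) (at x within {0..len \<Gamma> e}))"
proof -
  have "\<forall>i. \<exists>c c'. continuous_on_graph \<Gamma> c \<and> ae_eq \<Gamma> (\<phi> i) c \<and>
     (\<forall>e\<in>E. \<forall>x\<in>{0..len \<Gamma> e}. (c e has_real_derivative c' e x) (at x within {0..len \<Gamma> e}) \<and>
        (c' e has_real_derivative (\<kappa>\<^sup>2 - lam i) * c e x) (at x within {0..len \<Gamma> e}))"
    by (rule allI, rule phi_regular)
  from choice[OF this] show ?thesis by (elim exE) (drule choice, erule exI)
qed

text \<open>
  The classical representatives of the eigenfunctions and their derivatives, chosen for all indices at once.
\<close>

definition "\<Phi> = (SOME c. \<exists>c'. \<forall>i. continuous_on_graph \<Gamma> (c i) \<and> ae_eq \<Gamma> (\<phi> i) (c i) \<and>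
     (\<forall>e\<in>E. \<forall>x\<in>{0..len \<Gamma> e}. (c i e has_real_derivative c' i e x) (at x within {0..len \<Gamma> e}) \<and>
        (c' i e has_real_derivative (\<kappa>\<^sup>2 - lam i) * c i e x) (at x within {0..len \<Gamma> e})))"

definition "D\<Phi> = (SOME c'. \<forall>i. continuous_on_graph \<Gamma> (\<Phi> i) \<and> ae_eq \<Gamma> (\<phi> i) (\<Phi> i) \<and>
     (\<forall>e\<in>E. \<forall>x\<in>{0..len \<Gamma> e}. (\<Phi> i e has_real_derivative c' i e x) (at x within {0..len \<Gamma> e}) \<and>
        (c' i e has_real_derivative (\<kappa>\<^sup>2 - lam i) * \<Phi> i e x) (at x within {0..len \<Gamma> e})))"

lemma Phi_spec: "continuous_on_graph \<Gamma> (\<Phi> i) \<and> ae_eq \<Gamma> (\<phi> i) (\<Phi> i) \<and>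
     (\<forall>e\<in>E. \<forall>x\<in>{0..len \<Gamma> e}. (\<Phi> i e has_real_derivative D\<Phi> i e x) (at x within {0..len \<Gamma> e}) \<and>
        (D\<Phi> i e has_real_derivative (\<kappa>\<^sup>2 - lam i) * \<Phi> i e x) (at x within {0..len \<Gamma> e}))"
  using someI_ex[OF someI_ex[OF phi_regular_all, folded \<Phi>_def], folded D\<Phi>_def] by simp

lemma Phi_continuous_on_graph: "continuous_on_graph \<Gamma> (\<Phi> i)"
  and phi_ae_Phi: "ae_eq \<Gamma> (\<phi> i) (\<Phi> i)"
  and Phi_deriv: "e \<in> E \<Longrightarrow> x \<in> {0..len \<Gamma> e} \<Longrightarrow> (\<Phi> i e has_real_derivative D\<Phi> i e x) (at x within {0..len \<Gamma> e})"
  and DPhi_deriv: "e \<in> E \<Longrightarrow> x \<in> {0..len \<Gamma> e} \<Longrightarrow>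
     (D\<Phi> i e has_real_derivative (\<kappa>\<^sup>2 - lam i) * \<Phi> i e x) (at x within {0..len \<Gamma> e})"
  using Phi_spec[of i] by blast+

lemma Phi_continuous: "e \<in> E \<Longrightarrow> continuous_on {0..len \<Gamma> e} (\<Phi> i e)"
  using deriv_within_continuous[OF Phi_deriv] .

lemma DPhi_continuous: "e \<in> E \<Longrightarrow> continuous_on {0..len \<Gamma> e} (D\<Phi> i e)"
  using deriv_within_continuous[OF DPhi_deriv] .

lemma Phi_L2: "\<Phi> i \<in> L2 \<Gamma>" and DPhi_L2: "D\<Phi> i \<in> L2 \<Gamma>"
  by (auto simp: L2_iff intro!: square_integrable_continuous Phi_continuous DPhi_continuous)

lemma inner_phi: "f \<in> L2 \<Gamma> \<Longrightarrow> inn f (\<phi> i) = inn f (\<Phi> i)"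
  by (rule L2_inner_cong) (auto simp: Phi_L2 phi_L2 phi_ae_Phi, simp add: ae_eq_def)

lemma Phi_orthonormal: "inn (\<Phi> i) (\<Phi> j) = (if i = j then 1 else 0)"
  using phi_orthonormal[of i j] inner_phi[OF phi_L2, of i j] inner_phi[OF Phi_L2, of j i]
  by (simp add: L2_inner_commute[of \<Gamma> "\<Phi> j"])

lemma L2_norm_phi_sum_eq:
  assumes "f \<in> L2 \<Gamma>" 
  shows "L2_norm \<Gamma> (\<lambda>e x. f e x - (\<Sum>i<n. c i * \<phi> i e x)) = L2_norm \<Gamma> (\<lambda>e x. f e x - (\<Sum>i<(n::nat). c i * \<Phi> i e x))"
proof -
  have "ae_eq \<Gamma> (\<lambda>e x. f e x - (\<Sum>i<n. c i * \<phi> i e x)) (\<lambda>e x. f e x - (\<Sum>i<n. c i * \<Phi> i e x))"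
    unfolding ae_eq_def
  proof
    fix e assume e: "e \<in> E"
    have "AE x in edge_measure \<Gamma> e. \<forall>i\<in>{..<n}. \<phi> i e x = \<Phi> i e x"
      using phi_ae_Phi e by (intro AE_finite_allI) (auto simp: ae_eq_def)
    then show "AE x in edge_measure \<Gamma> e. f e x - (\<Sum>i<n. c i * \<phi> i e x) = f e x - (\<Sum>i<n. c i * \<Phi> i e x)"
      by eventually_elim simp
  qed
  then have "inn (\<lambda>e x. f e x - (\<Sum>i<n. c i * \<phi> i e x)) (\<lambda>e x. f e x - (\<Sum>i<n. c i * \<phi> i e x)) =
      inn (\<lambda>e x. f e x - (\<Sum>i<n. c i * \<Phi> i e x)) (\<lambda>e x. f e x - (\<Sum>i<n. c i * \<Phi> i e x))"
    by (intro L2_inner_cong L2_diff L2_sum assms phi_L2 Phi_L2) auto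
  then show ?thesis by (simp add: L2_norm_def)
qed

lemma Phi_expansion:
  "f \<in> L2 \<Gamma> \<Longrightarrow> (\<lambda>n. L2_norm \<Gamma> (\<lambda>e x. f e x - (\<Sum>i<n. inn f (\<Phi> i) * \<Phi> i e x))) \<longlonglongrightarrow> 0"
  using phi_expansion[of f] by (simp add: L2_norm_phi_sum_eq inner_phi)

subsection \<open>Vertex conditions and Green's formula\<close>

text \<open>
  The derivative at an edge end in the direction away from the vertex, read off from the derivative \<open>f'\<close>
  along the coordinate; at the far end the two directions are opposite.
\<close>

definition end_deriv :: "'e graph_fun \<Rightarrow> 'e \<times> bool \<Rightarrow> real" where
  "end_deriv f' = (\<lambda>(e, b). if b then f' e 0 else - f' e (len \<Gamma> e))"

lemma edge_ends_E: "p \<in> edge_ends \<Gamma> v \<Longrightarrow> fst p \<in> E"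
  by (auto simp: edge_ends_def)

text \<open>
  The one-sided derivatives in the vertex condition are taken of some continuous representative. All
  continuous representatives agree on the closed edge, so these numbers are the end derivatives of \<open>\<Phi> i\<close>.
\<close>

lemma Phi_kirchhoff:
  assumes v: "v \<in> V" shows "(\<Sum>p\<in>edge_ends \<Gamma> v. end_deriv (D\<Phi> i) p) = 0"
proof -
  have "kirchhoff_at \<Gamma> v (\<phi> i)"
    using basis v by (auto simp: eigenbasis_def laplacian_dom_def)
  then obtain d where d: "\<And>p. p \<in> edge_ends \<Gamma> v \<Longrightarrow> has_dir_deriv \<Gamma> (\<phi> i) p (d p)"
    "(\<Sum>p\<in>edge_ends \<Gamma> v. d p) = 0" by (auto simp: kirchhoff_at_def)
  have "end_deriv (D\<Phi> i) p = d p" if p: "p \<in> edge_ends \<Gamma> v" for p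
  proof -
    obtain e b where eb: "p = (e, b)" by force
    have e: "e \<in> E" using edge_ends_E[OF p] eb by simp
    let ?l = "len \<Gamma> e"
    obtain c where c: "continuous_on {0..?l} c" "AE x in edge_measure \<Gamma> e. \<phi> i e x = c x"
      and der': "if b then (c has_real_derivative d (e, b)) (at 0 within {0..?l})
                else (c has_real_derivative (- d (e, b))) (at ?l within {0..?l})"
      using d(1)[OF p] unfolding eb has_dir_deriv_def by (simp only: prod.case) (elim exE conjE, rule that)
    note der = der'[folded eb]
    have "AE x in edge_measure \<Gamma> e. \<phi> i e x = \<Phi> i e x" using phi_ae_Phi e by (auto simp: ae_eq_def)
    with c(2) have "AE x in edge_measure \<Gamma> e. c x = \<Phi> i e x" by eventually_elim simp
    then have eq: "c x = \<Phi> i e x" if "x \<in> {0..?l}" for x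
      by (rule continuous_AE_eq_interval[OF len_pos[OF e] c(1) Phi_continuous[OF e] _ that])
    have tr: "(\<Phi> i e has_real_derivative D) (at x within {0..?l})"
      if "(c has_real_derivative D) (at x within {0..?l})" "x \<in> {0..?l}" for D x
      by (rule has_field_derivative_transform_within[OF that(1) zero_less_one that(2) eq])
    show ?thesis
    proof (cases b)
      case True
      then have "(\<Phi> i e has_real_derivative d p) (at 0 within {0..?l})" using tr der len_pos[OF e] by simp
      then show ?thesis using True deriv_within_interval_unique[OF len_pos[OF e] _ _ Phi_deriv[OF e]] len_pos[OF e]
        by (force simp: eb end_deriv_def)
    next
      case False
      then have "(\<Phi> i e has_real_derivative - d p) (at ?l within {0..?l})" using tr der len_pos[OF e] by simp
      then have "- d p = D\<Phi> i e ?l" using deriv_within_interval_unique[OF len_pos[OF e] _ _ Phi_deriv[OF e]] len_pos[OF e]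
        by force
      then show ?thesis using False by (simp add: eb end_deriv_def)
    qed
  qed
  with d(2) show ?thesis by simp
qed

text \<open>
  Every edge has exactly two ends, one at its tail and one at its head; this also counts a loop twice at
  its vertex.
\<close>

lemma sum_edge_ends:
  "(\<Sum>v\<in>V. \<Sum>p\<in>edge_ends \<Gamma> v. F v p) =
   (\<Sum>e\<in>E. F (tail (shape \<Gamma>) e) (e, True) + (F (head (shape \<Gamma>) e) (e, False) :: real))"
proof -
  have "(\<Sum>p\<in>edge_ends \<Gamma> v. F v p) = (\<Sum>e\<in>E. (if tail (shape \<Gamma>) e = v then F v (e, True) else 0)
      + (if head (shape \<Gamma>) e = v then F v (e, False) else 0))" for v
  proof -
    let ?T = "{e \<in> E. tail (shape \<Gamma>) e = v}" and ?H = "{e \<in> E. head (shape \<Gamma>) e = v}"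
    have "edge_ends \<Gamma> v = (\<lambda>e. (e, True)) ` ?T \<union> (\<lambda>e. (e, False)) ` ?H"
      by (auto simp: edge_ends_def image_iff split: if_splits)
    then have "(\<Sum>p\<in>edge_ends \<Gamma> v. F v p) =
        (\<Sum>p\<in>(\<lambda>e. (e, True)) ` ?T. F v p) + (\<Sum>p\<in>(\<lambda>e. (e, False)) ` ?H. F v p)"
      using finite_E by (simp only:) (intro sum.union_disjoint, auto)
    also have "\<dots> = (\<Sum>e\<in>?T. F v (e, True)) + (\<Sum>e\<in>?H. F v (e, False))"
      by (simp add: sum.reindex inj_on_def)
    also have "\<dots> = (\<Sum>e\<in>E. (if tail (shape \<Gamma>) e = v then F v (e, True) else 0)
      + (if head (shape \<Gamma>) e = v then F v (e, False) else 0))"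
      using finite_E by (simp add: sum.distrib sum.inter_filter)
    finally show ?thesis .
  qed
  then have "(\<Sum>v\<in>V. \<Sum>p\<in>edge_ends \<Gamma> v. F v p) = (\<Sum>v\<in>V. \<Sum>e\<in>E. (if tail (shape \<Gamma>) e = v then F v (e, True) else 0)
      + (if head (shape \<Gamma>) e = v then F v (e, False) else 0))" by simp
  also have "\<dots> = (\<Sum>e\<in>E. \<Sum>v\<in>V. (if tail (shape \<Gamma>) e = v then F v (e, True) else 0)
      + (if head (shape \<Gamma>) e = v then F v (e, False) else 0))"
    by (rule sum.swap)
  also have "\<dots> = (\<Sum>e\<in>E. F (tail (shape \<Gamma>) e) (e, True) + F (head (shape \<Gamma>) e) (e, False))"
    using finite_V tail_V head_V by (intro sum.cong) (auto simp: sum.distrib)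
  finally show ?thesis .
qed

text \<open>
  Integrating by parts edge by edge leaves at every edge end the vertex value of \<open>c\<close> times an end derivative
  of the eigenfunction. Grouped by vertices, the value of \<open>c\<close> factors out and the Kirchhoff sum is zero.
\<close>

lemma weak_Green_formula:
  assumes weak: "has_weak_deriv \<Gamma> 1 f g" and c: "continuous_on_graph \<Gamma> c" and fc: "ae_eq \<Gamma> f c"
  shows "inn g (D\<Phi> i) = (lam i - \<kappa>\<^sup>2) * inn f (\<Phi> i)"
proof -
  obtain val where val: "\<And>e. e \<in> E \<Longrightarrow> c e 0 = val (tail (shape \<Gamma>) e)" "\<And>e. e \<in> E \<Longrightarrow> c e (len \<Gamma> e) = val (head (shape \<Gamma>) e)"
    and cc: "\<And>e. e \<in> E \<Longrightarrow> continuous_on {0..len \<Gamma> e} (c e)"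
    using c unfolding continuous_on_graph_def by blast
  have L: "f \<in> L2 \<Gamma>" "g \<in> L2 \<Gamma>" using weak by (auto simp: has_weak_deriv_def)
  have edge: "(\<integral>x. g e x * D\<Phi> i e x \<partial>edge_measure \<Gamma> e) + (\<kappa>\<^sup>2 - lam i) * (\<integral>x. f e x * \<Phi> i e x \<partial>edge_measure \<Gamma> e) =
      - (val (tail (shape \<Gamma>) e) * end_deriv (D\<Phi> i) (e, True) + val (head (shape \<Gamma>) e) * end_deriv (D\<Phi> i) (e, False))"
    if e: "e \<in> E" for e
  proof -
    have ae: "AE x in edge_measure \<Gamma> e. c e x = f e x" using fc e by (auto simp: ae_eq_def elim: eventually_mono)
    have fi: "integrable (edge_measure \<Gamma> e) (f e)" by (rule L2_integrable[OF L(1) e])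
    have ci: "integrable (edge_measure \<Gamma> e) (c e)" by (rule continuous_integrable_interval[OF cc[OF e]])
    have cf: "(\<integral>x. c e x * h x \<partial>edge_measure \<Gamma> e) = (\<integral>x. f e x * h x \<partial>edge_measure \<Gamma> e)"
      if h: "continuous_on {0..len \<Gamma> e} h" for h
    proof (rule integral_cong_AE)
      show "AE x in edge_measure \<Gamma> e. c e x * h x = f e x * h x" using ae by eventually_elim simp
    qed (rule borel_measurable_integrable[OF integrable_mult_continuous[OF ci h]]
              borel_measurable_integrable[OF integrable_mult_continuous[OF fi h]])+
    have "(\<integral>x. g e x * D\<Phi> i e x \<partial>edge_measure \<Gamma> e) + (\<kappa>\<^sup>2 - lam i) * (\<integral>x. c e x * \<Phi> i e x \<partial>edge_measure \<Gamma> e) =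
       c e (len \<Gamma> e) * D\<Phi> i e (len \<Gamma> e) - c e 0 * D\<Phi> i e 0"
    proof (rule weak_integration_by_parts_ode[OF len_pos[OF e] L2_integrable[OF L(2) e] _ cc[OF e] Phi_deriv[OF e] DPhi_deriv[OF e]])
      fix \<eta> assume \<eta>: "test_function (len \<Gamma> e) \<eta>"
      have "(\<integral>x. f e x * deriv \<eta> x \<partial>edge_measure \<Gamma> e) = - (\<integral>x. g e x * \<eta> x \<partial>edge_measure \<Gamma> e)"
        using weak e \<eta> by (auto simp: has_weak_deriv_def)
      then show "(\<integral>x. c e x * deriv \<eta> x \<partial>edge_measure \<Gamma> e) = - (\<integral>x. g e x * \<eta> x \<partial>edge_measure \<Gamma> e)"
        using cf[OF test_function_continuous[OF test_function_deriv[OF \<eta> len_pos[OF e]]]] by simp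
    qed
    then show ?thesis using val[OF e] cf[OF Phi_continuous[OF e]] by (simp add: end_deriv_def)
  qed
  have "inn g (D\<Phi> i) + (\<kappa>\<^sup>2 - lam i) * inn f (\<Phi> i) =
     (\<Sum>e\<in>E. (\<integral>x. g e x * D\<Phi> i e x \<partial>edge_measure \<Gamma> e) + (\<kappa>\<^sup>2 - lam i) * (\<integral>x. f e x * \<Phi> i e x \<partial>edge_measure \<Gamma> e))"
    by (simp add: L2_inner_def sum.distrib sum_distrib_left)
  also have "\<dots> = - (\<Sum>e\<in>E. val (tail (shape \<Gamma>) e) * end_deriv (D\<Phi> i) (e, True) + val (head (shape \<Gamma>) e) * end_deriv (D\<Phi> i) (e, False))"
    by (simp only: edge sum_negf cong: sum.cong)
  also have "\<dots> = - (\<Sum>v\<in>V. \<Sum>p\<in>edge_ends \<Gamma> v. val v * end_deriv (D\<Phi> i) p)"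
    by (simp add: sum_edge_ends)
  also have "\<dots> = 0" by (simp add: sum_distrib_left[symmetric] Phi_kirchhoff)
  finally show ?thesis by (simp add: algebra_simps)
qed

lemma classical_weak_deriv:
  assumes f: "\<And>e x. e \<in> E \<Longrightarrow> x \<in> {0..len \<Gamma> e} \<Longrightarrow> (f e has_real_derivative f' e x) (at x within {0..len \<Gamma> e})"
    and f': "\<And>e. e \<in> E \<Longrightarrow> continuous_on {0..len \<Gamma> e} (f' e)"
  shows "has_weak_deriv \<Gamma> 1 f f'"
  unfolding has_weak_deriv_def
proof (intro conjI ballI allI impI)
  show "f \<in> L2 \<Gamma>" "f' \<in> L2 \<Gamma>"
    using deriv_within_continuous[OF f] f' by (auto simp: L2_iff intro!: square_integrable_continuous)
  fix e \<eta> assume e: "e \<in> E" and \<eta>: "test_function (len \<Gamma> e) \<eta>"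
  have "(\<integral>x. f e x * deriv \<eta> x \<partial>edge_measure \<Gamma> e) = f e (len \<Gamma> e) * \<eta> (len \<Gamma> e) - f e 0 * \<eta> 0 - (\<integral>x. f' e x * \<eta> x \<partial>edge_measure \<Gamma> e)"
    using len_pos[OF e] f[OF e] f'[OF e] test_function_continuous[OF test_function_deriv[OF \<eta> len_pos[OF e]]]
      smooth_has_deriv[OF test_function_smooth[OF \<eta>]]
    by (intro integration_by_parts_lebesgue) (auto intro: DERIV_subset)
  then show "(\<integral>x. f e x * (deriv ^^ 1) \<eta> x \<partial>edge_measure \<Gamma> e) = (-1) ^ 1 * (\<integral>x. f' e x * \<eta> x \<partial>edge_measure \<Gamma> e)"
    using test_function_boundary[OF \<eta> len_pos[OF e]] by simp
qed

lemma ae_eq_refl: "ae_eq \<Gamma> f f" by (simp add: ae_eq_def)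

lemma DPhi_orthogonal: "inn (D\<Phi> i) (D\<Phi> j) = (if i = j then lam i - \<kappa>\<^sup>2 else 0)"
  using weak_Green_formula[OF classical_weak_deriv[OF Phi_deriv DPhi_continuous] Phi_continuous_on_graph ae_eq_refl, of i j]
  by (simp add: Phi_orthonormal)

lemma lam_ge: "\<kappa>\<^sup>2 \<le> lam i"
  using DPhi_orthogonal[of i i] L2_inner_self_nonneg[of \<Gamma> "D\<Phi> i"] by simp

subsection \<open>Bessel inequalities\<close>

text \<open>
  The optimal approximation by an orthogonal system that is not normalised: \<open>\<psi> i\<close> has squared norm \<open>m i\<close>
  and the coefficient is the inner product divided by it. Writing the hypothesis as a product covers
  vectors \<open>\<psi> i\<close> of norm zero.
\<close>

lemma residual_sq:
  fixes \<psi> :: "nat \<Rightarrow> 'e graph_fun"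
  assumes f: "f \<in> L2 \<Gamma>" and \<psi>: "\<And>i. \<psi> i \<in> L2 \<Gamma>" and orth: "\<And>i j. inn (\<psi> i) (\<psi> j) = (if i = j then m i else 0)"
    and I: "finite I" and c: "\<And>i. inn f (\<psi> i) = m i * c i"
  shows "inn (\<lambda>e x. f e x - (\<Sum>i\<in>I. c i * \<psi> i e x)) (\<lambda>e x. f e x - (\<Sum>i\<in>I. c i * \<psi> i e x)) =
         inn f f - (\<Sum>i\<in>I. m i * (c i)\<^sup>2)"
proof -
  let ?S = "\<lambda>e x. \<Sum>i\<in>I. c i * \<psi> i e x"
  have S: "?S \<in> L2 \<Gamma>" by (intro L2_sum I \<psi>)
  have fS: "inn f ?S = (\<Sum>i\<in>I. m i * (c i)\<^sup>2)"
    by (simp add: L2_inner_sum_right[OF I \<psi> f] c power2_eq_square mult_ac)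
  have SS: "inn ?S ?S = (\<Sum>i\<in>I. m i * (c i)\<^sup>2)"
    by (simp add: L2_inner_self_sum_orthogonal[OF I \<psi> orth] mult.commute)
  have "inn (\<lambda>e x. f e x - ?S e x) (\<lambda>e x. f e x - ?S e x) = inn f (\<lambda>e x. f e x - ?S e x) - inn ?S (\<lambda>e x. f e x - ?S e x)"
    by (rule L2_inner_diff_left[OF f S L2_diff[OF f S]])
  also have "\<dots> = (inn f f - inn ?S f) - (inn f ?S - inn ?S ?S)"
    using L2_inner_diff_left[OF f S f] L2_inner_diff_left[OF f S S]
    by (simp add: L2_inner_commute[of \<Gamma> f "\<lambda>e x. f e x - ?S e x"] L2_inner_commute[of \<Gamma> ?S "\<lambda>e x. f e x - ?S e x"])
  finally show ?thesis using fS SS L2_inner_commute[of \<Gamma> f ?S] by simp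
qed

lemma Bessel:
  fixes \<psi> :: "nat \<Rightarrow> 'e graph_fun"
  assumes f: "f \<in> L2 \<Gamma>" and \<psi>: "\<And>i. \<psi> i \<in> L2 \<Gamma>" and orth: "\<And>i j. inn (\<psi> i) (\<psi> j) = (if i = j then m i else 0)"
    and I: "finite I" and c: "\<And>i. inn f (\<psi> i) = m i * c i"
  shows "(\<Sum>i\<in>I. m i * (c i)\<^sup>2) \<le> inn f f"
  using residual_sq[OF assms] L2_inner_self_nonneg[of \<Gamma> "\<lambda>e x. f e x - (\<Sum>i\<in>I. c i * \<psi> i e x)"] by simp

text \<open>
  Bessel's inequality for \<open>f\<close> against the \<open>\<Phi> i\<close> and for \<open>g\<close> against the \<open>D\<Phi> i\<close>, with the same
  coefficients by Green's formula; the factors \<open>\<kappa>\<^sup>2\<close> and \<open>lam i - \<kappa>\<^sup>2\<close> add up to \<open>lam i\<close>.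
\<close>

lemma energy_Bessel:
  assumes weak: "has_weak_deriv \<Gamma> 1 f g" and c: "continuous_on_graph \<Gamma> c" and fc: "ae_eq \<Gamma> f c"
  shows "(\<Sum>i<n. lam i * (inn f (\<Phi> i))\<^sup>2) \<le> \<kappa>\<^sup>2 * inn f f + inn g g"
proof -
  have L: "f \<in> L2 \<Gamma>" "g \<in> L2 \<Gamma>" using weak by (auto simp: has_weak_deriv_def)
  have "(\<Sum>i<n. 1 * (inn f (\<Phi> i))\<^sup>2) \<le> inn f f"
    by (rule Bessel[OF L(1) Phi_L2]) (auto simp: Phi_orthonormal)
  then have 1: "\<kappa>\<^sup>2 * (\<Sum>i<n. (inn f (\<Phi> i))\<^sup>2) \<le> \<kappa>\<^sup>2 * inn f f"
    by (intro mult_left_mono) auto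
  have 2: "(\<Sum>i<n. (lam i - \<kappa>\<^sup>2) * (inn f (\<Phi> i))\<^sup>2) \<le> inn g g"
    by (rule Bessel[OF L(2) DPhi_L2]) (auto simp: DPhi_orthogonal weak_Green_formula[OF weak c fc])
  from add_mono[OF 1 2] show ?thesis
    by (simp add: sum_distrib_left sum.distrib[symmetric] algebra_simps)
qed

end


context kirchhoff_eigenbasis
begin

section \<open>Growth of the eigenvalues\<close>

lemma edge_integral_le_inner:
  assumes "e \<in> E" shows "(\<integral>x. (f e x)\<^sup>2 \<partial>edge_measure \<Gamma> e) \<le> inn f f"
  unfolding L2_inner_def power2_eq_square using assms finite_E
  by (intro member_le_sum[where f = "\<lambda>e. \<integral>x. f e x * f e x \<partial>edge_measure \<Gamma> e"]) auto

lemma Phi_sum_deriv: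
  assumes "e \<in> E" "x \<in> {0..len \<Gamma> e}"
  shows "((\<lambda>x. \<Sum>i\<in>I. b i * \<Phi> i e x) has_real_derivative (\<Sum>i\<in>I. b i * D\<Phi> i e x)) (at x within {0..len \<Gamma> e})"
  by (intro DERIV_sum DERIV_cmult Phi_deriv assms)

lemma DPhi_sum_deriv:
  assumes "e \<in> E" "x \<in> {0..len \<Gamma> e}"
  shows "((\<lambda>x. \<Sum>i\<in>I. b i * D\<Phi> i e x) has_real_derivative (\<Sum>i\<in>I. b i * ((\<kappa>\<^sup>2 - lam i) * \<Phi> i e x))) (at x within {0..len \<Gamma> e})"
  by (intro DERIV_sum DERIV_cmult DPhi_deriv assms)

text \<open>
  The left-hand side \<open>K\<close> is the value at \<open>x\<close> of the kernel function \<open>f\<close> with coefficients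
  \<open>\<Phi> i e x\<close>. Its squared norm is \<open>K\<close> and the squared norm of its derivative is at most \<open>lam n * K\<close>, so the
  trace inequality is quadratic in \<open>K\<close> on the left and linear on the right. Balancing the two terms on the
  right gives the parameter \<open>sqrt (lam n)\<close>.
\<close>

lemma eigenfunction_sum_bound:
  assumes e: "e \<in> E" and x: "x \<in> {0..len \<Gamma> e}"
  shows "(\<Sum>i\<le>n. (\<Phi> i e x)\<^sup>2) \<le> 1 / len \<Gamma> e + 2 * sqrt (lam n)"
proof -
  let ?l = "len \<Gamma> e" and ?t = "sqrt (lam n)"
  define K where "K = (\<Sum>i\<le>n. (\<Phi> i e x)\<^sup>2)"
  define f where "f e' y = (\<Sum>i\<le>n. \<Phi> i e x * \<Phi> i e' y)" for e' y
  define f' where "f' e' y = (\<Sum>i\<le>n. \<Phi> i e x * D\<Phi> i e' y)" for e' y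
  have l: "0 < ?l" and t: "0 < ?t" using len_pos[OF e] lam_pos by auto
  have fx: "f e x = K" by (simp add: f_def K_def power2_eq_square)
  have ff: "inn f f = K"
    unfolding f_def[abs_def] K_def
    by (subst L2_inner_self_sum_orthogonal[OF _ Phi_L2 Phi_orthonormal]) auto
  have "inn f' f' = (\<Sum>i\<le>n. (\<Phi> i e x)\<^sup>2 * (lam i - \<kappa>\<^sup>2))"
    unfolding f'_def[abs_def] by (rule L2_inner_self_sum_orthogonal[OF _ DPhi_L2 DPhi_orthogonal]) auto
  also have "\<dots> \<le> (\<Sum>i\<le>n. (\<Phi> i e x)\<^sup>2 * lam n)"
  proof (intro sum_mono mult_left_mono)
    fix i assume "i \<in> {..n}"
    then show "lam i - \<kappa>\<^sup>2 \<le> lam n" using lam_mono[of i n] zero_le_power2[of \<kappa>] by (simp add: add_increasing2 diff_le_eq)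
  qed auto
  also have "\<dots> = K * lam n" by (simp add: K_def sum_distrib_right)
  finally have ff': "inn f' f' \<le> K * lam n" .
  have "(f e x)\<^sup>2 \<le> (1 / ?l + ?t) * (\<integral>x. (f e x)\<^sup>2 \<partial>edge_measure \<Gamma> e) + (1 / ?t) * (\<integral>x. (f' e x)\<^sup>2 \<partial>edge_measure \<Gamma> e)"
  proof (rule trace_inequality[OF l t _ _ x])
    show "(f e has_real_derivative f' e y) (at y within {0..?l})" if "y \<in> {0..?l}" for y
      unfolding f_def f'_def by (rule Phi_sum_deriv[OF e that])
    show "continuous_on {0..?l} (f' e)"
      unfolding f'_def by (intro continuous_intros DPhi_continuous e)
  qed
  also have "\<dots> \<le> (1 / ?l + ?t) * K + (1 / ?t) * (K * lam n)"
    using edge_integral_le_inner[OF e, of f] edge_integral_le_inner[OF e, of f'] ff ff' l t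
    by (intro add_mono mult_left_mono) auto
  also have "\<dots> = K * (1 / ?l + ?t + lam n / ?t)" by (simp add: algebra_simps)
  also have "lam n / ?t = ?t" using lam_pos[of n] by (simp add: real_div_sqrt)
  also have "1 / ?l + ?t + ?t = 1 / ?l + 2 * ?t" by simp
  finally have "K * K \<le> K * (1 / ?l + 2 * ?t)" unfolding fx power2_eq_square .
  moreover have "0 \<le> K" by (simp add: K_def sum_nonneg)
  ultimately have "K \<le> 1 / ?l + 2 * ?t"
  proof (cases "K = 0")
    case False
    with \<open>0 \<le> K\<close> have "0 < K" by simp
    with \<open>K * K \<le> _\<close> show ?thesis by simp
  qed (use l t in auto)
  then show ?thesis by (simp add: K_def)
qed

text \<open>
  The lower half of Weyl's law. The eigenfunctions have norm one, so integrating the pointwise bound over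
  the graph counts them.
\<close>

lemma lam_lower_bound: "\<exists>A>0. \<forall>n. real (Suc n) \<le> A * sqrt (lam n)"
proof -
  define L where "L = (\<Sum>e\<in>E. len \<Gamma> e)"
  define A where "A = real (card E) / sqrt (lam 0) + 2 * L"
  have L: "0 \<le> L" unfolding L_def using len_pos by (intro sum_nonneg) (auto intro: less_imp_le)
  have card: "0 < card E" using finite_E E_nonempty by (simp add: card_gt_0_iff)
  have A: "A > 0" unfolding A_def using L card lam_pos[of 0] by (intro add_pos_nonneg divide_pos_pos) auto
  have "real (Suc n) \<le> A * sqrt (lam n)" for n
  proof -
    have "real (Suc n) = (\<Sum>i\<le>n. inn (\<Phi> i) (\<Phi> i))" by (simp add: Phi_orthonormal)
    also have "\<dots> = (\<Sum>e\<in>E. \<Sum>i\<le>n. \<integral>x. (\<Phi> i e x)\<^sup>2 \<partial>edge_measure \<Gamma> e)"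
      unfolding L2_inner_def power2_eq_square by (rule sum.swap)
    also have "\<dots> \<le> (\<Sum>e\<in>E. 1 + 2 * sqrt (lam n) * len \<Gamma> e)"
    proof (rule sum_mono)
      fix e assume e: "e \<in> E"
      have i: "integrable (edge_measure \<Gamma> e) (\<lambda>x. (\<Phi> i e x)\<^sup>2)" for i
        using L2_integrable_mult[OF Phi_L2 Phi_L2 e] by (simp add: power2_eq_square)
      have "(\<Sum>i\<le>n. \<integral>x. (\<Phi> i e x)\<^sup>2 \<partial>edge_measure \<Gamma> e) = (\<integral>x. (\<Sum>i\<le>n. (\<Phi> i e x)\<^sup>2) \<partial>edge_measure \<Gamma> e)"
        using i by (subst Bochner_Integration.integral_sum) auto
      also have "\<dots> \<le> (\<integral>x. 1 / len \<Gamma> e + 2 * sqrt (lam n) \<partial>edge_measure \<Gamma> e)"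
      proof (rule integral_mono)
        show "integrable (edge_measure \<Gamma> e) (\<lambda>x. \<Sum>i\<le>n. (\<Phi> i e x)\<^sup>2)"
          by (intro Bochner_Integration.integrable_sum i)
        show "integrable (edge_measure \<Gamma> e) (\<lambda>x. 1 / len \<Gamma> e + 2 * sqrt (lam n))"
          by (intro continuous_integrable_interval continuous_on_const)
      qed (use eigenfunction_sum_bound[OF e] in auto)
      also have "\<dots> = 1 + 2 * sqrt (lam n) * len \<Gamma> e"
        using len_pos[OF e] by (simp add: measure_restrict_space field_simps)
      finally show "(\<Sum>i\<le>n. \<integral>x. (\<Phi> i e x)\<^sup>2 \<partial>edge_measure \<Gamma> e) \<le> 1 + 2 * sqrt (lam n) * len \<Gamma> e" .
    qed
    also have "\<dots> = real (card E) + 2 * L * sqrt (lam n)"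
      by (simp add: sum.distrib L_def sum_distrib_left mult_ac)
    also have "real (card E) \<le> real (card E) / sqrt (lam 0) * sqrt (lam n)"
      using lam_pos[of 0] lam_mono[of 0 n] by (auto simp: field_simps intro!: mult_right_mono)
    finally show ?thesis by (simp add: A_def algebra_simps)
  qed
  with A show ?thesis by blast
qed

lemma summable_lam_powr:
  assumes s: "s > 1/2" shows "summable (\<lambda>i. lam i powr (- s))"
proof -
  obtain A where A: "A > 0" "\<And>n. real (Suc n) \<le> A * sqrt (lam n)" using lam_lower_bound by blast
  have "summable (\<lambda>i. real i powr (- 2 * s))" using s by (simp add: summable_real_powr_iff)
  then have "summable (\<lambda>i. real (Suc i) powr (- 2 * s))" by (rule summable_Suc_iff[THEN iffD2])
  then have "summable (\<lambda>i. A powr (2 * s) * real (Suc i) powr (- 2 * s))" by (rule summable_mult)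
  then show ?thesis
  proof (rule summable_comparison_test')
    fix n :: nat
    have "lam n powr (- s) = sqrt (lam n) powr (- 2 * s)"
      using lam_pos[of n] by (simp add: powr_half_sqrt[symmetric] powr_powr)
    also have "\<dots> \<le> (real (Suc n) / A) powr (- 2 * s)"
      using A s by (intro powr_mono2') (auto simp: field_simps)
    also have "\<dots> = A powr (2 * s) * real (Suc n) powr (- 2 * s)"
      using A by (simp add: powr_divide powr_minus field_simps)
    finally show "norm (lam n powr (- s)) \<le> A powr (2 * s) * real (Suc n) powr (- 2 * s)" by simp
  qed
qed

lemma Parseval:
  assumes f: "f \<in> L2 \<Gamma>" shows "(\<lambda>i. (inn f (\<Phi> i))\<^sup>2) sums inn f f"
proof -
  have "(\<lambda>n. (L2_norm \<Gamma> (\<lambda>e x. f e x - (\<Sum>i<n. inn f (\<Phi> i) * \<Phi> i e x)))\<^sup>2) \<longlonglongrightarrow> 0\<^sup>2"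
    by (intro tendsto_intros Phi_expansion f)
  moreover have "(L2_norm \<Gamma> (\<lambda>e x. f e x - (\<Sum>i<n. inn f (\<Phi> i) * \<Phi> i e x)))\<^sup>2 = inn f f - (\<Sum>i<n. (inn f (\<Phi> i))\<^sup>2)" for n
    unfolding L2_norm_sq
    using residual_sq[OF f Phi_L2, where m = "\<lambda>_. 1" and I = "{..<n}" and c = "\<lambda>i. inn f (\<Phi> i)"] by (simp add: Phi_orthonormal)
  ultimately have "(\<lambda>n. inn f f - (\<Sum>i<n. (inn f (\<Phi> i))\<^sup>2)) \<longlonglongrightarrow> 0" by simp
  from tendsto_diff[OF tendsto_const[of "inn f f"] this] show ?thesis by (simp add: sums_def)
qed

text \<open>
  The convex function \<open>t powr (-1/2)\<close> lies above its tangent at \<open>s\<close>.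
\<close>

lemma inverse_sqrt_tangent:
  fixes s t :: real
  assumes "s > 0" "t > 0"
  shows "t powr (-1/2) \<ge> s powr (-1/2) * (3/2 - t / (2 * s))"
proof -
  define a b where "a = sqrt s" and "b = sqrt t"
  have ab: "a > 0" "b > 0" "s = a\<^sup>2" "t = b\<^sup>2" using assms by (auto simp: a_def b_def)
  have p: "s powr (-1/2) = 1 / a" "t powr (-1/2) = 1 / b"
    using assms by (simp_all add: a_def b_def powr_half_sqrt[symmetric] powr_minus_divide)
  have "0 \<le> (a - b)\<^sup>2 * (2 * a + b)" using ab by (intro mult_nonneg_nonneg) auto
  then have "b * (3 * a\<^sup>2 - b\<^sup>2) \<le> 2 * a ^ 3" by (simp add: power2_eq_square power3_eq_cube algebra_simps)
  then show ?thesis unfolding p using ab(1,2) unfolding ab(3,4)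
    by (simp add: field_simps power2_eq_square power3_eq_cube)
qed

lemma integral_cos_multiple:
  assumes l: "0 < l" and k: "k \<noteq> 0"
  shows "(\<integral>x. cos (of_int k * pi * x / l) \<partial>lebesgue_on {0..l}) = 0"
proof -
  have "(\<integral>x. cos (of_int k * pi * x / l) \<partial>lebesgue_on {0..l}) =
     l / (of_int k * pi) * sin (of_int k * pi * l / l) - l / (of_int k * pi) * sin (of_int k * pi * 0 / l)"
    using l k by (intro FTC_lebesgue) (auto intro!: derivative_eq_intros continuous_intros simp: field_simps)
  also have "of_int k * pi * l / l = of_int k * pi" using l by simp
  finally show ?thesis using sin_npi_int[of k] by (simp add: mult.commute)
qed

lemma integral_trig_orthogonal:
  fixes j k :: nat
  assumes l: "0 < l"
  shows "(\<integral>x. sin (real (Suc j) * pi * x / l) * sin (real (Suc k) * pi * x / l) \<partial>lebesgue_on {0..l}) = (if j = k then l / 2 else 0)"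
    and "(\<integral>x. cos (real (Suc j) * pi * x / l) * cos (real (Suc k) * pi * x / l) \<partial>lebesgue_on {0..l}) = (if j = k then l / 2 else 0)"
proof -
  define a where "a x = cos (of_int (int (Suc j) - int (Suc k)) * pi * x / l)" for x
  define b where "b x = cos (of_int (int (Suc j) + int (Suc k)) * pi * x / l)" for x
  have i: "integrable (lebesgue_on {0..l}) a" "integrable (lebesgue_on {0..l}) b"
    unfolding a_def b_def using l by (intro continuous_integrable_interval continuous_intros; simp)+
  have b0: "(\<integral>x. b x \<partial>lebesgue_on {0..l}) = 0"
    unfolding b_def by (rule integral_cos_multiple[OF l]) auto
  have a0: "(\<integral>x. a x \<partial>lebesgue_on {0..l}) = (if j = k then l else 0)"
    unfolding a_def
    using integral_cos_multiple[OF l, of "int (Suc j) - int (Suc k)"] l by (auto simp: measure_restrict_space)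
  have "sin (real (Suc j) * pi * x / l) * sin (real (Suc k) * pi * x / l) = (a x - b x) / 2"
    "cos (real (Suc j) * pi * x / l) * cos (real (Suc k) * pi * x / l) = (a x + b x) / 2" for x
    by (simp_all add: a_def b_def sin_times_sin cos_times_cos add_divide_distrib[symmetric] diff_divide_distrib[symmetric] algebra_simps)
  note eq = this
  show "(\<integral>x. sin (real (Suc j) * pi * x / l) * sin (real (Suc k) * pi * x / l) \<partial>lebesgue_on {0..l}) = (if j = k then l / 2 else 0)"
    "(\<integral>x. cos (real (Suc j) * pi * x / l) * cos (real (Suc k) * pi * x / l) \<partial>lebesgue_on {0..l}) = (if j = k then l / 2 else 0)"
    unfolding eq using i a0 b0 by simp_all
qed

text \<open>
  The sines on one edge vanish at its ends, hence extend by zero to functions of finite energy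
  \<open>s k\<close>. The numbers \<open>p k i\<close>, the squared coefficients of the \<open>k\<close>-th sine, form a probability distribution in \<open>i\<close>
  under which \<open>lam i\<close> has mean at most \<open>s k\<close>; by convexity \<open>lam i powr (-1/2)\<close> has mean at least
  \<open>s k powr (-1/2)\<close>, which is of order \<open>1 / k\<close>. By Bessel's inequality the weights of a fixed \<open>i\<close> over all
  \<open>k\<close> sum to at most one, so a finite sum of \<open>lam i powr (-1/2)\<close> would bound the harmonic series.
\<close>

lemma not_summable_lam_powr: "\<not> summable (\<lambda>i. lam i powr (-1/2))"
proof
  assume S: "summable (\<lambda>i. lam i powr (-1/2))"
  obtain e0 where e0: "e0 \<in> E" using E_nonempty by blast
  let ?l = "len \<Gamma> e0"
  have l: "0 < ?l" by (rule len_pos[OF e0])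
  define f where "f k e x = (if e = e0 then sqrt (2 / ?l) * sin (real (Suc k) * pi * x / ?l) else 0)" for k e x
  define g where "g k e x = (if e = e0 then sqrt (2 / ?l) * (real (Suc k) * pi / ?l * cos (real (Suc k) * pi * x / ?l)) else 0)" for k e x
  have fd: "(f k e has_real_derivative g k e x) (at x within {0..len \<Gamma> e})" for k e x
    using l unfolding f_def g_def by (cases "e = e0") (auto intro!: derivative_eq_intros simp: field_simps)
  have gc: "continuous_on {0..len \<Gamma> e} (g k e)" for k e
    unfolding g_def using l by (cases "e = e0") (auto intro!: continuous_intros)
  have weak: "has_weak_deriv \<Gamma> 1 (f k) (g k)" for k by (rule classical_weak_deriv[OF fd gc])
  have fL: "f k \<in> L2 \<Gamma>" for k using weak by (auto simp: has_weak_deriv_def)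
  have fcont: "continuous_on_graph \<Gamma> (f k)" for k
    unfolding continuous_on_graph_def
  proof (intro conjI ballI exI[of _ "\<lambda>_. 0"])
    show "continuous_on {0..len \<Gamma> e} (f k e)" for e by (rule deriv_within_continuous[OF fd])
    show "f k e 0 = 0" "f k e (len \<Gamma> e) = 0" for e
      using l sin_npi[of "Suc k"] by (auto simp: f_def simp del: sin_npi)
  qed
  have single: "inn p q = (\<integral>x. p e0 x * q e0 x \<partial>edge_measure \<Gamma> e0)"
    if "\<And>e x. e \<noteq> e0 \<Longrightarrow> p e x = 0" for p q :: "'e graph_fun"
    unfolding L2_inner_def using that e0 finite_E by (subst sum.remove[of _ e0]) (auto intro!: sum.neutral)
  have sq: "sqrt (2 / ?l) * a * (sqrt (2 / ?l) * b) = 2 / ?l * (a * b)" for a b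
  proof -
    have "sqrt (2 / ?l) * a * (sqrt (2 / ?l) * b) = (sqrt (2 / ?l) * sqrt (2 / ?l)) * (a * b)" by (simp only: mult_ac)
    then show ?thesis using l by simp
  qed
  have ff: "inn (f j) (f k) = (if j = k then 1 else 0)" for j k
  proof -
    have "inn (f j) (f k) = (\<integral>x. 2 / ?l * (sin (real (Suc j) * pi * x / ?l) * sin (real (Suc k) * pi * x / ?l)) \<partial>edge_measure \<Gamma> e0)"
      by (subst single) (simp_all only: f_def simp_thms if_False if_True sq)
    then show ?thesis using l integral_trig_orthogonal(1)[OF l, of j k] by simp
  qed
  have gg: "inn (g k) (g k) = (real (Suc k) * pi / ?l)\<^sup>2" for k
  proof -
    define w where "w = real (Suc k) * pi / ?l"
    have "inn (g k) (g k) = (\<integral>x. 2 / ?l * (w * cos (real (Suc k) * pi * x / ?l) * (w * cos (real (Suc k) * pi * x / ?l))) \<partial>edge_measure \<Gamma> e0)"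
      unfolding w_def by (subst single) (simp_all only: g_def simp_thms if_False if_True sq)
    also have "\<dots> = (\<integral>x. 2 / ?l * w\<^sup>2 * (cos (real (Suc k) * pi * x / ?l) * cos (real (Suc k) * pi * x / ?l)) \<partial>edge_measure \<Gamma> e0)"
      by (simp only: power2_eq_square mult_ac)
    also have "\<dots> = 2 / ?l * w\<^sup>2 * (\<integral>x. cos (real (Suc k) * pi * x / ?l) * cos (real (Suc k) * pi * x / ?l) \<partial>edge_measure \<Gamma> e0)"
      by (rule Bochner_Integration.integral_mult_right_zero)
    also have "\<dots> = w\<^sup>2"
      unfolding integral_trig_orthogonal(2)[OF l] using l by simp
    finally show ?thesis by (simp only: w_def)
  qed
  define s where "s k = \<kappa>\<^sup>2 + (real (Suc k) * pi / ?l)\<^sup>2" for k :: nat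
  have s_pos: "0 < s k" for k using kappa by (simp add: s_def add_pos_nonneg)
  define p where "p k i = (inn (f k) (\<Phi> i))\<^sup>2" for k i
  have p0: "0 \<le> p k i" for k i by (simp add: p_def)
  have p_sums: "p k sums 1" for k using Parseval[OF fL[of k]] by (simp add: p_def[abs_def] ff)
  have energy: "(\<Sum>i<n. lam i * p k i) \<le> s k" for n k
    using energy_Bessel[OF weak fcont ae_eq_refl, of k n] by (simp add: p_def s_def ff gg)
  have p_le: "(\<Sum>k<N. p k i) \<le> 1" for N i
  proof -
    have "(\<Sum>k<N. 1 * (inn (\<Phi> i) (f k))\<^sup>2) \<le> inn (\<Phi> i) (\<Phi> i)"
      by (rule Bessel[OF Phi_L2 fL]) (auto simp: ff)
    then show ?thesis by (simp add: p_def Phi_orthonormal L2_inner_commute[of \<Gamma> "\<Phi> i"])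
  qed
  define T where "T = (\<Sum>i. lam i powr (-1/2))"
  \<comment> \<open>Jensen for the truncated sum over \<open>i < n\<close>; the deficit of the total mass disappears as \<open>n\<close> grows.\<close>
  have fin: "(\<Sum>k<N. s k powr (-1/2) * (3/2 * (\<Sum>i<n. p k i) - 1/2)) \<le> T" for N n
  proof -
    have "s k powr (-1/2) * (3/2 * (\<Sum>i<n. p k i) - 1/2) \<le> (\<Sum>i<n. lam i powr (-1/2) * p k i)" for k
    proof -
      have "s k powr (-1/2) * (3/2 * (\<Sum>i<n. p k i) - 1/2) \<le>
          s k powr (-1/2) * (3/2 * (\<Sum>i<n. p k i) - (\<Sum>i<n. lam i * p k i) / (2 * s k))"
        using energy[of k n] s_pos[of k] by (intro mult_left_mono) (auto simp: field_simps)
      also have "\<dots> = (\<Sum>i<n. s k powr (-1/2) * (3/2 - lam i / (2 * s k)) * p k i)"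
        by (simp add: sum_distrib_left sum_divide_distrib sum_subtractf[symmetric] algebra_simps)
      also have "\<dots> \<le> (\<Sum>i<n. lam i powr (-1/2) * p k i)"
        by (intro sum_mono mult_right_mono inverse_sqrt_tangent s_pos lam_pos p0)
      finally show ?thesis .
    qed
    then have "(\<Sum>k<N. s k powr (-1/2) * (3/2 * (\<Sum>i<n. p k i) - 1/2)) \<le> (\<Sum>k<N. \<Sum>i<n. lam i powr (-1/2) * p k i)"
      by (rule sum_mono)
    also have "\<dots> = (\<Sum>i<n. lam i powr (-1/2) * (\<Sum>k<N. p k i))"
      by (subst sum.swap) (simp add: sum_distrib_left)
    also have "\<dots> \<le> (\<Sum>i<n. lam i powr (-1/2) * 1)"
      by (intro sum_mono mult_left_mono p_le) auto
    also have "\<dots> \<le> T" unfolding T_def using S by (simp add: sum_le_suminf)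
    finally show ?thesis .
  qed
  have "(\<lambda>n. \<Sum>k<N. s k powr (-1/2) * (3/2 * (\<Sum>i<n. p k i) - 1/2)) \<longlonglongrightarrow> (\<Sum>k<N. s k powr (-1/2) * (3/2 * 1 - 1/2))" for N
    using p_sums unfolding sums_def by (intro tendsto_intros)
  then have bound: "(\<Sum>k<N. s k powr (-1/2)) \<le> T" for N
    using LIMSEQ_le_const2[of _ _ T] fin by fastforce
  define c where "c = (\<kappa>\<^sup>2 + (pi / ?l)\<^sup>2) powr (-1/2)"
  have c: "0 < c" using kappa by (simp add: c_def add_pos_nonneg)
  have ge: "c * (1 / real (Suc k)) \<le> s k powr (-1/2)" for k
  proof -
    have "1 \<le> (real (Suc k))\<^sup>2" by simp
    then have "\<kappa>\<^sup>2 * 1 \<le> \<kappa>\<^sup>2 * (real (Suc k))\<^sup>2" by (intro mult_left_mono) auto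
    moreover have "(N * pi / ?l)\<^sup>2 = (pi / ?l)\<^sup>2 * N\<^sup>2" for N :: real
      by (simp add: power_mult_distrib power_divide)
    from this[of "real (Suc k)"] have "(real (Suc k) * pi / ?l)\<^sup>2 = (pi / ?l)\<^sup>2 * (real (Suc k))\<^sup>2" .
    ultimately have "s k \<le> (\<kappa>\<^sup>2 + (pi / ?l)\<^sup>2) * (real (Suc k))\<^sup>2"
      unfolding s_def distrib_right by linarith
    then have "((\<kappa>\<^sup>2 + (pi / ?l)\<^sup>2) * (real (Suc k))\<^sup>2) powr (-1/2) \<le> s k powr (-1/2)"
      using s_pos by (intro powr_mono2') auto
    also have "((\<kappa>\<^sup>2 + (pi / ?l)\<^sup>2) * (real (Suc k))\<^sup>2) powr (-1/2) = c * ((real (Suc k))\<^sup>2) powr (-1/2)"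
      by (simp add: powr_mult c_def)
    also have "((real (Suc k))\<^sup>2) powr (-1/2) = 1 / real (Suc k)"
      by (simp add: powr_minus_divide powr_half_sqrt del: of_nat_Suc)
    finally show ?thesis .
  qed
  have le: "(\<Sum>k<N. 1 / real (Suc k)) \<le> T / c" for N
  proof -
    have "c * (\<Sum>k<N. 1 / real (Suc k)) \<le> T"
      unfolding sum_distrib_left using sum_mono[of "{..<N}", OF ge] bound[of N] by (rule order_trans)
    then show ?thesis using c by (simp only: pos_le_divide_eq mult.commute)
  qed
  have "summable (\<lambda>k. 1 / real (Suc k))"
  proof (rule bounded_imp_summable)
    show "0 \<le> 1 / real (Suc k)" for k by simp
    show "(\<Sum>k\<le>n. 1 / real (Suc k)) \<le> T / c" for n
      using le[of "Suc n"] by (simp only: lessThan_Suc_atMost)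
  qed
  then have "summable (\<lambda>k. inverse (real (Suc k)))" by (simp only: inverse_eq_divide)
  then have "summable (\<lambda>k. inverse (real k))" by (rule summable_Suc_iff[THEN iffD1])
  then show False using not_summable_harmonic[where 'a = real] by blast
qed

end


section \<open>Spectral series and Sobolev regularity\<close>

text \<open>
  The trace inequality with parameter 1, applied to differences of members of the sequence.
\<close>

lemma uniformly_convergent_of_Cauchy_energy:
  fixes f f' :: "nat \<Rightarrow> real \<Rightarrow> real"
  assumes l: "0 < l"
    and f: "\<And>n x. x \<in> {0..l} \<Longrightarrow> (f n has_real_derivative f' n x) (at x within {0..l})"
    and f': "\<And>n. continuous_on {0..l} (f' n)"
    and C: "\<And>\<epsilon>. \<epsilon> > 0 \<Longrightarrow> \<exists>N. \<forall>m\<ge>N. \<forall>n\<ge>N. (\<integral>x. (f m x - f n x)\<^sup>2 \<partial>lebesgue_on {0..l}) < \<epsilon>"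
    and C': "\<And>\<epsilon>. \<epsilon> > 0 \<Longrightarrow> \<exists>N. \<forall>m\<ge>N. \<forall>n\<ge>N. (\<integral>x. (f' m x - f' n x)\<^sup>2 \<partial>lebesgue_on {0..l}) < \<epsilon>"
  obtains F where "uniform_limit {0..l} f F sequentially"
proof -
  have "uniformly_Cauchy_on {0..l} f"
    unfolding uniformly_Cauchy_on_def
  proof (intro allI impI)
    fix e :: real assume e: "e > 0"
    define K where "K = 1 / l + 1 + 1"
    have K: "K > 0" using l by (simp add: K_def add_pos_pos)
    obtain N where N: "\<And>m n. m \<ge> N \<Longrightarrow> n \<ge> N \<Longrightarrow> (\<integral>x. (f m x - f n x)\<^sup>2 \<partial>lebesgue_on {0..l}) < e\<^sup>2 / K"
      using C[of "e\<^sup>2 / K"] e K by auto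
    obtain N' where N': "\<And>m n. m \<ge> N' \<Longrightarrow> n \<ge> N' \<Longrightarrow> (\<integral>x. (f' m x - f' n x)\<^sup>2 \<partial>lebesgue_on {0..l}) < e\<^sup>2 / K"
      using C'[of "e\<^sup>2 / K"] e K by auto
    have "dist (f m x) (f n x) < e" if "x \<in> {0..l}" "m \<ge> max N N'" "n \<ge> max N N'" for x m n
    proof -
      have "(f m x - f n x)\<^sup>2 \<le> (1 / l + 1) * (\<integral>x. (f m x - f n x)\<^sup>2 \<partial>lebesgue_on {0..l}) + 1 / 1 * (\<integral>x. (f' m x - f' n x)\<^sup>2 \<partial>lebesgue_on {0..l})"
        using f f' by (intro trace_inequality[OF l zero_less_one _ _ that(1)]) (auto intro!: derivative_eq_intros continuous_intros)
      also have "\<dots> < (1 / l + 1) * (e\<^sup>2 / K) + 1 / 1 * (e\<^sup>2 / K)"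
        using N[of m n] N'[of m n] that l by (intro add_strict_mono mult_strict_left_mono) (auto simp: add_pos_pos)
      also have "\<dots> = K * (e\<^sup>2 / K)"
        unfolding div_by_1 mult_1 by (simp only: K_def distrib_right mult_1)
      also have "\<dots> = e\<^sup>2" using K by simp
      finally have "\<bar>f m x - f n x\<bar>\<^sup>2 < e\<^sup>2" by simp
      then show ?thesis using e by (simp add: dist_real_def power2_less_imp_less)
    qed
    then show "\<exists>M. \<forall>x\<in>{0..l}. \<forall>m\<ge>M. \<forall>n\<ge>M. dist (f m x) (f n x) < e" by blast
  qed
  then show ?thesis
    using that Cauchy_uniformly_convergent unfolding uniformly_convergent_on_def by blast
qed

lemma AE_eq_uniform_limit:
  fixes g F :: "real \<Rightarrow> real" and S :: "nat \<Rightarrow> real \<Rightarrow> real"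
  assumes l: "0 < l" and g: "square_integrable (lebesgue_on {0..l}) g" and S: "\<And>n. continuous_on {0..l} (S n)"
    and u: "uniform_limit {0..l} S F sequentially"
    and L2: "(\<lambda>n. \<integral>x. (g x - S n x)\<^sup>2 \<partial>lebesgue_on {0..l}) \<longlonglongrightarrow> 0"
  shows "continuous_on {0..l} F" "AE x in lebesgue_on {0..l}. g x = F x"
proof -
  show F: "continuous_on {0..l} F"
    using S by (intro uniform_limit_theorem[OF _ u]) auto
  have gF: "square_integrable (lebesgue_on {0..l}) (\<lambda>x. g x - F x)"
    by (intro square_integrable_diff g square_integrable_continuous F)
  have le: "(\<integral>x. (g x - F x)\<^sup>2 \<partial>lebesgue_on {0..l}) \<le> \<epsilon>" if e: "\<epsilon> > 0" for \<epsilon>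
  proof -
    define d where "d = sqrt (\<epsilon> / (4 * l))"
    have d: "d > 0" "d\<^sup>2 = \<epsilon> / (4 * l)" using e l by (auto simp: d_def)
    have "\<forall>\<^sub>F n in sequentially. \<forall>x\<in>{0..l}. dist (S n x) (F x) < d"
      using u d(1) by (rule uniform_limitD)
    moreover have "\<forall>\<^sub>F n in sequentially. (\<integral>x. (g x - S n x)\<^sup>2 \<partial>lebesgue_on {0..l}) < \<epsilon> / 4"
      by (rule order_tendstoD(2)[OF L2]) (use e in simp)
    ultimately have "\<forall>\<^sub>F n in sequentially. (\<integral>x. (g x - F x)\<^sup>2 \<partial>lebesgue_on {0..l}) \<le> \<epsilon>"
    proof eventually_elim
      case (elim n)
      have i: "integrable (lebesgue_on {0..l}) (\<lambda>x. (g x - S n x)\<^sup>2)"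
        using square_integrable_diff[OF g square_integrable_continuous[OF S]] by (simp add: square_integrable_def)
      have "(\<integral>x. (g x - F x)\<^sup>2 \<partial>lebesgue_on {0..l}) \<le> (\<integral>x. 2 * (g x - S n x)\<^sup>2 + 2 * d\<^sup>2 \<partial>lebesgue_on {0..l})"
      proof (rule integral_mono)
        show "integrable (lebesgue_on {0..l}) (\<lambda>x. (g x - F x)\<^sup>2)" using gF by (simp add: square_integrable_def)
        show "integrable (lebesgue_on {0..l}) (\<lambda>x. 2 * (g x - S n x)\<^sup>2 + 2 * d\<^sup>2)"
          by (intro Bochner_Integration.integrable_add integrable_mult_right i continuous_integrable_interval continuous_on_const)
        fix x assume "x \<in> space (lebesgue_on {0..l})"
        then have "\<bar>S n x - F x\<bar> \<le> d" using elim(1) by (auto simp: dist_real_def intro: less_imp_le)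
        then have "(S n x - F x)\<^sup>2 \<le> d\<^sup>2" using d(1) by (simp add: abs_le_square_iff[symmetric])
        moreover have "(g x - F x)\<^sup>2 \<le> 2 * (g x - S n x)\<^sup>2 + 2 * (S n x - F x)\<^sup>2"
        proof -
          have "0 \<le> ((g x - S n x) - (S n x - F x))\<^sup>2" by simp
          then show ?thesis by (simp add: power2_eq_square algebra_simps)
        qed
        ultimately show "(g x - F x)\<^sup>2 \<le> 2 * (g x - S n x)\<^sup>2 + 2 * d\<^sup>2" by linarith
      qed
      also have "\<dots> = 2 * (\<integral>x. (g x - S n x)\<^sup>2 \<partial>lebesgue_on {0..l}) + 2 * d\<^sup>2 * l"
      proof -
        have "integrable (lebesgue_on {0..l}) (\<lambda>x. 2 * d\<^sup>2)"
          by (intro continuous_integrable_interval continuous_on_const)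
        then show ?thesis using i l by (simp add: measure_restrict_space)
      qed
      also have "\<dots> \<le> \<epsilon>" using elim(2) d(2) l by simp
      finally show ?case .
    qed
    then show ?thesis using eventually_happens'[OF sequentially_bot] by blast
  qed
  have "(\<integral>x. (g x - F x)\<^sup>2 \<partial>lebesgue_on {0..l}) \<le> 0"
    by (rule field_le_epsilon) (use le in simp)
  then have "(\<integral>x. (g x - F x)\<^sup>2 \<partial>lebesgue_on {0..l}) = 0"
    by (intro antisym integral_nonneg_AE) auto
  then have "AE x in lebesgue_on {0..l}. (g x - F x)\<^sup>2 = 0"
    using gF by (subst (asm) integral_nonneg_eq_0_iff_AE) (auto simp: square_integrable_def)
  then show "AE x in lebesgue_on {0..l}. g x = F x" by eventually_elim simp
qed

lemma uniform_limit_deriv: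
  fixes S S' :: "nat \<Rightarrow> real \<Rightarrow> real"
  assumes S: "\<And>n x. x \<in> {0..l} \<Longrightarrow> (S n has_real_derivative S' n x) (at x within {0..l})"
    and u: "uniform_limit {0..l} S F sequentially" and u': "uniform_limit {0..l} S' G sequentially"
    and x: "x \<in> {0..l}"
  shows "(F has_real_derivative G x) (at x within {0..l})"
proof -
  have "\<exists>g. \<forall>x\<in>{0..l}. (\<lambda>n. S n x) \<longlonglongrightarrow> g x \<and> (g has_derivative (*) (G x)) (at x within {0..l})"
  proof (rule has_derivative_sequence[where f = S and f' = "\<lambda>n y. (*) (S' n y)" and g' = "\<lambda>y. (*) (G y)" and S = "{0..l}" and l = "F x"])
    show "(S n has_derivative (*) (S' n y)) (at y within {0..l})" if "y \<in> {0..l}" for n y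
      using S[OF that] by (simp add: has_field_derivative_def)
    show "(\<lambda>n. S n x) \<longlonglongrightarrow> F x" using tendsto_uniform_limitI[OF u x] .
    fix e :: real assume "e > 0"
    from uniform_limitD[OF u' this]
    show "\<forall>\<^sub>F n in sequentially. \<forall>x\<in>{0..l}. \<forall>h. norm (S' n x * h - G x * h) \<le> e * norm h"
    proof eventually_elim
      case (elim n)
      have "norm (S' n y * h - G y * h) \<le> e * norm h" if "y \<in> {0..l}" for y h
      proof -
        have "\<bar>S' n y - G y\<bar> \<le> e" using elim that by (auto simp: dist_real_def intro: less_imp_le)
        then show ?thesis
          unfolding real_norm_def left_diff_distrib[symmetric] abs_mult by (rule mult_right_mono) simp
      qed
      then show ?case by blast
    qed
  qed (use x in auto)
  then obtain g where gx: "\<forall>x\<in>{0..l}. (\<lambda>n. S n x) \<longlonglongrightarrow> g x \<and> (g has_derivative (*) (G x)) (at x within {0..l})" ..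
  have g: "(\<lambda>n. S n y) \<longlonglongrightarrow> g y" if "y \<in> {0..l}" for y using gx that by blast
  have g': "(g has_derivative (*) (G x)) (at x within {0..l})" using gx x by blast
  have "g y = F y" if "y \<in> {0..l}" for y
    using g[OF that] tendsto_uniform_limitI[OF u that] by (rule LIMSEQ_unique)
  then show ?thesis
    using g' has_field_derivative_transform_within[of g "G x" x "{0..l}" 1 F] x
    by (auto simp: has_field_derivative_def)
qed

context kirchhoff_eigenbasis
begin

subsection \<open>Weak derivatives through pairings with test functions\<close>

text \<open>
  Pairing with a test function on a single edge as an inner product on the whole graph, so that
  linearity and continuity of the inner product apply to weak derivatives.
\<close>

definition on_edge :: "'e \<Rightarrow> (real \<Rightarrow> real) \<Rightarrow> 'e graph_fun" where
  "on_edge e0 \<eta> = (\<lambda>e x. if e = e0 then \<eta> x else 0)"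

lemma inner_on_edge:
  assumes "e \<in> E" shows "inn f (on_edge e \<eta>) = (\<integral>x. f e x * \<eta> x \<partial>edge_measure \<Gamma> e)"
  unfolding L2_inner_def on_edge_def using assms finite_E
  by (subst sum.remove[of _ e]) (auto intro!: sum.neutral)

lemma on_edge_L2: "test_function l \<eta> \<Longrightarrow> on_edge e \<eta> \<in> L2 \<Gamma>"
  unfolding L2_iff on_edge_def
proof
  fix e' assume "test_function l \<eta>" 
  then show "square_integrable (edge_measure \<Gamma> e') (\<lambda>x. if e' = e then \<eta> x else 0)"
    by (cases "e' = e") (auto intro!: square_integrable_continuous intro: test_function_continuous)
qed

lemma has_weak_deriv_iff:
  "has_weak_deriv \<Gamma> j f g \<longleftrightarrow> f \<in> L2 \<Gamma> \<and> g \<in> L2 \<Gamma> \<and> (\<forall>e\<in>E. \<forall>\<eta>. test_function (len \<Gamma> e) \<eta> \<longrightarrow>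
     inn f (on_edge e ((deriv ^^ j) \<eta>)) = (-1) ^ j * inn g (on_edge e \<eta>))"
  unfolding has_weak_deriv_def by (auto simp: inner_on_edge)

text \<open>
  The function \<open>weak_deriv\<close> makes an arbitrary choice; this lemma identifies it with every weak derivative
  that is constructed explicitly.
\<close>

lemma weak_deriv_AE_unique:
  assumes g: "has_weak_deriv \<Gamma> j f g" and g': "has_weak_deriv \<Gamma> j f g'"
  shows "ae_eq \<Gamma> g g'"
  unfolding ae_eq_def
proof
  fix e assume e: "e \<in> E"
  have L: "g \<in> L2 \<Gamma>" "g' \<in> L2 \<Gamma>" using g g' by (auto simp: has_weak_deriv_def)
  have "AE x in edge_measure \<Gamma> e. g e x - g' e x = 0"
  proof (rule fundamental_lemma)
    show "integrable (edge_measure \<Gamma> e) (\<lambda>x. g e x - g' e x)"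
      by (intro Bochner_Integration.integrable_diff L2_integrable L e)
    fix \<eta> assume \<eta>: "test_function (len \<Gamma> e) \<eta>"
    have "(-1) ^ j * inn g (on_edge e \<eta>) = (-1) ^ j * inn g' (on_edge e \<eta>)"
      using g g' e \<eta> unfolding has_weak_deriv_iff by metis
    then have "inn g (on_edge e \<eta>) - inn g' (on_edge e \<eta>) = 0" by simp
    then have "inn (\<lambda>e x. g e x - g' e x) (on_edge e \<eta>) = 0"
      by (simp add: L2_inner_diff_left[OF L on_edge_L2[OF \<eta>]])
    then show "(\<integral>x. (g e x - g' e x) * \<eta> x \<partial>edge_measure \<Gamma> e) = 0"
      by (simp add: inner_on_edge[OF e])
  qed
  then show "AE x in edge_measure \<Gamma> e. g e x = g' e x" by eventually_elim simp
qed

lemma has_weak_deriv_weak_deriv: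
  "weakly_differentiable \<Gamma> j f \<Longrightarrow> has_weak_deriv \<Gamma> j f (weak_deriv \<Gamma> j f)"
  unfolding weakly_differentiable_def weak_deriv_def by (intro someI_ex[of "has_weak_deriv \<Gamma> j f"]) simp

lemma has_weak_deriv_sum:
  assumes "finite I" and w: "\<And>i. has_weak_deriv \<Gamma> j (f i) (g i)"
  shows "has_weak_deriv \<Gamma> j (\<lambda>e x. \<Sum>i\<in>I. c i * f i e x) (\<lambda>e x. \<Sum>i\<in>I. c i * g i e x)"
proof -
  have L: "f i \<in> L2 \<Gamma>" "g i \<in> L2 \<Gamma>" for i using w by (auto simp: has_weak_deriv_def)
  show ?thesis
    unfolding has_weak_deriv_iff
  proof (intro conjI ballI allI impI L2_sum assms L)
    fix e \<eta> assume e: "e \<in> E" and \<eta>: "test_function (len \<Gamma> e) \<eta>"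
    have \<eta>j: "test_function (len \<Gamma> e) ((deriv ^^ j) \<eta>)" by (rule test_function_higher_deriv[OF \<eta> len_pos[OF e]])
    have "inn (f i) (on_edge e ((deriv ^^ j) \<eta>)) = (-1) ^ j * inn (g i) (on_edge e \<eta>)" for i
      using w[of i] e \<eta> unfolding has_weak_deriv_iff by blast
    then show "inn (\<lambda>e x. \<Sum>i\<in>I. c i * f i e x) (on_edge e ((deriv ^^ j) \<eta>)) = (-1) ^ j * inn (\<lambda>e x. \<Sum>i\<in>I. c i * g i e x) (on_edge e \<eta>)"
      by (simp add: L2_inner_sum_left[OF assms(1) L(1) on_edge_L2[OF \<eta>j]]
            L2_inner_sum_left[OF assms(1) L(2) on_edge_L2[OF \<eta>]] sum_distrib_left mult_ac)
  qed
qed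

text \<open>
  Both sides of the defining identity are continuous in the mean square for a fixed test function.
\<close>

lemma has_weak_deriv_limit:
  assumes w: "\<And>n. has_weak_deriv \<Gamma> j (S n) (T n)" and L: "f \<in> L2 \<Gamma>" "g \<in> L2 \<Gamma>"
    and lim: "(\<lambda>n. L2_norm \<Gamma> (\<lambda>e x. f e x - S n e x)) \<longlonglongrightarrow> 0" "(\<lambda>n. L2_norm \<Gamma> (\<lambda>e x. g e x - T n e x)) \<longlonglongrightarrow> 0"
  shows "has_weak_deriv \<Gamma> j f g"
proof -
  have LS: "S n \<in> L2 \<Gamma>" "T n \<in> L2 \<Gamma>" for n using w by (auto simp: has_weak_deriv_def)
  show ?thesis
    unfolding has_weak_deriv_iff
  proof (intro conjI ballI allI impI L)
    fix e \<eta> assume e: "e \<in> E" and \<eta>: "test_function (len \<Gamma> e) \<eta>"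
    have \<eta>j: "test_function (len \<Gamma> e) ((deriv ^^ j) \<eta>)" by (rule test_function_higher_deriv[OF \<eta> len_pos[OF e]])
    have "(\<lambda>n. inn (S n) (on_edge e ((deriv ^^ j) \<eta>))) \<longlonglongrightarrow> inn f (on_edge e ((deriv ^^ j) \<eta>))"
      by (rule L2_inner_tendsto[OF LS(1) L(1) on_edge_L2[OF \<eta>j] lim(1)])
    moreover have "inn (S n) (on_edge e ((deriv ^^ j) \<eta>)) = (-1) ^ j * inn (T n) (on_edge e \<eta>)" for n
      using w[of n] e \<eta> unfolding has_weak_deriv_iff by blast
    moreover have "(\<lambda>n. (-1) ^ j * inn (T n) (on_edge e \<eta>)) \<longlonglongrightarrow> (-1) ^ j * inn g (on_edge e \<eta>)"
      by (intro tendsto_intros L2_inner_tendsto[OF LS(2) L(2) on_edge_L2[OF \<eta>] lim(2)])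
    ultimately show "inn f (on_edge e ((deriv ^^ j) \<eta>)) = (-1) ^ j * inn g (on_edge e \<eta>)"
      by (simp only:) (rule LIMSEQ_unique)
  qed
qed

lemma L2_inner_cmult_right: "inn f (\<lambda>e x. c * g e x) = c * inn f g"
  by (simp add: L2_inner_commute[of \<Gamma> f] L2_inner_cmult_left)

text \<open>
  The \<open>j\<close>-th derivative of \<open>\<Phi> i\<close>: by the equation every pair of derivatives costs a factor
  \<open>\<kappa>\<^sup>2 - lam i\<close>.
\<close>

definition higher_deriv :: "nat \<Rightarrow> nat \<Rightarrow> 'e graph_fun" where
  "higher_deriv j i = (\<lambda>e x. (\<kappa>\<^sup>2 - lam i) ^ (j div 2) * (if even j then \<Phi> i e x else D\<Phi> i e x))"

lemma higher_deriv_L2: "higher_deriv j i \<in> L2 \<Gamma>"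
  unfolding higher_deriv_def by (cases "even j") (auto intro!: L2_cmult Phi_L2 DPhi_L2)

lemma higher_deriv_orthogonal:
  "inn (higher_deriv j i) (higher_deriv j k) = (if i = k then (lam i - \<kappa>\<^sup>2) ^ j else 0)"
proof (cases "even j")
  case True
  then obtain m where m: "j = 2 * m" by blast
  have "(\<kappa>\<^sup>2 - lam i) ^ m * (\<kappa>\<^sup>2 - lam i) ^ m = (lam i - \<kappa>\<^sup>2) ^ j" for i
    by (metis m power2_commute power_mult power_mult_distrib power2_eq_square)
  then show ?thesis
    using True m by (simp add: higher_deriv_def L2_inner_cmult_left L2_inner_cmult_right Phi_orthonormal)
next
  case False
  then obtain m where m: "j = 2 * m + 1" using oddE by blast
  have "(\<kappa>\<^sup>2 - lam i) ^ m * ((\<kappa>\<^sup>2 - lam i) ^ m * (lam i - \<kappa>\<^sup>2)) = (lam i - \<kappa>\<^sup>2) ^ j" for i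
  proof -
    have "(\<kappa>\<^sup>2 - lam i) ^ m * (\<kappa>\<^sup>2 - lam i) ^ m = (lam i - \<kappa>\<^sup>2) ^ (2 * m)"
      by (metis power2_commute power_mult power_mult_distrib power2_eq_square)
    then show ?thesis by (simp add: m mult.assoc[symmetric])
  qed
  then show ?thesis
    using False m by (simp add: higher_deriv_def L2_inner_cmult_left L2_inner_cmult_right DPhi_orthogonal)
qed

lemma Phi_weak_derivs: "has_weak_deriv \<Gamma> j (\<Phi> i) (higher_deriv j i)"
  unfolding has_weak_deriv_iff
proof (intro conjI ballI allI impI Phi_L2 higher_deriv_L2)
  fix e \<eta> assume e: "e \<in> E" and \<eta>: "test_function (len \<Gamma> e) \<eta>"
  note l = len_pos[OF e]
  have 1: "inn (\<Phi> i) (on_edge e (deriv \<eta>)) = - inn (D\<Phi> i) (on_edge e \<eta>)" if "test_function (len \<Gamma> e) \<eta>" for \<eta>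
    using classical_weak_deriv[OF Phi_deriv[where i = i] DPhi_continuous[where i = i]] that e unfolding has_weak_deriv_iff by simp
  have 2: "inn (D\<Phi> i) (on_edge e (deriv \<eta>)) = - ((\<kappa>\<^sup>2 - lam i) * inn (\<Phi> i) (on_edge e \<eta>))" if "test_function (len \<Gamma> e) \<eta>" for \<eta>
  proof -
    have "has_weak_deriv \<Gamma> 1 (D\<Phi> i) (\<lambda>e x. (\<kappa>\<^sup>2 - lam i) * \<Phi> i e x)"
      by (rule classical_weak_deriv[OF DPhi_deriv]) (auto intro!: continuous_intros Phi_continuous)
    then show ?thesis using that e unfolding has_weak_deriv_iff by (simp add: L2_inner_cmult_left)
  qed
  have even_case: "inn (\<Phi> i) (on_edge e ((deriv ^^ (2 * m)) \<eta>)) = (\<kappa>\<^sup>2 - lam i) ^ m * inn (\<Phi> i) (on_edge e \<eta>)"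
    if "test_function (len \<Gamma> e) \<eta>" for m \<eta>
    using that
  proof (induction m arbitrary: \<eta>)
    case (Suc m)
    have t: "test_function (len \<Gamma> e) (deriv \<eta>)" "test_function (len \<Gamma> e) (deriv (deriv \<eta>))"
      using Suc.prems test_function_deriv l by auto
    have "(deriv ^^ (2 * Suc m)) \<eta> = (deriv ^^ (2 * m)) (deriv (deriv \<eta>))"
      by (simp add: funpow_swap1)
    then have "inn (\<Phi> i) (on_edge e ((deriv ^^ (2 * Suc m)) \<eta>)) = (\<kappa>\<^sup>2 - lam i) ^ m * inn (\<Phi> i) (on_edge e (deriv (deriv \<eta>)))"
      using Suc.IH[OF t(2)] by simp
    also have "inn (\<Phi> i) (on_edge e (deriv (deriv \<eta>))) = (\<kappa>\<^sup>2 - lam i) * inn (\<Phi> i) (on_edge e \<eta>)"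
      by (simp add: 1[OF t(1)] 2[OF Suc.prems])
    finally show ?case by simp
  qed simp
  show "inn (\<Phi> i) (on_edge e ((deriv ^^ j) \<eta>)) = (-1) ^ j * inn (higher_deriv j i) (on_edge e \<eta>)"
  proof (cases "even j")
    case True
    then obtain m where "j = 2 * m" by blast
    then show ?thesis using even_case[OF \<eta>, of m] by (simp add: higher_deriv_def L2_inner_cmult_left)
  next
    case False
    then obtain m where "j = 2 * m + 1" using oddE by blast
    then have m: "j = Suc (2 * m)" by simp
    have "(deriv ^^ j) \<eta> = (deriv ^^ (2 * m)) (deriv \<eta>)" by (simp add: m funpow_swap1)
    then show ?thesis using even_case[OF test_function_deriv[OF \<eta> l], of m] 1[OF \<eta>] m
      by (simp add: higher_deriv_def L2_inner_cmult_left)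
  qed
qed

lemma summable_shifted:
  assumes "summable (\<lambda>i. lam i ^ j * (b i)\<^sup>2)" shows "summable (\<lambda>i. (b i)\<^sup>2 * (lam i - \<kappa>\<^sup>2) ^ j)"
proof (rule summable_comparison_test'[OF assms])
  fix i :: nat
  have "0 \<le> lam i - \<kappa>\<^sup>2" "lam i - \<kappa>\<^sup>2 \<le> lam i" using lam_ge[of i] by simp_all
  then have "(lam i - \<kappa>\<^sup>2) ^ j \<le> lam i ^ j" "0 \<le> (lam i - \<kappa>\<^sup>2) ^ j"
    using power_mono[of "lam i - \<kappa>\<^sup>2" "lam i" j] by simp_all
  then show "norm ((b i)\<^sup>2 * (lam i - \<kappa>\<^sup>2) ^ j) \<le> lam i ^ j * (b i)\<^sup>2"
    by (simp add: abs_mult mult.commute[of "(b i)\<^sup>2"] mult_right_mono)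
qed

text \<open>
  The \<open>j\<close>-th derivatives of the partial sums form an orthogonal series that converges by hypothesis, and weak
  derivatives pass to the limit. The second conclusion identifies the derivative as this series.
\<close>

lemma spectral_weak_deriv:
  assumes f: "f \<in> L2 \<Gamma>" and s: "summable (\<lambda>i. lam i ^ j * (inn f (\<Phi> i))\<^sup>2)"
  obtains g where "has_weak_deriv \<Gamma> j f g"
    "(\<lambda>n. L2_norm \<Gamma> (\<lambda>e x. g e x - (\<Sum>i<n. inn f (\<Phi> i) * higher_deriv j i e x))) \<longlonglongrightarrow> 0"
proof -
  obtain g where g: "g \<in> L2 \<Gamma>" "(\<lambda>n. L2_norm \<Gamma> (\<lambda>e x. g e x - (\<Sum>i<n. inn f (\<Phi> i) * higher_deriv j i e x))) \<longlonglongrightarrow> 0"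
    by (rule L2_orthogonal_series[OF finite_E higher_deriv_L2 higher_deriv_orthogonal summable_shifted[OF s]])
  have "has_weak_deriv \<Gamma> j f g"
    by (rule has_weak_deriv_limit[OF has_weak_deriv_sum[OF _ Phi_weak_derivs] f g(1) Phi_expansion[OF f] g(2)]) auto
  with g show ?thesis using that by blast
qed

end


context kirchhoff_eigenbasis
begin

lemma summable_lower_power:
  assumes "summable (\<lambda>i. lam i ^ Suc k * (a i)\<^sup>2)" shows "summable (\<lambda>i. lam i ^ k * (a i)\<^sup>2)"
proof (rule summable_comparison_test'[OF summable_mult[OF assms, of "1 / lam 0"]])
  fix i :: nat
  have "lam 0 * lam i ^ k \<le> lam i * lam i ^ k"
    using lam_mono[of 0 i] lam_pos[of i] by (intro mult_right_mono) auto
  then have "lam i ^ k \<le> 1 / lam 0 * lam i ^ Suc k" using lam_pos[of 0] by (simp add: field_simps)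
  then have "lam i ^ k * (a i)\<^sup>2 \<le> 1 / lam 0 * lam i ^ Suc k * (a i)\<^sup>2" by (rule mult_right_mono) simp
  then show "norm (lam i ^ k * (a i)\<^sup>2) \<le> 1 / lam 0 * (lam i ^ Suc k * (a i)\<^sup>2)"
    using lam_pos[of i] by (simp add: abs_mult mult.assoc)
qed

text \<open>
  Localises the Cauchy property of an orthogonal series to one edge, where uniform convergence is proved.
\<close>

lemma edge_partial_sums_Cauchy:
  fixes \<psi> :: "nat \<Rightarrow> 'e graph_fun" and c m :: "nat \<Rightarrow> real"
  assumes e: "e \<in> E" and \<psi>: "\<And>i. \<psi> i \<in> L2 \<Gamma>" and orth: "\<And>i j. inn (\<psi> i) (\<psi> j) = (if i = j then m i else 0)"
    and s: "summable (\<lambda>i. (c i)\<^sup>2 * m i)" and \<epsilon>: "\<epsilon> > 0"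
  shows "\<exists>N. \<forall>k\<ge>N. \<forall>n\<ge>N. (\<integral>x. ((\<Sum>i<k. c i * \<psi> i e x) - (\<Sum>i<n. c i * \<psi> i e x))\<^sup>2 \<partial>edge_measure \<Gamma> e) < \<epsilon>"
proof -
  have le: "(\<integral>x. ((\<Sum>i<k. c i * \<psi> i e x) - (\<Sum>i<n. c i * \<psi> i e x))\<^sup>2 \<partial>edge_measure \<Gamma> e) \<le>
    inn (\<lambda>e x. (\<Sum>i<k. c i * \<psi> i e x) - (\<Sum>i<n. c i * \<psi> i e x)) (\<lambda>e x. (\<Sum>i<k. c i * \<psi> i e x) - (\<Sum>i<n. c i * \<psi> i e x))" for k n
    by (rule edge_integral_le_inner[OF e, of "\<lambda>e x. (\<Sum>i<k. c i * \<psi> i e x) - (\<Sum>i<n. c i * \<psi> i e x)"])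
  from L2_orthogonal_Cauchy[OF \<psi> orth s \<epsilon>] obtain N where
    N: "\<forall>k\<ge>N. \<forall>n\<ge>N. inn (\<lambda>e x. (\<Sum>i<k. c i * \<psi> i e x) - (\<Sum>i<n. c i * \<psi> i e x)) (\<lambda>e x. (\<Sum>i<k. c i * \<psi> i e x) - (\<Sum>i<n. c i * \<psi> i e x)) < \<epsilon>" ..
  show ?thesis
    by (intro exI[of _ N] allI impI, rule le_less_trans[OF le]) (use N in simp)
qed

lemma Phi_series_uniform:
  assumes e: "e \<in> E" and s: "summable (\<lambda>i. lam i * (a i)\<^sup>2)"
  obtains F where "uniform_limit {0..len \<Gamma> e} (\<lambda>n x. \<Sum>i<n. a i * \<Phi> i e x) F sequentially"
proof (rule uniformly_convergent_of_Cauchy_energy[OF len_pos[OF e]])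
  have "summable (\<lambda>i. lam i ^ 0 * (a i)\<^sup>2)" by (rule summable_lower_power) (use s in simp)
  then have s0: "summable (\<lambda>i. (a i)\<^sup>2 * 1)" by simp
  have s1: "summable (\<lambda>i. (a i)\<^sup>2 * (lam i - \<kappa>\<^sup>2))" using summable_shifted[of 1 a] s by simp
  show "\<exists>N. \<forall>m\<ge>N. \<forall>n\<ge>N. (\<integral>x. ((\<Sum>i<m. a i * \<Phi> i e x) - (\<Sum>i<n. a i * \<Phi> i e x))\<^sup>2 \<partial>edge_measure \<Gamma> e) < \<epsilon>" if "\<epsilon> > 0" for \<epsilon>
    by (rule edge_partial_sums_Cauchy[OF e Phi_L2 Phi_orthonormal s0 that])
  show "\<exists>N. \<forall>m\<ge>N. \<forall>n\<ge>N. (\<integral>x. ((\<Sum>i<m. a i * D\<Phi> i e x) - (\<Sum>i<n. a i * D\<Phi> i e x))\<^sup>2 \<partial>edge_measure \<Gamma> e) < \<epsilon>" if "\<epsilon> > 0" for \<epsilon>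
    by (rule edge_partial_sums_Cauchy[OF e DPhi_L2 DPhi_orthogonal s1 that])
  show "((\<lambda>x. \<Sum>i<n. a i * \<Phi> i e x) has_real_derivative (\<Sum>i<n. a i * D\<Phi> i e x)) (at x within {0..len \<Gamma> e})"
    if "x \<in> {0..len \<Gamma> e}" for n x by (rule Phi_sum_deriv[OF e that])
  show "continuous_on {0..len \<Gamma> e} (\<lambda>x. \<Sum>i<n. a i * D\<Phi> i e x)" for n
    by (intro continuous_intros DPhi_continuous e)
qed (rule that)

lemma DPhi_series_uniform:
  assumes e: "e \<in> E" and s: "summable (\<lambda>i. (lam i)\<^sup>2 * (a i)\<^sup>2)"
  obtains G where "uniform_limit {0..len \<Gamma> e} (\<lambda>n x. \<Sum>i<n. a i * D\<Phi> i e x) G sequentially"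
proof (rule uniformly_convergent_of_Cauchy_energy[OF len_pos[OF e]])
  have "summable (\<lambda>i. lam i ^ 1 * (a i)\<^sup>2)"
    by (rule summable_lower_power) (use s in \<open>simp add: power2_eq_square\<close>)
  then have s1: "summable (\<lambda>i. (a i)\<^sup>2 * (lam i - \<kappa>\<^sup>2))" using summable_shifted[of 1 a] by simp
  have "summable (\<lambda>i. (a i)\<^sup>2 * (lam i - \<kappa>\<^sup>2)\<^sup>2)" by (rule summable_shifted[OF s])
  then have s2: "summable (\<lambda>i. (a i * (\<kappa>\<^sup>2 - lam i))\<^sup>2 * 1)"
    by (simp add: power_mult_distrib power2_commute[of "\<kappa>\<^sup>2"])
  show "\<exists>N. \<forall>m\<ge>N. \<forall>n\<ge>N. (\<integral>x. ((\<Sum>i<m. a i * D\<Phi> i e x) - (\<Sum>i<n. a i * D\<Phi> i e x))\<^sup>2 \<partial>edge_measure \<Gamma> e) < \<epsilon>" if "\<epsilon> > 0" for \<epsilon>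
    by (rule edge_partial_sums_Cauchy[OF e DPhi_L2 DPhi_orthogonal s1 that])
  show "\<exists>N. \<forall>m\<ge>N. \<forall>n\<ge>N. (\<integral>x. ((\<Sum>i<m. a i * ((\<kappa>\<^sup>2 - lam i) * \<Phi> i e x)) - (\<Sum>i<n. a i * ((\<kappa>\<^sup>2 - lam i) * \<Phi> i e x)))\<^sup>2 \<partial>edge_measure \<Gamma> e) < \<epsilon>" if "\<epsilon> > 0" for \<epsilon>
    using edge_partial_sums_Cauchy[OF e Phi_L2 Phi_orthonormal s2 that] by (simp only: mult.assoc)
  show "((\<lambda>x. \<Sum>i<n. a i * D\<Phi> i e x) has_real_derivative (\<Sum>i<n. a i * ((\<kappa>\<^sup>2 - lam i) * \<Phi> i e x))) (at x within {0..len \<Gamma> e})"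
    if "x \<in> {0..len \<Gamma> e}" for n x by (rule DPhi_sum_deriv[OF e that])
  show "continuous_on {0..len \<Gamma> e} (\<lambda>x. \<Sum>i<n. a i * ((\<kappa>\<^sup>2 - lam i) * \<Phi> i e x))" for n
    by (intro continuous_intros Phi_continuous e)
qed (rule that)

lemma edge_tendsto_of_L2:
  assumes e: "e \<in> E" and lim: "(\<lambda>n. L2_norm \<Gamma> (\<lambda>e x. g e x - S n e x)) \<longlonglongrightarrow> 0"
  shows "(\<lambda>n. \<integral>x. (g e x - S n e x)\<^sup>2 \<partial>edge_measure \<Gamma> e) \<longlonglongrightarrow> 0"
proof (rule Lim_null_comparison)
  have "(\<lambda>n. (L2_norm \<Gamma> (\<lambda>e x. g e x - S n e x))\<^sup>2) \<longlonglongrightarrow> 0\<^sup>2" by (intro tendsto_intros lim)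
  then show "(\<lambda>n. inn (\<lambda>e x. g e x - S n e x) (\<lambda>e x. g e x - S n e x)) \<longlonglongrightarrow> 0" by (simp add: L2_norm_sq)
  show "\<forall>\<^sub>F n in sequentially. norm (\<integral>x. (g e x - S n e x)\<^sup>2 \<partial>edge_measure \<Gamma> e) \<le> inn (\<lambda>e x. g e x - S n e x) (\<lambda>e x. g e x - S n e x)"
    using edge_integral_le_inner[OF e, of "\<lambda>e x. g e x - S _ e x"] by (intro always_eventually allI) simp
qed

text \<open>
  A series of eigenfunctions that converges in the energy norm converges uniformly on every edge, and the
  uniform limit is a continuous representative of its limit in the mean square.
\<close>

lemma Phi_series_limit:
  assumes g: "g \<in> L2 \<Gamma>" and s: "summable (\<lambda>i. lam i * (a i)\<^sup>2)"
    and lim: "(\<lambda>n. L2_norm \<Gamma> (\<lambda>e x. g e x - (\<Sum>i<n. a i * \<Phi> i e x))) \<longlonglongrightarrow> 0"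
  obtains F where "\<And>e. e \<in> E \<Longrightarrow> uniform_limit {0..len \<Gamma> e} (\<lambda>n x. \<Sum>i<n. a i * \<Phi> i e x) (F e) sequentially"
    "\<And>e. e \<in> E \<Longrightarrow> continuous_on {0..len \<Gamma> e} (F e)" "ae_eq \<Gamma> g F"
proof -
  have "\<forall>e\<in>E. \<exists>F. uniform_limit {0..len \<Gamma> e} (\<lambda>n x. \<Sum>i<n. a i * \<Phi> i e x) F sequentially"
  proof
    fix e assume "e \<in> E"
    then obtain F where "uniform_limit {0..len \<Gamma> e} (\<lambda>n x. \<Sum>i<n. a i * \<Phi> i e x) F sequentially"
      by (rule Phi_series_uniform[OF _ s])
    then show "\<exists>F. uniform_limit {0..len \<Gamma> e} (\<lambda>n x. \<Sum>i<n. a i * \<Phi> i e x) F sequentially" by (rule exI[of _ F])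
  qed
  from bchoice[OF this] obtain F where
    F: "\<And>e. e \<in> E \<Longrightarrow> uniform_limit {0..len \<Gamma> e} (\<lambda>n x. \<Sum>i<n. a i * \<Phi> i e x) (F e) sequentially" by blast
  have c: "continuous_on {0..len \<Gamma> e} (\<lambda>x. \<Sum>i<n. a i * \<Phi> i e x)" if "e \<in> E" for n e
    by (intro continuous_intros Phi_continuous that)
  have sq: "square_integrable (edge_measure \<Gamma> e) (g e)" if "e \<in> E" for e using g that by (simp add: L2_iff)
  note * = AE_eq_uniform_limit[OF len_pos sq c F edge_tendsto_of_L2[OF _ lim]]
  show ?thesis
  proof (rule that[of F])
    show "ae_eq \<Gamma> g F" unfolding ae_eq_def by (intro ballI *(2))
  qed (assumption | rule F *(1))+
qed

text \<open>
  The values of the uniform limit at the edge ends are limits of the common vertex values of the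
  partial sums, so they match across edges.
\<close>

lemma H1_if_summable:
  assumes f: "f \<in> L2 \<Gamma>" and s: "summable (\<lambda>i. lam i * (inn f (\<Phi> i))\<^sup>2)"
  shows "f \<in> H1 \<Gamma>"
proof -
  have w0: "has_weak_deriv \<Gamma> 0 f f" using f by (simp add: has_weak_deriv_def)
  obtain g where w1: "has_weak_deriv \<Gamma> 1 f g"
    by (rule spectral_weak_deriv[OF f, of 1]) (use s in simp_all)
  have "f \<in> Sobolev_edges \<Gamma> 1"
    using f w0 w1 unfolding Sobolev_edges_def weakly_differentiable_def
    by (auto simp: le_Suc_eq)
  moreover have "f \<in> C_space \<Gamma>"
  proof -
    obtain F where F: "\<And>e. e \<in> E \<Longrightarrow> uniform_limit {0..len \<Gamma> e} (\<lambda>n x. \<Sum>i<n. inn f (\<Phi> i) * \<Phi> i e x) (F e) sequentially"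
      "\<And>e. e \<in> E \<Longrightarrow> continuous_on {0..len \<Gamma> e} (F e)" "ae_eq \<Gamma> f F"
      by (rule Phi_series_limit[OF f s Phi_expansion[OF f]]) (rule that)
    have "\<forall>i. \<exists>val. \<forall>e\<in>E. \<Phi> i e 0 = val (tail (shape \<Gamma>) e) \<and> \<Phi> i e (len \<Gamma> e) = val (head (shape \<Gamma>) e)"
      using Phi_continuous_on_graph unfolding continuous_on_graph_def by blast
    from choice[OF this] obtain val where val: "\<And>i e. e \<in> E \<Longrightarrow> \<Phi> i e 0 = val i (tail (shape \<Gamma>) e)"
      "\<And>i e. e \<in> E \<Longrightarrow> \<Phi> i e (len \<Gamma> e) = val i (head (shape \<Gamma>) e)" by blast
    define v where "v w = lim (\<lambda>n. \<Sum>i<n. inn f (\<Phi> i) * val i w)" for w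
    have "F e 0 = v (tail (shape \<Gamma>) e)" "F e (len \<Gamma> e) = v (head (shape \<Gamma>) e)" if e: "e \<in> E" for e
    proof -
      have t: "(\<lambda>n. \<Sum>i<n. inn f (\<Phi> i) * \<Phi> i e x) \<longlonglongrightarrow> F e x" if "x \<in> {0..len \<Gamma> e}" for x
        by (rule tendsto_uniform_limitI[OF F(1)[OF e] that])
      have "0 \<in> {0..len \<Gamma> e}" "len \<Gamma> e \<in> {0..len \<Gamma> e}" using len_pos[OF e] by auto
      from limI[OF t[OF this(1)]] limI[OF t[OF this(2)]]
      show "F e 0 = v (tail (shape \<Gamma>) e)" "F e (len \<Gamma> e) = v (head (shape \<Gamma>) e)"
        unfolding v_def val[OF e] by simp_all
    qed
    then have "continuous_on_graph \<Gamma> F"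
      unfolding continuous_on_graph_def using F(2) by blast
    then show ?thesis using F(3) by (auto simp: C_space_def)
  qed
  ultimately show ?thesis by (simp add: H1_def)
qed

text \<open>
  The energy of the function bounds all partial sums.
\<close>

lemma summable_if_H1:
  assumes "f \<in> H1 \<Gamma>" shows "summable (\<lambda>i. lam i * (inn f (\<Phi> i))\<^sup>2)"
proof -
  obtain c where c: "continuous_on_graph \<Gamma> c" "ae_eq \<Gamma> f c" using assms by (auto simp: H1_def C_space_def)
  obtain g where g: "has_weak_deriv \<Gamma> 1 f g"
    using assms by (auto simp: H1_def Sobolev_edges_def weakly_differentiable_def)
  show ?thesis
  proof (rule bounded_imp_summable)
    show "0 \<le> lam i * (inn f (\<Phi> i))\<^sup>2" for i using lam_pos[of i] by simp
    show "(\<Sum>i\<le>n. lam i * (inn f (\<Phi> i))\<^sup>2) \<le> \<kappa>\<^sup>2 * inn f f + inn g g" for n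
      using energy_Bessel[OF g c, of "Suc n"] by (simp only: lessThan_Suc_atMost)
  qed
qed

text \<open>
  With two orders of summability the series and its derivative both converge uniformly on the closed
  edges. The limit is then continuously differentiable up to the vertices, and its end derivatives are limits of
  end derivatives of partial sums, whose vertex sums vanish.
\<close>

lemma Phi_series_kirchhoff:
  assumes g: "g \<in> L2 \<Gamma>" and s: "summable (\<lambda>i. (lam i)\<^sup>2 * (a i)\<^sup>2)"
    and lim: "(\<lambda>n. L2_norm \<Gamma> (\<lambda>e x. g e x - (\<Sum>i<n. a i * \<Phi> i e x))) \<longlonglongrightarrow> 0"
    and w: "ae_eq \<Gamma> w g" and v: "v \<in> V"
  shows "kirchhoff_at \<Gamma> v w"
proof -
  have "summable (\<lambda>i. lam i ^ 1 * (a i)\<^sup>2)"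
    by (rule summable_lower_power) (use s in \<open>simp add: power2_eq_square\<close>)
  then have s1: "summable (\<lambda>i. lam i * (a i)\<^sup>2)" by simp
  obtain F where F: "\<And>e. e \<in> E \<Longrightarrow> uniform_limit {0..len \<Gamma> e} (\<lambda>n x. \<Sum>i<n. a i * \<Phi> i e x) (F e) sequentially"
      "\<And>e. e \<in> E \<Longrightarrow> continuous_on {0..len \<Gamma> e} (F e)" "ae_eq \<Gamma> g F"
    by (rule Phi_series_limit[OF g s1 lim]) (rule that)
  have "\<forall>e\<in>E. \<exists>G. uniform_limit {0..len \<Gamma> e} (\<lambda>n x. \<Sum>i<n. a i * D\<Phi> i e x) G sequentially"
  proof
    fix e assume "e \<in> E"
    then obtain G where "uniform_limit {0..len \<Gamma> e} (\<lambda>n x. \<Sum>i<n. a i * D\<Phi> i e x) G sequentially"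
      by (rule DPhi_series_uniform[OF _ s])
    then show "\<exists>G. uniform_limit {0..len \<Gamma> e} (\<lambda>n x. \<Sum>i<n. a i * D\<Phi> i e x) G sequentially" by (rule exI[of _ G])
  qed
  from bchoice[OF this] obtain G where
    G: "\<And>e. e \<in> E \<Longrightarrow> uniform_limit {0..len \<Gamma> e} (\<lambda>n x. \<Sum>i<n. a i * D\<Phi> i e x) (G e) sequentially" by blast
  have FG: "(F e has_real_derivative G e x) (at x within {0..len \<Gamma> e})" if "e \<in> E" "x \<in> {0..len \<Gamma> e}" for e x
    by (rule uniform_limit_deriv[OF Phi_sum_deriv[OF that(1)] F(1)[OF that(1)] G[OF that(1)] that(2)])
  have dir: "has_dir_deriv \<Gamma> w p (end_deriv G p)" if p: "p \<in> edge_ends \<Gamma> v" for p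
  proof -
    obtain e b where eb: "p = (e, b)" by force
    have e: "e \<in> E" using edge_ends_E[OF p] eb by simp
    have "AE x in edge_measure \<Gamma> e. w e x = g e x" "AE x in edge_measure \<Gamma> e. g e x = F e x"
      using w F(3) e by (auto simp: ae_eq_def)
    then have "AE x in edge_measure \<Gamma> e. w e x = F e x" by eventually_elim simp
    then show ?thesis
      unfolding has_dir_deriv_def eb prod.case
      using F(2)[OF e] FG[OF e, of 0] FG[OF e, of "len \<Gamma> e"] len_pos[OF e]
      by (intro exI[of _ "F e"]) (auto simp: end_deriv_def)
  qed
  have "(\<lambda>n. \<Sum>p\<in>edge_ends \<Gamma> v. \<Sum>i<n. a i * end_deriv (D\<Phi> i) p) \<longlonglongrightarrow> (\<Sum>p\<in>edge_ends \<Gamma> v. end_deriv G p)"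
  proof (rule tendsto_sum)
    fix p assume p: "p \<in> edge_ends \<Gamma> v"
    obtain e b where eb: "p = (e, b)" by force
    have e: "e \<in> E" using edge_ends_E[OF p] eb by simp
    have "(\<lambda>n. \<Sum>i<n. a i * D\<Phi> i e x) \<longlonglongrightarrow> G e x" if "x \<in> {0..len \<Gamma> e}" for x
      by (rule tendsto_uniform_limitI[OF G[OF e] that])
    from this[of 0] tendsto_minus[OF this[of "len \<Gamma> e"]]
    show "(\<lambda>n. \<Sum>i<n. a i * end_deriv (D\<Phi> i) p) \<longlonglongrightarrow> end_deriv G p"
      using len_pos[OF e] by (cases b) (simp_all add: eb end_deriv_def sum_negf)
  qed
  moreover have "(\<Sum>p\<in>edge_ends \<Gamma> v. \<Sum>i<n. a i * end_deriv (D\<Phi> i) p) = 0" for n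
    by (subst sum.swap) (simp add: sum_distrib_left[symmetric] Phi_kirchhoff[OF v])
  ultimately have "(\<lambda>n::nat. 0) \<longlonglongrightarrow> (\<Sum>p\<in>edge_ends \<Gamma> v. end_deriv G p)"
    by (simp only:)
  then have "(\<Sum>p\<in>edge_ends \<Gamma> v. end_deriv G p) = 0" by (simp only: LIMSEQ_const_iff)
  with dir show ?thesis unfolding kirchhoff_at_def by (intro exI[of _ "end_deriv G"]) blast
qed

text \<open>
  An even derivative of an eigenfunction is a multiple of the eigenfunction, so the derivative of order
  \<open>j\<close> is again a series of functions satisfying the vertex condition.
\<close>

lemma kirchhoff_even_weak_deriv:
  assumes f: "f \<in> L2 \<Gamma>" and j: "even j" and s: "summable (\<lambda>i. lam i ^ (j + 2) * (inn f (\<Phi> i))\<^sup>2)" and v: "v \<in> V"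
  shows "kirchhoff_at \<Gamma> v (weak_deriv \<Gamma> j f)"
proof -
  obtain m where m: "j = 2 * m" using j by blast
  have "summable (\<lambda>i. lam i ^ (j + 1) * (inn f (\<Phi> i))\<^sup>2)" by (rule summable_lower_power) (use s in simp)
  then have sj: "summable (\<lambda>i. lam i ^ j * (inn f (\<Phi> i))\<^sup>2)" by (intro summable_lower_power[of j]) simp
  obtain g where g: "has_weak_deriv \<Gamma> j f g"
    "(\<lambda>n. L2_norm \<Gamma> (\<lambda>e x. g e x - (\<Sum>i<n. inn f (\<Phi> i) * higher_deriv j i e x))) \<longlonglongrightarrow> 0"
    by (rule spectral_weak_deriv[OF f sj])
  define a where "a i = inn f (\<Phi> i) * (\<kappa>\<^sup>2 - lam i) ^ m" for i
  have lim: "(\<lambda>n. L2_norm \<Gamma> (\<lambda>e x. g e x - (\<Sum>i<n. a i * \<Phi> i e x))) \<longlonglongrightarrow> 0"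
    using g(2) j by (simp add: higher_deriv_def a_def m mult.assoc)
  have sa: "summable (\<lambda>i. (lam i)\<^sup>2 * (a i)\<^sup>2)"
  proof (rule summable_comparison_test'[OF s])
    fix i :: nat
    have "\<bar>\<kappa>\<^sup>2 - lam i\<bar> \<le> lam i" using lam_ge[of i] by auto
    then have "\<bar>\<kappa>\<^sup>2 - lam i\<bar> ^ j \<le> lam i ^ j" by (intro power_mono) auto
    moreover have "\<bar>\<kappa>\<^sup>2 - lam i\<bar> ^ j = ((\<kappa>\<^sup>2 - lam i) ^ m)\<^sup>2"
      using j by (simp add: power_even_abs m power_mult[symmetric] mult.commute)
    ultimately have "(lam i)\<^sup>2 * (inn f (\<Phi> i))\<^sup>2 * ((\<kappa>\<^sup>2 - lam i) ^ m)\<^sup>2 \<le> (lam i)\<^sup>2 * (inn f (\<Phi> i))\<^sup>2 * lam i ^ j"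
      by (intro mult_left_mono) auto
    then have "(lam i)\<^sup>2 * (a i)\<^sup>2 \<le> lam i ^ (j + 2) * (inn f (\<Phi> i))\<^sup>2"
      by (simp only: a_def power_mult_distrib power_add mult_ac)
    then show "norm ((lam i)\<^sup>2 * (a i)\<^sup>2) \<le> lam i ^ (j + 2) * (inn f (\<Phi> i))\<^sup>2" by simp
  qed
  have gL: "g \<in> L2 \<Gamma>" using g(1) by (simp add: has_weak_deriv_def)
  have "has_weak_deriv \<Gamma> j f (weak_deriv \<Gamma> j f)"
    using g(1) by (intro has_weak_deriv_weak_deriv) (auto simp: weakly_differentiable_def)
  from weak_deriv_AE_unique[OF this g(1)] show ?thesis
    by (rule Phi_series_kirchhoff[OF gL sa lim _ v])
qed

end


section \<open>Gaussian sums of squares\<close>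

lemma centered_gaussian_moments:
  assumes X: "centered_gaussian M X" and v: "(\<integral>\<omega>. (X \<omega>)\<^sup>2 \<partial>M) = v" "v > 0"
  shows "integrable M (\<lambda>\<omega>. X \<omega> ^ 4)" "(\<integral>\<omega>. X \<omega> ^ 4 \<partial>M) = 3 * v\<^sup>2"
proof -
  have "\<not> (AE \<omega> in M. X \<omega> = 0)"
  proof
    assume "AE \<omega> in M. X \<omega> = 0"
    then have "AE \<omega> in M. (X \<omega>)\<^sup>2 = 0" by eventually_elim simp
    then have "(\<integral>\<omega>. (X \<omega>)\<^sup>2 \<partial>M) = 0" by (rule integral_eq_zero_AE)
    with v show False by simp
  qed
  with X obtain \<sigma> where \<sigma>: "\<sigma> > 0" and D: "distributed M lborel X (normal_density 0 \<sigma>)"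
    by (auto simp: centered_gaussian_def)
  have mom: "(\<integral>\<omega>. X \<omega> ^ (2 * k) \<partial>M) = fact (2 * k) / ((2 / \<sigma>\<^sup>2) ^ k * fact k)"
    and int: "integrable M (\<lambda>\<omega>. X \<omega> ^ (2 * k))" for k
  proof -
    have *: "has_bochner_integral lborel (\<lambda>x. normal_density 0 \<sigma> x * x ^ (2 * k)) (fact (2 * k) / ((2 / \<sigma>\<^sup>2) ^ k * fact k))"
      using normal_moment_even[OF \<sigma>, of 0 k] by simp
    have "(\<integral>x. normal_density 0 \<sigma> x * x ^ (2 * k) \<partial>lborel) = (\<integral>\<omega>. X \<omega> ^ (2 * k) \<partial>M)"
      by (rule distributed_integral[OF D]) auto
    then show "(\<integral>\<omega>. X \<omega> ^ (2 * k) \<partial>M) = fact (2 * k) / ((2 / \<sigma>\<^sup>2) ^ k * fact k)"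
      using has_bochner_integral_integral_eq[OF *] by simp
    have "integrable lborel (\<lambda>x. normal_density 0 \<sigma> x * x ^ (2 * k)) \<longleftrightarrow> integrable M (\<lambda>\<omega>. X \<omega> ^ (2 * k))"
      by (rule distributed_integrable[OF D]) auto
    then show "integrable M (\<lambda>\<omega>. X \<omega> ^ (2 * k))" using * has_bochner_integral_iff by blast
  qed
  have "v = \<sigma>\<^sup>2" using mom[of 1] v(1) by simp
  moreover have "(\<integral>\<omega>. X \<omega> ^ 4 \<partial>M) = 3 * (\<sigma>\<^sup>2)\<^sup>2"
    using mom[of 2] \<sigma> by (simp add: fact_numeral power_divide)
  ultimately show "(\<integral>\<omega>. X \<omega> ^ 4 \<partial>M) = 3 * v\<^sup>2" by simp
  show "integrable M (\<lambda>\<omega>. X \<omega> ^ 4)" using int[of 2] by simp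
qed

text \<open>
  Gaussianity of sums and differences is enough: polarisation expresses \<open>X\<^sup>2 * Y\<^sup>2\<close> through the fourth
  powers of \<open>X\<close>, \<open>Y\<close>, \<open>X + Y\<close> and \<open>X - Y\<close>. The last two have equal variances because
  \<open>X\<close> and \<open>Y\<close> are uncorrelated.
\<close>

lemma gaussian_pair_fourth_moment:
  assumes X: "centered_gaussian M X" "centered_gaussian M Y"
    and S: "centered_gaussian M (\<lambda>\<omega>. X \<omega> + Y \<omega>)" "centered_gaussian M (\<lambda>\<omega>. X \<omega> - Y \<omega>)"
    and i: "integrable M (\<lambda>\<omega>. (X \<omega>)\<^sup>2)" "integrable M (\<lambda>\<omega>. (Y \<omega>)\<^sup>2)" "integrable M (\<lambda>\<omega>. X \<omega> * Y \<omega>)"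
    and v: "(\<integral>\<omega>. (X \<omega>)\<^sup>2 \<partial>M) = v" "v > 0" "(\<integral>\<omega>. (Y \<omega>)\<^sup>2 \<partial>M) = w" "w > 0" "(\<integral>\<omega>. X \<omega> * Y \<omega> \<partial>M) = 0"
  shows "integrable M (\<lambda>\<omega>. (X \<omega>)\<^sup>2 * (Y \<omega>)\<^sup>2)" "(\<integral>\<omega>. (X \<omega>)\<^sup>2 * (Y \<omega>)\<^sup>2 \<partial>M) = v * w"
proof -
  have "(\<integral>\<omega>. (X \<omega> + Y \<omega>)\<^sup>2 \<partial>M) = (\<integral>\<omega>. (X \<omega>)\<^sup>2 + 2 * (X \<omega> * Y \<omega>) + (Y \<omega>)\<^sup>2 \<partial>M)"
    by (simp add: power2_sum algebra_simps)
  also have "\<dots> = v + w" using i v by simp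
  finally have p: "(\<integral>\<omega>. (X \<omega> + Y \<omega>)\<^sup>2 \<partial>M) = v + w" .
  have "(\<integral>\<omega>. (X \<omega> - Y \<omega>)\<^sup>2 \<partial>M) = (\<integral>\<omega>. (X \<omega>)\<^sup>2 - 2 * (X \<omega> * Y \<omega>) + (Y \<omega>)\<^sup>2 \<partial>M)"
    by (simp add: power2_diff algebra_simps)
  also have "\<dots> = v + w" using i v by simp
  finally have m: "(\<integral>\<omega>. (X \<omega> - Y \<omega>)\<^sup>2 \<partial>M) = v + w" .
  have vw: "v + w > 0" using v by simp
  note M = centered_gaussian_moments[OF X(1) v(1,2)] centered_gaussian_moments[OF X(2) v(3,4)]
    centered_gaussian_moments[OF S(1) p vw] centered_gaussian_moments[OF S(2) m vw]
  have polar: "(x::real)\<^sup>2 * y\<^sup>2 = ((x + y) ^ 4 + (x - y) ^ 4 - 2 * x ^ 4 - 2 * y ^ 4) / 12" for x y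
    by (simp add: power4_eq_xxxx power2_eq_square algebra_simps)
  show "integrable M (\<lambda>\<omega>. (X \<omega>)\<^sup>2 * (Y \<omega>)\<^sup>2)" unfolding polar using M by simp
  have "(\<integral>\<omega>. (X \<omega>)\<^sup>2 * (Y \<omega>)\<^sup>2 \<partial>M) = (3 * (v + w)\<^sup>2 + 3 * (v + w)\<^sup>2 - 2 * (3 * v\<^sup>2) - 2 * (3 * w\<^sup>2)) / 12"
    unfolding polar using M by simp
  also have "\<dots> = v * w" by (simp add: power2_eq_square algebra_simps)
  finally show "(\<integral>\<omega>. (X \<omega>)\<^sup>2 * (Y \<omega>)\<^sup>2 \<partial>M) = v * w" .
qed

text \<open>
  Let \<open>S n\<close> be the partial sums and \<open>A n\<close> their expectations. The moment hypotheses bound the variance of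
  \<open>S n\<close> by \<open>2 * B * A n\<close>, so \<open>S n / A n\<close> tends to 1 in the mean square, and almost surely along a
  subsequence. Where the series converges this quotient tends to 0, since \<open>A n\<close> is unbounded.
\<close>

lemma not_AE_summable_squares:
  fixes Y :: "nat \<Rightarrow> 'w \<Rightarrow> real" and w v :: "nat \<Rightarrow> real"
  assumes M: "prob_space M"
    and m2: "\<And>i. integrable M (\<lambda>\<omega>. (Y i \<omega>)\<^sup>2)" "\<And>i. (\<integral>\<omega>. (Y i \<omega>)\<^sup>2 \<partial>M) = v i"
    and m4: "\<And>i j. integrable M (\<lambda>\<omega>. (Y i \<omega>)\<^sup>2 * (Y j \<omega>)\<^sup>2)"
      "\<And>i j. (\<integral>\<omega>. (Y i \<omega>)\<^sup>2 * (Y j \<omega>)\<^sup>2 \<partial>M) = (if i = j then 3 else 1) * (v i * v j)"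
    and w: "\<And>i. 0 < w i * v i" "\<And>i. w i * v i \<le> B" "\<not> summable (\<lambda>i. w i * v i)"
  shows "\<not> (AE \<omega> in M. summable (\<lambda>i. w i * (Y i \<omega>)\<^sup>2))"
proof
  assume AE: "AE \<omega> in M. summable (\<lambda>i. w i * (Y i \<omega>)\<^sup>2)"
  interpret prob_space M by fact
  define a where "a i = w i * v i" for i
  have a: "0 < a i" "a i \<le> B" for i using w(1,2) by (auto simp: a_def)
  \<comment> \<open>Starting with one summand keeps \<open>A n\<close> positive for every \<open>n\<close>.\<close>
  define A where "A n = (\<Sum>i<Suc n. a i)" for n
  define S where "S n \<omega> = (\<Sum>i<Suc n. w i * (Y i \<omega>)\<^sup>2)" for n \<omega>
  have A_pos: "0 < A n" for n unfolding A_def using a by (intro sum_pos) auto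
  have A_lim: "filterlim A at_top sequentially"
  proof -
    have "mono A" unfolding A_def using a by (intro monoI sum_mono2) (auto intro: less_imp_le)
    moreover have "\<not> bdd_above (range A)"
    proof
      assume "bdd_above (range A)"
      then obtain C where C: "\<And>n. A n \<le> C" by (auto simp: bdd_above_def)
      have "summable a"
      proof (rule bounded_imp_summable)
        show "(\<Sum>i\<le>n. a i) \<le> C" for n using C[of n] unfolding A_def lessThan_Suc_atMost .
      qed (use a in \<open>auto intro: less_imp_le\<close>)
      with w(3) show False unfolding a_def[abs_def] by blast
    qed
    ultimately show ?thesis
      unfolding filterlim_at_top
    proof (intro allI)
      fix Z
      have "\<exists>n. Z < A n" using \<open>\<not> bdd_above (range A)\<close> unfolding bdd_above_def by (auto simp: not_le)
      then obtain n where n: "Z < A n" ..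
      have "Z \<le> A k" if "n \<le> k" for k
        using n monoD[OF \<open>mono A\<close> that] by simp
      then show "\<forall>\<^sub>F n in sequentially. Z \<le> A n" unfolding eventually_sequentially by blast
    qed
  qed
  have int_S: "integrable M (S n)" and E_S: "expectation (S n) = A n" for n
    unfolding S_def A_def a_def using m2 by simp_all
  have S_sq: "(S n \<omega>)\<^sup>2 = (\<Sum>i<Suc n. \<Sum>j<Suc n. w i * w j * ((Y i \<omega>)\<^sup>2 * (Y j \<omega>)\<^sup>2))" for n \<omega>
    unfolding S_def power2_eq_square[of "sum _ _"] sum_product by (intro sum.cong refl) (simp only: mult_ac)
  have int_S2: "integrable M (\<lambda>\<omega>. (S n \<omega>)\<^sup>2)" for n
    unfolding S_sq by (intro Bochner_Integration.integrable_sum integrable_mult_right m4(1))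
  have E_S2: "expectation (\<lambda>\<omega>. (S n \<omega>)\<^sup>2) \<le> (A n)\<^sup>2 + 2 * B * A n" for n
  proof -
    have "expectation (\<lambda>\<omega>. (S n \<omega>)\<^sup>2) = (\<Sum>i<Suc n. \<Sum>j<Suc n. w i * w j * ((if i = j then 3 else 1) * (v i * v j)))"
      unfolding S_sq
      by (subst Bochner_Integration.integral_sum, intro Bochner_Integration.integrable_sum integrable_mult_right m4(1),
          subst Bochner_Integration.integral_sum, intro integrable_mult_right m4(1), simp only: integral_mult_right_zero m4(2))
    also have "\<dots> = (\<Sum>i<Suc n. \<Sum>j<Suc n. a i * a j + (if i = j then 2 * (a i * a i) else 0))"
      by (intro sum.cong refl) (auto simp: a_def)
    also have "\<dots> = (\<Sum>i<Suc n. \<Sum>j<Suc n. a i * a j) + (\<Sum>i<Suc n. \<Sum>j<Suc n. if i = j then 2 * (a i * a i) else 0)"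
      by (simp only: sum.distrib)
    also have "(\<Sum>i<Suc n. \<Sum>j<Suc n. if i = j then 2 * (a i * a i) else 0) = (\<Sum>i<Suc n. 2 * (a i * a i))"
      by (intro sum.cong refl) (simp add: sum.delta' del: sum.lessThan_Suc)
    also have "(\<Sum>i<Suc n. \<Sum>j<Suc n. a i * a j) = (A n)\<^sup>2"
      unfolding A_def power2_eq_square sum_product ..
    also have "(\<Sum>i<Suc n. 2 * (a i * a i)) \<le> (\<Sum>i<Suc n. 2 * (B * a i))"
      using a by (intro sum_mono mult_left_mono mult_right_mono) (auto intro: less_imp_le)
    also have "(\<Sum>i<Suc n. 2 * (B * a i)) = 2 * B * A n" unfolding A_def sum_distrib_left mult.assoc ..
    finally show ?thesis by simp
  qed
  define U where "U n \<omega> = (S n \<omega> / A n - 1)\<^sup>2" for n \<omega>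
  have U_eq: "U n \<omega> = 1 / (A n)\<^sup>2 * (S n \<omega>)\<^sup>2 - 2 / A n * S n \<omega> + 1" for n \<omega>
    by (simp add: U_def power2_diff power_divide)
  have int_U: "integrable M (U n)" for n unfolding U_eq[abs_def] using int_S int_S2 by simp
  have "(\<integral>\<omega>. norm (U n \<omega>) \<partial>M) \<le> 2 * B / A n" for n
  proof -
    have "(\<integral>\<omega>. norm (U n \<omega>) \<partial>M) = (\<integral>\<omega>. U n \<omega> \<partial>M)" by (simp add: U_def)
    also have "\<dots> = 1 / (A n)\<^sup>2 * expectation (\<lambda>\<omega>. (S n \<omega>)\<^sup>2) - 2 / A n * A n + 1"
      unfolding U_eq using int_S[of n] int_S2[of n] E_S[of n] by (simp add: prob_space)
    also have "\<dots> \<le> 1 / (A n)\<^sup>2 * ((A n)\<^sup>2 + 2 * B * A n) - 2 / A n * A n + 1"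
      by (intro add_mono diff_mono mult_left_mono E_S2 order_refl) auto
    also have "\<dots> = 2 * B / A n" using A_pos[of n] by (simp add: field_simps power2_eq_square)
    finally show ?thesis .
  qed
  moreover have "(\<lambda>n. 2 * B / A n) \<longlonglongrightarrow> 0"
    by (rule tendsto_divide_0[OF tendsto_const filterlim_at_top_imp_at_infinity[OF A_lim]])
  ultimately have "(\<lambda>n. \<integral>\<omega>. norm (U n \<omega>) \<partial>M) \<longlonglongrightarrow> 0"
    by (intro Lim_null_comparison[of "\<lambda>n. \<integral>\<omega>. norm (U n \<omega>) \<partial>M" "\<lambda>n. 2 * B / A n"] always_eventually) auto
  from tendsto_L1_AE_subseq[OF int_U this] obtain r where r: "strict_mono r"
    "AE \<omega> in M. (\<lambda>n. U (r n) \<omega>) \<longlonglongrightarrow> 0" by blast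
  from r(2) AE have "AE \<omega> in M. False"
  proof eventually_elim
    case (elim \<omega>)
    have "(\<lambda>n. S n \<omega>) \<longlonglongrightarrow> (\<Sum>i. w i * (Y i \<omega>)\<^sup>2)"
      unfolding S_def using elim(2) summable_LIMSEQ LIMSEQ_Suc by blast
    then have "(\<lambda>n. S n \<omega> / A n) \<longlonglongrightarrow> 0"
      by (rule tendsto_divide_0[OF _ filterlim_at_top_imp_at_infinity[OF A_lim]])
    then have "(\<lambda>n. U n \<omega>) \<longlonglongrightarrow> (0 - 1)\<^sup>2" unfolding U_def by (intro tendsto_intros)
    then have "(\<lambda>n. U (r n) \<omega>) \<longlonglongrightarrow> 1" using LIMSEQ_subseq_LIMSEQ[OF _ r(1)] by (fastforce simp: o_def)
    with elim(1) show False using LIMSEQ_unique by fastforce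
  qed
  then show False by simp
qed

text \<open>
  Monotone convergence: the expectation of the sum is the sum of the expectations, and a variable of finite
  expectation is finite almost surely.
\<close>

lemma AE_summable_of_expectation:
  fixes X :: "nat \<Rightarrow> 'w \<Rightarrow> real"
  assumes X: "\<And>i. integrable M (X i)" "\<And>i \<omega>. 0 \<le> X i \<omega>" and s: "summable (\<lambda>i. \<integral>\<omega>. X i \<omega> \<partial>M)"
  shows "AE \<omega> in M. summable (\<lambda>i. X i \<omega>)" "integrable M (\<lambda>\<omega>. \<Sum>i. X i \<omega>)"
proof -
  have "(\<integral>\<^sup>+\<omega>. (\<Sum>i. ennreal (X i \<omega>)) \<partial>M) = (\<Sum>i. \<integral>\<^sup>+\<omega>. ennreal (X i \<omega>) \<partial>M)"
    using X by (intro nn_integral_suminf) auto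
  also have "\<dots> = (\<Sum>i. ennreal (\<integral>\<omega>. X i \<omega> \<partial>M))"
    using X by (intro suminf_cong nn_integral_eq_integral) auto
  also have "\<dots> < \<infinity>" using s X(2) by (subst suminf_ennreal2) (auto intro: integral_nonneg_AE)
  finally have "AE \<omega> in M. (\<Sum>i. ennreal (X i \<omega>)) \<noteq> \<infinity>"
    using X by (intro nn_integral_noteq_infinite) auto
  then show AE: "AE \<omega> in M. summable (\<lambda>i. X i \<omega>)"
    by eventually_elim (intro summable_suminf_not_top, auto simp: X)
  show "integrable M (\<lambda>\<omega>. \<Sum>i. X i \<omega>)"
    by (rule integrable_suminf) (use X s AE in auto)
qed

section \<open>Whittle--Matern fields\<close>

locale whittle_matern_field = kirchhoff_eigenbasis \<Gamma> \<kappa> \<phi> lam + prob_space M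
  for \<Gamma> :: "('v, 'e) metric_graph" and \<kappa> :: real and \<phi> :: "nat \<Rightarrow> 'e graph_fun" and lam :: "nat \<Rightarrow> real"
    and M :: "'w measure" +
  fixes W :: "'e graph_fun \<Rightarrow> 'w \<Rightarrow> real" and u :: "'w \<Rightarrow> 'e graph_fun" and \<tau> \<alpha> :: real
  assumes tau: "\<tau> > 0" and alpha: "\<alpha> > 1/2" and noise: "white_noise M \<Gamma> W"
    and solution: "whittle_matern_solution M \<Gamma> \<phi> lam \<alpha> \<tau> W u"
begin

definition "\<xi> i \<omega> = inn (u \<omega>) (\<phi> i)"

text \<open>
  The argument at which the noise is evaluated to give \<open>\<xi> i\<close>, and the variance that results.
\<close>

definition "mode i = (\<lambda>e x. inverse \<tau> * L_pow \<Gamma> \<phi> lam (-\<alpha>/2) (\<phi> i) e x)"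

definition "mode_var i = (inverse \<tau>)\<^sup>2 * lam i powr (-\<alpha>)"

lemma mode_var_pos: "0 < mode_var i" using tau lam_pos[of i] by (simp add: mode_var_def)

lemma u_L2: "AE \<omega> in M. u \<omega> \<in> L2 \<Gamma>"
  using solution by (auto simp: whittle_matern_solution_def bochner_measurable_def)

text \<open>
  The operator power is an arbitrary limit in the mean square, hence determined only up to null sets, and only its
  inner products are accessible. For an eigenfunction the approximating sums are eventually constant, which
  gives both the existence of the limit and its value.
\<close>

lemma L_pow_phi:
  shows "L_pow \<Gamma> \<phi> lam \<beta> (\<phi> i) \<in> L2 \<Gamma>"
    and "f \<in> L2 \<Gamma> \<Longrightarrow> inn (L_pow \<Gamma> \<phi> lam \<beta> (\<phi> i)) f = lam i powr \<beta> * inn (\<phi> i) f"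
proof -
  let ?S = "\<lambda>n e x. \<Sum>j<n. lam j powr \<beta> * inn (\<phi> i) (\<phi> j) * \<phi> j e x"
  let ?c = "\<lambda>e x. lam i powr \<beta> * \<phi> i e x"
  have S: "?S n e x = ?c e x" if "i < n" for n e x
  proof -
    have "?S n e x = (\<Sum>j<n. if i = j then lam j powr \<beta> * \<phi> j e x else 0)"
      by (intro sum.cong refl) (simp add: phi_orthonormal)
    then show ?thesis using that by simp
  qed
  have ev: "\<forall>\<^sub>F n in sequentially. L2_norm \<Gamma> (\<lambda>e x. g e x - ?S n e x) = L2_norm \<Gamma> (\<lambda>e x. g e x - ?c e x)" for g
    using eventually_gt_at_top[of i] by eventually_elim (simp only: S)
  have c: "?c \<in> L2 \<Gamma>" by (intro L2_cmult phi_L2)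
  have "L2_norm \<Gamma> (\<lambda>e x. ?c e x - ?c e x) = 0" by (simp add: L2_norm_def L2_inner_def)
  then have "(\<lambda>n. L2_norm \<Gamma> (\<lambda>e x. ?c e x - ?S n e x)) \<longlonglongrightarrow> 0"
    using ev[of ?c] by (intro tendsto_eventually) simp
  with c have ex: "\<exists>g. g \<in> L2 \<Gamma> \<and> (\<lambda>n. L2_norm \<Gamma> (\<lambda>e x. g e x - ?S n e x)) \<longlonglongrightarrow> 0" by blast
  define g where "g = L_pow \<Gamma> \<phi> lam \<beta> (\<phi> i)"
  have g: "g \<in> L2 \<Gamma>" "(\<lambda>n. L2_norm \<Gamma> (\<lambda>e x. g e x - ?S n e x)) \<longlonglongrightarrow> 0"
    using someI_ex[OF ex] unfolding g_def L_pow_def by blast+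
  then show "L_pow \<Gamma> \<phi> lam \<beta> (\<phi> i) \<in> L2 \<Gamma>" by (simp add: g_def)
  have "(\<lambda>n. L2_norm \<Gamma> (\<lambda>e x. g e x - ?S n e x)) \<longlonglongrightarrow> L2_norm \<Gamma> (\<lambda>e x. g e x - ?c e x)"
    by (rule tendsto_eventually[OF ev])
  with g(2) have z: "L2_norm \<Gamma> (\<lambda>e x. g e x - ?c e x) = 0" using LIMSEQ_unique by blast
  show "inn (L_pow \<Gamma> \<phi> lam \<beta> (\<phi> i)) f = lam i powr \<beta> * inn (\<phi> i) f" if f: "f \<in> L2 \<Gamma>"
  proof -
    have "\<bar>inn (\<lambda>e x. g e x - ?c e x) f\<bar> \<le> 0"
      using L2_inner_bound[OF L2_diff[OF g(1) c] f] z by simp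
    then have "inn g f - inn ?c f = 0" using L2_inner_diff_left[OF g(1) c f] by simp
    then show ?thesis by (simp add: g_def L2_inner_cmult_left)
  qed
qed

lemma mode_L2: "mode i \<in> L2 \<Gamma>"
  unfolding mode_def by (intro L2_cmult L_pow_phi)

lemma mode_inner: "inn (mode i) (mode j) = (if i = j then mode_var i else 0)"
proof -
  have "inn (mode i) f = inverse \<tau> * lam i powr (-\<alpha>/2) * inn (\<phi> i) f" if "f \<in> L2 \<Gamma>" for f i
    unfolding mode_def L2_inner_cmult_left L_pow_phi(2)[OF that] by simp
  from this[OF mode_L2] this[OF phi_L2]
  have "inn (mode i) (mode j) = inverse \<tau> * lam i powr (-\<alpha>/2) * (inverse \<tau> * lam j powr (-\<alpha>/2) * inn (\<phi> j) (\<phi> i))"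
    by (simp add: L2_inner_commute[of \<Gamma> "\<phi> i"])
  moreover have "lam i powr (-\<alpha>/2) * lam i powr (-\<alpha>/2) = lam i powr (-\<alpha>)"
    by (simp add: powr_add[symmetric])
  ultimately show ?thesis by (auto simp: phi_orthonormal mode_var_def power2_eq_square)
qed

lemma noise_gaussian: "finite H \<Longrightarrow> H \<subseteq> L2 \<Gamma> \<Longrightarrow> centered_gaussian M (\<lambda>\<omega>. \<Sum>g\<in>H. c g * W g \<omega>)"
  using noise by (simp add: white_noise_def)

lemma noise_cov: "f \<in> L2 \<Gamma> \<Longrightarrow> g \<in> L2 \<Gamma> \<Longrightarrow> (\<integral>\<omega>. W f \<omega> * W g \<omega> \<partial>M) = inn f g"
  using noise by (simp add: white_noise_def)

lemma noise_mode:
  "centered_gaussian M (W (mode i))" "integrable M (\<lambda>\<omega>. (W (mode i) \<omega>)\<^sup>2)" "(\<integral>\<omega>. (W (mode i) \<omega>)\<^sup>2 \<partial>M) = mode_var i"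
proof -
  show "centered_gaussian M (W (mode i))" using noise_gaussian[of "{mode i}" "\<lambda>_. 1"] mode_L2 by simp
  show v: "(\<integral>\<omega>. (W (mode i) \<omega>)\<^sup>2 \<partial>M) = mode_var i"
    using noise_cov[OF mode_L2 mode_L2, of i i] by (simp add: power2_eq_square mode_inner)
  show "integrable M (\<lambda>\<omega>. (W (mode i) \<omega>)\<^sup>2)"
    using v mode_var_pos[of i] not_integrable_integral_eq by fastforce
qed

text \<open>
  Different modes are different functions, since they are orthogonal and nonzero; only then do
  \<open>c i * W (mode i) + c j * W (mode j)\<close> occur among the sums over finite sets in the definition of white noise.
\<close>

lemma noise_mode_fourth:
  "integrable M (\<lambda>\<omega>. (W (mode i) \<omega>)\<^sup>2 * (W (mode j) \<omega>)\<^sup>2)"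
  "(\<integral>\<omega>. (W (mode i) \<omega>)\<^sup>2 * (W (mode j) \<omega>)\<^sup>2 \<partial>M) = (if i = j then 3 else 1) * (mode_var i * mode_var j)"
proof -
  have "integrable M (\<lambda>\<omega>. (W (mode i) \<omega>)\<^sup>2 * (W (mode j) \<omega>)\<^sup>2) \<and>
    (\<integral>\<omega>. (W (mode i) \<omega>)\<^sup>2 * (W (mode j) \<omega>)\<^sup>2 \<partial>M) = (if i = j then 3 else 1) * (mode_var i * mode_var j)"
  proof (cases "i = j")
    case True
    have "(W (mode i) \<omega>)\<^sup>2 * (W (mode i) \<omega>)\<^sup>2 = W (mode i) \<omega> ^ 4" for \<omega>
      by (simp add: power4_eq_xxxx power2_eq_square)
    then show ?thesis using True centered_gaussian_moments[OF noise_mode(1) noise_mode(3) mode_var_pos, of i]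
      by (simp add: power2_eq_square)
  next
    case False
    have ne: "mode i \<noteq> mode j" using mode_inner[of i j] mode_inner[of i i] mode_var_pos[of i] False by auto
    have g: "centered_gaussian M (\<lambda>\<omega>. W (mode i) \<omega> + c * W (mode j) \<omega>)" for c
      using noise_gaussian[of "{mode i, mode j}" "\<lambda>g. if g = mode i then 1 else c"] mode_L2 ne by simp
    have m: "W (mode k) \<in> borel_measurable M" for k using noise_mode(1)[of k] by (simp add: centered_gaussian_def)
    have ij: "integrable M (\<lambda>\<omega>. W (mode i) \<omega> * W (mode j) \<omega>)"
      by (rule square_integrable_mult) (auto simp: square_integrable_def m noise_mode)
    have "(\<integral>\<omega>. W (mode i) \<omega> * W (mode j) \<omega> \<partial>M) = 0" using noise_cov[OF mode_L2 mode_L2] False by (simp add: mode_inner)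
    from gaussian_pair_fourth_moment[OF noise_mode(1) noise_mode(1) _ _ noise_mode(2) noise_mode(2) ij noise_mode(3) mode_var_pos noise_mode(3) mode_var_pos this]
    show ?thesis using g[of 1] g[of "-1"] False by simp
  qed
  then show "integrable M (\<lambda>\<omega>. (W (mode i) \<omega>)\<^sup>2 * (W (mode j) \<omega>)\<^sup>2)"
    "(\<integral>\<omega>. (W (mode i) \<omega>)\<^sup>2 * (W (mode j) \<omega>)\<^sup>2 \<partial>M) = (if i = j then 3 else 1) * (mode_var i * mode_var j)" by blast+
qed

lemma xi_eq: "AE \<omega> in M. \<xi> i \<omega> = W (mode i) \<omega>"
  using solution phi_L2 unfolding whittle_matern_solution_def \<xi>_def mode_def by blast

lemma xi_measurable: "\<xi> i \<in> borel_measurable M"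
  using solution phi_L2 unfolding whittle_matern_solution_def \<xi>_def centered_gaussian_def by fast

lemma xi_moments: "integrable M (\<lambda>\<omega>. (\<xi> i \<omega>)\<^sup>2)" "(\<integral>\<omega>. (\<xi> i \<omega>)\<^sup>2 \<partial>M) = mode_var i"
proof -
  have m: "(\<lambda>\<omega>. (\<xi> i \<omega>)\<^sup>2) \<in> borel_measurable M" "(\<lambda>\<omega>. (W (mode i) \<omega>)\<^sup>2) \<in> borel_measurable M"
    using xi_measurable[of i] noise_mode(2)[of i] by auto
  have ae: "AE \<omega> in M. (\<xi> i \<omega>)\<^sup>2 = (W (mode i) \<omega>)\<^sup>2" using xi_eq[of i] by eventually_elim simp
  show "integrable M (\<lambda>\<omega>. (\<xi> i \<omega>)\<^sup>2)" using integrable_cong_AE[OF m ae] noise_mode(2) by simp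
  show "(\<integral>\<omega>. (\<xi> i \<omega>)\<^sup>2 \<partial>M) = mode_var i" using integral_cong_AE[OF m ae] noise_mode(3) by simp
qed

text \<open>
  The expected sum is a multiple of the sum of \<open>lam i powr (s - \<alpha>)\<close>, an exponent below \<open>-1/2\<close>.
\<close>

lemma coefficients_summable:
  assumes s: "s < \<alpha> - 1/2"
  shows "AE \<omega> in M. summable (\<lambda>i. lam i powr s * (\<xi> i \<omega>)\<^sup>2)"
    and "integrable M (\<lambda>\<omega>. \<Sum>i. lam i powr s * (\<xi> i \<omega>)\<^sup>2)"
proof -
  have e: "(\<integral>\<omega>. lam i powr s * (\<xi> i \<omega>)\<^sup>2 \<partial>M) = (inverse \<tau>)\<^sup>2 * lam i powr (- (\<alpha> - s))" for i
    using xi_moments[of i] by (simp add: mode_var_def powr_add[symmetric] algebra_simps)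
  have "summable (\<lambda>i. \<integral>\<omega>. lam i powr s * (\<xi> i \<omega>)\<^sup>2 \<partial>M)"
    unfolding e using s by (intro summable_mult summable_lam_powr) simp
  from AE_summable_of_expectation[OF _ _ this]
  show "AE \<omega> in M. summable (\<lambda>i. lam i powr s * (\<xi> i \<omega>)\<^sup>2)"
    "integrable M (\<lambda>\<omega>. \<Sum>i. lam i powr s * (\<xi> i \<omega>)\<^sup>2)"
    using xi_moments by auto
qed

lemma coefficients_summable_power:
  assumes "real j < \<alpha> - 1/2"
  shows "AE \<omega> in M. u \<omega> \<in> L2 \<Gamma> \<and> summable (\<lambda>i. lam i ^ j * (inn (u \<omega>) (\<Phi> i))\<^sup>2)"
  using coefficients_summable(1)[OF assms] u_L2
proof eventually_elim
  case (elim \<omega>)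
  then show ?case by (simp add: \<xi>_def inner_phi[symmetric] powr_realpow[OF lam_pos])
qed

text \<open>
  If \<open>\<alpha> > 3/2\<close>, the energy of \<open>u\<close> has finite expectation. Otherwise membership in \<open>H1\<close> would make
  \<open>lam i * (\<xi> i)\<^sup>2\<close> summable, contradicting the divergence theorem for Gaussian squares.
\<close>

lemma AE_H1_iff: "(AE \<omega> in M. u \<omega> \<in> H1 \<Gamma>) \<longleftrightarrow> \<alpha> > 3/2"
proof
  assume "\<alpha> > 3/2"
  then have "AE \<omega> in M. u \<omega> \<in> L2 \<Gamma> \<and> summable (\<lambda>i. lam i ^ 1 * (inn (u \<omega>) (\<Phi> i))\<^sup>2)"
    by (intro coefficients_summable_power) simp
  then show "AE \<omega> in M. u \<omega> \<in> H1 \<Gamma>" by eventually_elim (simp add: H1_if_summable)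
next
  assume H: "AE \<omega> in M. u \<omega> \<in> H1 \<Gamma>"
  show "\<alpha> > 3/2"
  proof (rule ccontr)
    assume "\<not> \<alpha> > 3/2"
    then have le: "\<alpha> - 3/2 \<le> 0" by simp
    \<comment> \<open>Weights dominated by a multiple of \<open>lam i\<close>, since \<open>\<alpha> \<le> 3/2\<close>, for which the expectations are a multiple of \<open>lam i powr (-1/2)\<close>: bounded, but not summable.\<close>
    define w where "w i = lam i powr (\<alpha> - 1/2)" for i
    have wv: "w i * mode_var i = (inverse \<tau>)\<^sup>2 * lam i powr (-1/2)" for i
      by (simp add: w_def mode_var_def powr_add[symmetric])
    have pos: "(inverse \<tau>)\<^sup>2 > 0" using tau by simp
    have w_le: "w i \<le> lam 0 powr (\<alpha> - 3/2) * lam i" for i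
    proof -
      have "w i = lam i powr (\<alpha> - 3/2) * lam i powr 1" unfolding w_def powr_add[symmetric] by simp
      also have "\<dots> \<le> lam 0 powr (\<alpha> - 3/2) * lam i powr 1"
        using le lam_pos[of 0] lam_mono[of 0 i] by (intro mult_right_mono powr_mono2') auto
      finally show ?thesis using lam_pos[of i] by simp
    qed
    have all_eq: "AE \<omega> in M. \<forall>i. \<xi> i \<omega> = W (mode i) \<omega>" using xi_eq by (simp add: AE_all_countable)
    have "AE \<omega> in M. summable (\<lambda>i. w i * (W (mode i) \<omega>)\<^sup>2)"
      using H all_eq
    proof eventually_elim
      case (elim \<omega>)
      then have L: "u \<omega> \<in> L2 \<Gamma>" by (simp add: H1_def Sobolev_edges_def)
      have s: "summable (\<lambda>i. lam i * (inn (u \<omega>) (\<Phi> i))\<^sup>2)" by (rule summable_if_H1[OF elim(1)])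
      show ?case
      proof (rule summable_comparison_test'[OF summable_mult[OF s, of "lam 0 powr (\<alpha> - 3/2)"]])
        fix i :: nat
        have "W (mode i) \<omega> = inn (u \<omega>) (\<Phi> i)" using elim(2) inner_phi[OF L] by (simp add: \<xi>_def)
        then show "norm (w i * (W (mode i) \<omega>)\<^sup>2) \<le> lam 0 powr (\<alpha> - 3/2) * (lam i * (inn (u \<omega>) (\<Phi> i))\<^sup>2)"
          using mult_right_mono[OF w_le[of i], of "(inn (u \<omega>) (\<Phi> i))\<^sup>2"] by (simp add: abs_mult w_def mult.assoc)
      qed
    qed
    moreover have "\<not> (AE \<omega> in M. summable (\<lambda>i. w i * (W (mode i) \<omega>)\<^sup>2))"
    proof (rule not_AE_summable_squares[OF prob_space_axioms noise_mode(2,3) noise_mode_fourth])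
      show "0 < w i * mode_var i" for i unfolding wv using pos lam_pos[of i] by simp
      show "w i * mode_var i \<le> (inverse \<tau>)\<^sup>2 * lam 0 powr (-1/2)" for i
        unfolding wv using lam_pos[of 0] lam_mono[of 0 i] by (intro mult_left_mono powr_mono2') auto
      show "\<not> summable (\<lambda>i. w i * mode_var i)"
        unfolding wv using not_summable_lam_powr pos by (simp add: summable_cmult_iff)
    qed
    ultimately show False by blast
  qed
qed

lemma AE_weakly_differentiable:
  assumes "real j < \<alpha> - 1/2" shows "AE \<omega> in M. weakly_differentiable \<Gamma> j (u \<omega>)"
  using coefficients_summable_power[OF assms]
proof eventually_elim
  case (elim \<omega>)
  then obtain g where "has_weak_deriv \<Gamma> j (u \<omega>) g" by (elim conjE) (rule spectral_weak_deriv)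
  then show ?case unfolding weakly_differentiable_def by blast
qed

lemma AE_kirchhoff:
  assumes "real (j + 2) < \<alpha> - 1/2" "even j"
  shows "AE \<omega> in M. \<forall>v\<in>V. kirchhoff_at \<Gamma> v (weak_deriv \<Gamma> j (u \<omega>))"
  using coefficients_summable_power[OF assms(1)]
proof eventually_elim
  case (elim \<omega>)
  then show ?case using kirchhoff_even_weak_deriv[OF _ assms(2)] by blast
qed

end


context whittle_matern_field
begin

section \<open>Bochner measurability in the spectral scale\<close>

lemma simple_function_finite_expansion:
  assumes "\<And>i. simple_function M (q i)"
  shows "simple_function M (\<lambda>\<omega>. (\<lambda>e x. \<Sum>i<n. q i \<omega> * \<phi> i e x) :: 'e graph_fun)"
proof (induction n)
  case (Suc n)
  show ?case
    using simple_function_compose2[OF Suc assms[of n], of "\<lambda>F t e x. F e x + t * \<phi> n e x"] by simp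
qed simp

lemma inner_finite_expansion:
  "inn (\<lambda>e x. \<Sum>i<n. c i * \<phi> i e x) (\<phi> k) = (if k < n then c k else 0)"
  by (simp add: L2_inner_sum_left[OF _ phi_L2 phi_L2] phi_orthonormal if_distrib[of "\<lambda>x. _ * x"] cong: if_cong)

text \<open>
  Truncating the expansion at \<open>n\<close> and replacing each coefficient by a simple function dominated by
  \<open>2 * \<bar>\<xi> i\<bar>\<close> gives simple functions with values in finite expansions. One sequence serves all orders
  \<open>s\<close>: the errors tend to zero termwise and are dominated by \<open>9 * lam i powr s * (\<xi> i)\<^sup>2\<close>.
\<close>

lemma simple_approximations:
  obtains U :: "nat \<Rightarrow> 'w \<Rightarrow> 'e graph_fun" where
    "\<And>n. simple_function M (U n)" "\<And>n \<omega>. U n \<omega> \<in> L2 \<Gamma>"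
    "\<And>n \<omega> s. summable (\<lambda>i. lam i powr s * (inn (U n \<omega>) (\<phi> i))\<^sup>2)"
    "\<And>s \<omega>. \<omega> \<in> space M \<Longrightarrow> summable (\<lambda>i. lam i powr s * (\<xi> i \<omega>)\<^sup>2) \<Longrightarrow>
       (\<lambda>n. sqrt (\<Sum>i. lam i powr s * (inn (U n \<omega>) (\<phi> i) - \<xi> i \<omega>)\<^sup>2)) \<longlonglongrightarrow> 0"
proof -
  have "\<forall>i. \<exists>F. (\<forall>n. simple_function M (F n)) \<and> (\<forall>x\<in>space M. (\<lambda>n. F n x) \<longlonglongrightarrow> \<xi> i x) \<and>
     (\<forall>n. \<forall>x\<in>space M. dist (F n x) 0 \<le> 2 * dist (\<xi> i x) 0)"
    by (rule allI, rule borel_measurable_implies_sequence_metric[OF xi_measurable])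
  from choice[OF this] obtain q where q': "\<forall>i. (\<forall>n. simple_function M (q i n)) \<and>
     (\<forall>x\<in>space M. (\<lambda>n. q i n x) \<longlonglongrightarrow> \<xi> i x) \<and> (\<forall>n. \<forall>x\<in>space M. dist (q i n x) 0 \<le> 2 * dist (\<xi> i x) 0)" ..
  then have q: "\<And>i n. simple_function M (q i n)"
    "\<And>i \<omega>. \<omega> \<in> space M \<Longrightarrow> (\<lambda>n. q i n \<omega>) \<longlonglongrightarrow> \<xi> i \<omega>"
    "\<And>i n \<omega>. \<omega> \<in> space M \<Longrightarrow> \<bar>q i n \<omega>\<bar> \<le> 2 * \<bar>\<xi> i \<omega>\<bar>" by simp_all
  define U where "U n \<omega> = (\<lambda>e x. \<Sum>i<n. q i n \<omega> * \<phi> i e x)" for n \<omega>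
  have Uk: "inn (U n \<omega>) (\<phi> k) = (if k < n then q k n \<omega> else 0)" for n \<omega> k
    unfolding U_def by (rule inner_finite_expansion)
  have sU: "summable (\<lambda>i. lam i powr s * (inn (U n \<omega>) (\<phi> i))\<^sup>2)" for n \<omega> s
    by (rule summable_finite[of "{..<n}"]) (auto simp: Uk)
  have conv: "(\<lambda>n. sqrt (\<Sum>i. lam i powr s * (inn (U n \<omega>) (\<phi> i) - \<xi> i \<omega>)\<^sup>2)) \<longlonglongrightarrow> 0"
    if \<omega>: "\<omega> \<in> space M" and s: "summable (\<lambda>i. lam i powr s * (\<xi> i \<omega>)\<^sup>2)" for s \<omega>
  proof -
    have lim_k: "(\<lambda>n. lam k powr s * (inn (U n \<omega>) (\<phi> k) - \<xi> k \<omega>)\<^sup>2) \<longlonglongrightarrow> 0" for k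
    proof -
      have "\<forall>\<^sub>F n in sequentially. q k n \<omega> = inn (U n \<omega>) (\<phi> k)"
        using eventually_gt_at_top[of k] by eventually_elim (simp add: Uk)
      with q(2)[OF \<omega>] have "(\<lambda>n. inn (U n \<omega>) (\<phi> k)) \<longlonglongrightarrow> \<xi> k \<omega>" by (rule Lim_transform_eventually)
      then have "(\<lambda>n. lam k powr s * (inn (U n \<omega>) (\<phi> k) - \<xi> k \<omega>)\<^sup>2) \<longlonglongrightarrow> lam k powr s * (\<xi> k \<omega> - \<xi> k \<omega>)\<^sup>2"
        by (intro tendsto_intros)
      then show ?thesis by simp
    qed
    have bound: "norm (lam k powr s * (inn (U n \<omega>) (\<phi> k) - \<xi> k \<omega>)\<^sup>2) \<le> 9 * (lam k powr s * (\<xi> k \<omega>)\<^sup>2)" for k n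
    proof -
      have "\<bar>inn (U n \<omega>) (\<phi> k) - \<xi> k \<omega>\<bar> \<le> 3 * \<bar>\<xi> k \<omega>\<bar>"
        using q(3)[OF \<omega>, of k n] by (auto simp: Uk)
      then have "(inn (U n \<omega>) (\<phi> k) - \<xi> k \<omega>)\<^sup>2 \<le> (3 * \<xi> k \<omega>)\<^sup>2"
        by (intro abs_le_square_iff[THEN iffD1]) (simp add: abs_mult)
      then have "lam k powr s * (inn (U n \<omega>) (\<phi> k) - \<xi> k \<omega>)\<^sup>2 \<le> lam k powr s * (3 * \<xi> k \<omega>)\<^sup>2"
        by (rule mult_left_mono) simp
      then show ?thesis by (simp add: abs_mult power_mult_distrib mult_ac)
    qed
    have "(\<lambda>n. \<Sum>k. lam k powr s * (inn (U n \<omega>) (\<phi> k) - \<xi> k \<omega>)\<^sup>2) \<longlonglongrightarrow> (\<Sum>k::nat. 0)"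
      using tannerys_theorem[OF lim_k always_eventually summable_mult[OF s, of 9] sequentially_bot]
        bound by (simp add: case_prod_beta)
    then show ?thesis using tendsto_real_sqrt by fastforce
  qed
  show ?thesis
  proof (rule that[of U])
    show "simple_function M (U n)" for n
      unfolding U_def by (rule simple_function_finite_expansion) (rule q)
    show "U n \<omega> \<in> L2 \<Gamma>" for n \<omega> unfolding U_def by (intro L2_sum phi_L2) simp
  qed (fact sU conv)+
qed

text \<open>
  Since \<open>lam i \<ge> lam 0 > 0\<close>, the norm of order \<open>\<beta>\<close> dominates a multiple of the mean square norm.
\<close>

lemma Hdot_dual_of_L2:
  assumes f: "f \<in> L2 \<Gamma>" and \<beta>: "0 \<le> \<beta>"
  shows "(\<lambda>\<psi>. inn f \<psi>) \<in> Hdot_dual \<Gamma> \<phi> lam \<beta>"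
proof -
  define C where "C = L2_norm \<Gamma> f * sqrt (lam 0 powr (-\<beta>))"
  have "\<bar>inn f g\<bar> \<le> C * Hdot_norm \<Gamma> \<phi> lam \<beta> g" if g: "g \<in> Hdot \<Gamma> \<phi> lam \<beta>" for g
  proof -
    have gL: "g \<in> L2 \<Gamma>" and s: "summable (\<lambda>i. lam i powr \<beta> * (inn g (\<phi> i))\<^sup>2)" using g by (auto simp: Hdot_def)
    have "(\<lambda>i. (inn g (\<phi> i))\<^sup>2) sums inn g g" using Parseval[OF gL] by (simp add: inner_phi[OF gL])
    then have gg: "inn g g = (\<Sum>i. (inn g (\<phi> i))\<^sup>2)" and s1: "summable (\<lambda>i. (inn g (\<phi> i))\<^sup>2)"
      by (auto simp: sums_iff)
    note gg
    also have "(\<Sum>i. (inn g (\<phi> i))\<^sup>2) \<le> (\<Sum>i. lam 0 powr (-\<beta>) * (lam i powr \<beta> * (inn g (\<phi> i))\<^sup>2))"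
    proof (rule suminf_le[OF _ s1 summable_mult[OF s]])
      fix i
      have "lam 0 powr \<beta> \<le> lam i powr \<beta>" using lam_mono[of 0 i] lam_pos[of 0] \<beta> by (intro powr_mono2) auto
      then have "lam 0 powr (-\<beta>) * lam 0 powr \<beta> \<le> lam 0 powr (-\<beta>) * lam i powr \<beta>" by (rule mult_left_mono) simp
      then have "1 \<le> lam 0 powr (-\<beta>) * lam i powr \<beta>" using lam_pos[of 0] by (simp add: powr_add[symmetric])
      from mult_right_mono[OF this zero_le_power2[of "inn g (\<phi> i)"]]
      show "(inn g (\<phi> i))\<^sup>2 \<le> lam 0 powr (-\<beta>) * (lam i powr \<beta> * (inn g (\<phi> i))\<^sup>2)"
        by (simp add: mult.assoc)
    qed
    also have "\<dots> = lam 0 powr (-\<beta>) * (\<Sum>i. lam i powr \<beta> * (inn g (\<phi> i))\<^sup>2)" by (rule suminf_mult[OF s])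
    finally have "L2_norm \<Gamma> g \<le> sqrt (lam 0 powr (-\<beta>)) * Hdot_norm \<Gamma> \<phi> lam \<beta> g"
      unfolding L2_norm_def Hdot_norm_def by (simp add: real_sqrt_mult[symmetric])
    then have "L2_norm \<Gamma> f * L2_norm \<Gamma> g \<le> C * Hdot_norm \<Gamma> \<phi> lam \<beta> g"
      unfolding C_def mult.assoc by (rule mult_left_mono[OF _ L2_norm_nonneg])
    with L2_inner_bound[OF f gL] show ?thesis by linarith
  qed
  moreover have "inn f (\<lambda>e x. a * g e x + b * k e x) = a * inn f g + b * inn f k"
    if "g \<in> Hdot \<Gamma> \<phi> lam \<beta>" "k \<in> Hdot \<Gamma> \<phi> lam \<beta>" for g k a b
    using that f by (simp add: L2_inner_commute[of \<Gamma> f] L2_inner_add_left L2_inner_cmult_left L2_cmult Hdot_def)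
  ultimately show ?thesis unfolding Hdot_dual_def by blast
qed

text \<open>
  For a negative order the field acts as a functional, and its dual norm is the same weighted sum of
  \<open>(\<xi> i)\<^sup>2\<close>; the same approximations, read as functionals, serve both cases.
\<close>

lemma in_L2_Hdot_below:
  assumes s: "s < \<alpha> - 1/2" shows "in_L2_Hdot M \<Gamma> \<phi> lam s u"
proof (rule simple_approximations)
  fix U :: "nat \<Rightarrow> 'w \<Rightarrow> 'e graph_fun"
  assume U: "\<And>n. simple_function M (U n)" "\<And>n \<omega>. U n \<omega> \<in> L2 \<Gamma>"
    "\<And>n \<omega> s. summable (\<lambda>i. lam i powr s * (inn (U n \<omega>) (\<phi> i))\<^sup>2)"
    "\<And>s \<omega>. \<omega> \<in> space M \<Longrightarrow> summable (\<lambda>i. lam i powr s * (\<xi> i \<omega>)\<^sup>2) \<Longrightarrow>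
       (\<lambda>n. sqrt (\<Sum>i. lam i powr s * (inn (U n \<omega>) (\<phi> i) - \<xi> i \<omega>)\<^sup>2)) \<longlonglongrightarrow> 0"
  have AE: "AE \<omega> in M. u \<omega> \<in> L2 \<Gamma> \<and> summable (\<lambda>i. lam i powr s * (\<xi> i \<omega>)\<^sup>2)
      \<and> (\<lambda>n. sqrt (\<Sum>i. lam i powr s * (inn (U n \<omega>) (\<phi> i) - \<xi> i \<omega>)\<^sup>2)) \<longlonglongrightarrow> 0"
    using coefficients_summable(1)[OF s] u_L2 AE_space
  proof eventually_elim
    case (elim \<omega>)
    from elim(2) elim(1) U(4)[OF elim(3,1)] show ?case by (intro conjI)
  qed
  have int: "integrable M (\<lambda>\<omega>. (sqrt (\<Sum>i. lam i powr s * (\<xi> i \<omega>)\<^sup>2))\<^sup>2)"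
  proof (rule integrable_cong_AE_imp[OF coefficients_summable(2)[OF s]])
    show "(\<lambda>\<omega>. (sqrt (\<Sum>i. lam i powr s * (\<xi> i \<omega>)\<^sup>2))\<^sup>2) \<in> borel_measurable M"
      by (rule measurable_compose[OF borel_measurable_integrable[OF coefficients_summable(2)[OF s]]]) measurable
    show "AE \<omega> in M. (\<Sum>i. lam i powr s * (\<xi> i \<omega>)\<^sup>2) = (sqrt (\<Sum>i. lam i powr s * (\<xi> i \<omega>)\<^sup>2))\<^sup>2"
      using AE by eventually_elim (auto intro!: real_sqrt_pow2[symmetric] suminf_nonneg)
  qed
  show ?thesis
  proof (cases "0 \<le> s")
    case True
    have "u \<in> L2_Bochner M (Hdot \<Gamma> \<phi> lam s) (Hdot_norm \<Gamma> \<phi> lam s)"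
      unfolding L2_Bochner_def bochner_measurable_def
    proof (intro CollectI conjI exI[of _ U] allI)
      show "AE \<omega> in M. u \<omega> \<in> Hdot \<Gamma> \<phi> lam s"
        using AE by eventually_elim (simp add: Hdot_def \<xi>_def)
      show "simple_function M (U n)" for n by (rule U(1))
      show "U n ` space M \<subseteq> Hdot \<Gamma> \<phi> lam s" for n using U(2,3) by (auto simp: Hdot_def)
      show "AE \<omega> in M. (\<lambda>n. Hdot_norm \<Gamma> \<phi> lam s (U n \<omega> - u \<omega>)) \<longlonglongrightarrow> 0"
        using AE
      proof eventually_elim
        case (elim \<omega>)
        have "U n \<omega> - u \<omega> = (\<lambda>e x. U n \<omega> e x - u \<omega> e x)" for n by (intro ext) simp
        then have "inn (U n \<omega> - u \<omega>) (\<phi> i) = inn (U n \<omega>) (\<phi> i) - \<xi> i \<omega>" for n i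
          using L2_inner_diff_left[OF U(2) _ phi_L2] elim by (simp add: \<xi>_def)
        then show ?case using elim by (simp add: Hdot_norm_def)
      qed
      show "integrable M (\<lambda>\<omega>. (Hdot_norm \<Gamma> \<phi> lam s (u \<omega>))\<^sup>2)"
        using int by (simp add: Hdot_norm_def \<xi>_def)
    qed
    then show ?thesis using True by (simp add: in_L2_Hdot_def)
  next
    case False
    have "(\<lambda>\<omega> \<psi>. inn (u \<omega>) \<psi>) \<in> L2_Bochner M (Hdot_dual \<Gamma> \<phi> lam (-s)) (Hdot_dual_norm \<phi> lam (-s))"
      unfolding L2_Bochner_def bochner_measurable_def
    proof (intro CollectI conjI exI[of _ "\<lambda>n \<omega> \<psi>. inn (U n \<omega>) \<psi>"] allI)
      show "AE \<omega> in M. inn (u \<omega>) \<in> Hdot_dual \<Gamma> \<phi> lam (-s)"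
        using AE by eventually_elim (use False in \<open>auto intro: Hdot_dual_of_L2\<close>)
      show "simple_function M (\<lambda>\<omega>. inn (U n \<omega>))" for n
        using simple_function_compose[OF U(1), of inn n] by (simp add: o_def)
      show "(\<lambda>\<omega>. inn (U n \<omega>)) ` space M \<subseteq> Hdot_dual \<Gamma> \<phi> lam (-s)" for n
        using Hdot_dual_of_L2[OF U(2)] False by auto
      show "AE \<omega> in M. (\<lambda>n. Hdot_dual_norm \<phi> lam (-s) (inn (U n \<omega>) - inn (u \<omega>))) \<longlonglongrightarrow> 0"
        using AE by eventually_elim (simp add: Hdot_dual_norm_def \<xi>_def)
      show "integrable M (\<lambda>\<omega>. (Hdot_dual_norm \<phi> lam (-s) (inn (u \<omega>)))\<^sup>2)"
        using int by (simp add: Hdot_dual_norm_def \<xi>_def)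
    qed
    then show ?thesis using False by (simp add: in_L2_Hdot_def)
  qed
qed

end

theorem theorem1:
  fixes \<Gamma> :: "('v, 'e) metric_graph"
    and \<kappa> \<tau> \<alpha> :: real
    and \<phi> :: "nat \<Rightarrow> 'e graph_fun" and lam :: "nat \<Rightarrow> real"
    and M :: "'w measure"
    and W :: "'e graph_fun \<Rightarrow> 'w \<Rightarrow> real"
    and u :: "'w \<Rightarrow> 'e graph_fun"
    and alpha_star :: int
  assumes "compact_metric_graph \<Gamma>"
    and "\<kappa> > 0" and "\<tau> > 0" and "\<alpha> > 1/2"
    and "eigenbasis \<Gamma> \<kappa> \<phi> lam"
    and "prob_space M" and "complete_measure M"
    and "white_noise M \<Gamma> W"
    and "whittle_matern_solution M \<Gamma> \<phi> lam \<alpha> \<tau> W u"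
    and "alpha_star = \<lceil>\<alpha> - 1/2\<rceil> - 1"
  shows "(\<forall>\<epsilon>>0. in_L2_Hdot M \<Gamma> \<phi> lam (\<alpha> - 1/2 - \<epsilon>) u) \<and>
         ((AE \<omega> in M. u \<omega> \<in> H1 \<Gamma>) \<longleftrightarrow> \<alpha> > 3/2) \<and>
         (\<forall>j::nat. 1 \<le> j \<and> int j \<le> alpha_star \<longrightarrow>
            (AE \<omega> in M. weakly_differentiable \<Gamma> j (u \<omega>))) \<and>
         (\<alpha> \<ge> 2 \<longrightarrow> (\<forall>k::nat. odd k \<and> 1 \<le> k \<and> int k \<le> alpha_star - 1 \<longrightarrow>
            (AE \<omega> in M. weakly_differentiable \<Gamma> (k - 1) (u \<omega>) \<and>
               (\<forall>v\<in>verts (shape \<Gamma>). kirchhoff_at \<Gamma> v (weak_deriv \<Gamma> (k - 1) (u \<omega>))))))"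
proof -
  interpret prob_space M by fact
  interpret whittle_matern_field \<Gamma> \<kappa> \<phi> lam M W u \<tau> \<alpha>
    by unfold_locales fact+
  have below: "real j < \<alpha> - 1/2" if "int j \<le> alpha_star" for j
    using that assms(10) by linarith
  show ?thesis
  proof (intro conjI allI impI)
    show "in_L2_Hdot M \<Gamma> \<phi> lam (\<alpha> - 1/2 - \<epsilon>) u" if "0 < \<epsilon>" for \<epsilon>
      using that by (intro in_L2_Hdot_below) simp
    show "(AE \<omega> in M. u \<omega> \<in> H1 \<Gamma>) \<longleftrightarrow> \<alpha> > 3/2" by (rule AE_H1_iff)
    show "AE \<omega> in M. weakly_differentiable \<Gamma> j (u \<omega>)" if "1 \<le> j \<and> int j \<le> alpha_star" for j
      using that by (intro AE_weakly_differentiable below) simp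
    fix k :: nat assume k: "odd k \<and> 1 \<le> k \<and> int k \<le> alpha_star - 1"
    then have "real (k - 1 + 2) < \<alpha> - 1/2" by (intro below) simp
    moreover from this have "real (k - 1) < \<alpha> - 1/2" by simp
    moreover have "even (k - 1)" using k by simp
    ultimately show "AE \<omega> in M. weakly_differentiable \<Gamma> (k - 1) (u \<omega>) \<and>
       (\<forall>v\<in>verts (shape \<Gamma>). kirchhoff_at \<Gamma> v (weak_deriv \<Gamma> (k - 1) (u \<omega>)))"
      by (intro eventually_conj AE_weakly_differentiable AE_kirchhoff)
  qed
qed

end
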